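(* Consider the two-bidder auction setting described in the context. A pair $(q_1,q_2)$ of monotone functions, $q_i:[\underline v_i,\overline v_i]\to[0,1]$, is a reduced-form auction if and only if the associated quantile allocations $\tilde q_i(s):=q_i(G_i^{-1}(s))$, $s\in[0,1]$, satisfy $$\tilde q_1\preceq_w\tilde q_2^{-1}.$$ Moreover, every extreme point of this set satisfies $$\tilde q_1\equiv\tilde q_2^{-1}\,\mathbf 1_{[k_1,1]}\quad\text{and}\quad\tilde q_2\equiv\tilde q_1^{-1}\,\mathbf 1_{[k_2,1]}$$ for some $k_1,k_2\in[0,1]$.
   Context: There is one seller, one good, and two bidders. Bidder $i$ privately observes a value $v_i\in[\underline v_i,\overline v_i]$ drawn from a distribution $G_i$; $v_1,v_2$ are independent (possibly with different distributions). A mechanism is a (measurable) map $(p_1,p_2,t_1,t_2):[\underline v_1,\overline v_1]\times[\underline v_2,\overline v_2]\to[0,1]^2\times\mathbb R^2$ satisfying: (BIC) $\mathbb E_{v_{-i}}[p_i(v)v_i-t_i(v)]\ge\mathbb E_{v_{-i}}[p_i(\hat v_i,v_{-i})v_i-t_i(\hat v_i,v_{-i})]$ for all $i,v_i,\hat v_i$; (BIR) $\mathbb E_{v_{-i}}[p_i(v)v_i-t_i(v)]\ge0$ for all $i,v_i$; (Feasibility) $p_1(v)+p_2(v)\le1$ for all $v$. A pair of monotone (nondecreasing) functions $(q_1,q_2)$ is a reduced-form auction if there is a mechanism $(p,t)$ with $q_i(v_i)=\int p_i(v_i,v_{-i})\,G_{-i}(dv_{-i})$ for all $i$. For nondecreasing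 $g_1,g_2:[0,1]\to\mathbb R$, $g_1\preceq_w g_2$ ($g_2$ weakly majorizes $g_1$) means $\int_x^1g_1(z)\,dz\le\int_x^1g_2(z)\,dz$ for all $x\in[0,1]$. For a nondecreasing $g:[0,1]\to[0,1]$, $g^{-1}(z):=\inf\{x\in[0,1]:g(x)>z\}$ (with $\inf\emptyset=1$). $G_i^{-1}$ is the quantile function of $G_i$. Quantile allocations are identified when equal almost everywhere (equivalently, taken left-continuous), and $\equiv$ is equality almost everywhere. *)

theory Defs
  imports "HOL-Probability.Probability"
begin

text \<open>The underlying space of a value distribution is the interval itself, so that functions
  measurable on \<open>G1 \<Otimes>\<^sub>M G2\<close> are exactly the Borel functions on the rectangle of value profiles.
  Atoms and gaps in the support are allowed.\<close>

definition value_distribution :: "real \<Rightarrow> real \<Rightarrow> real measure \<Rightarrow> bool" where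
  "value_distribution lo hi G \<longleftrightarrow>
     prob_space G \<and> sets G = sets (restrict_space borel {lo..hi})"

text \<open>Expected utility of a bidder with value \<open>v\<close> who reports \<open>r\<close>. The first argument of \<open>p\<close> and
  \<open>t\<close> is the bidder's own report, the second one is the opponent's value, which is distributed
  according to \<open>H\<close>.\<close>

definition interim_utility ::
  "real measure \<Rightarrow> (real \<Rightarrow> real \<Rightarrow> real) \<Rightarrow> (real \<Rightarrow> real \<Rightarrow> real) \<Rightarrow> real \<Rightarrow> real \<Rightarrow> real" where
  "interim_utility H p t r v = (\<integral>w. p r w * v - t r w \<partial>H)"

definition bayes_incentive_compatible ::
  "real measure \<Rightarrow> real measure \<Rightarrow> (real \<Rightarrow> real \<Rightarrow> real) \<Rightarrow> (real \<Rightarrow> real \<Rightarrow> real) \<Rightarrow> bool" where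
  "bayes_incentive_compatible G H p t \<longleftrightarrow>
     (\<forall>v\<in>space G. \<forall>r\<in>space G. interim_utility H p t v v \<ge> interim_utility H p t r v)"

definition bayes_individually_rational ::
  "real measure \<Rightarrow> real measure \<Rightarrow> (real \<Rightarrow> real \<Rightarrow> real) \<Rightarrow> (real \<Rightarrow> real \<Rightarrow> real) \<Rightarrow> bool" where
  "bayes_individually_rational G H p t \<longleftrightarrow> (\<forall>v\<in>space G. interim_utility H p t v v \<ge> 0)"

text \<open>Here \<open>p1\<close>, \<open>p2\<close>, \<open>t1\<close>, \<open>t2\<close> all take the arguments in the order \<open>v1\<close>, \<open>v2\<close>.
  The integrability of the transfers makes the interim expectations well defined; the Bochner
  integral of a non-integrable function would silently be \<open>0\<close>.\<close>

definition mechanism ::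
  "real measure \<Rightarrow> real measure \<Rightarrow> (real \<Rightarrow> real \<Rightarrow> real) \<Rightarrow> (real \<Rightarrow> real \<Rightarrow> real) \<Rightarrow>
   (real \<Rightarrow> real \<Rightarrow> real) \<Rightarrow> (real \<Rightarrow> real \<Rightarrow> real) \<Rightarrow> bool" where
  "mechanism G1 G2 p1 p2 t1 t2 \<longleftrightarrow>
     case_prod p1 \<in> borel_measurable (G1 \<Otimes>\<^sub>M G2) \<and>
     case_prod p2 \<in> borel_measurable (G1 \<Otimes>\<^sub>M G2) \<and>
     case_prod t1 \<in> borel_measurable (G1 \<Otimes>\<^sub>M G2) \<and>
     case_prod t2 \<in> borel_measurable (G1 \<Otimes>\<^sub>M G2) \<and>
     (\<forall>v1\<in>space G1. integrable G2 (\<lambda>v2. t1 v1 v2)) \<and>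
     (\<forall>v2\<in>space G2. integrable G1 (\<lambda>v1. t2 v1 v2)) \<and>
     (\<forall>v1\<in>space G1. \<forall>v2\<in>space G2. p1 v1 v2 \<in> {0..1} \<and> p2 v1 v2 \<in> {0..1}) \<and>
     bayes_incentive_compatible G1 G2 p1 t1 \<and>
     bayes_incentive_compatible G2 G1 (\<lambda>v2 v1. p2 v1 v2) (\<lambda>v2 v1. t2 v1 v2) \<and>
     bayes_individually_rational G1 G2 p1 t1 \<and>
     bayes_individually_rational G2 G1 (\<lambda>v2 v1. p2 v1 v2) (\<lambda>v2 v1. t2 v1 v2) \<and>
     (\<forall>v1\<in>space G1. \<forall>v2\<in>space G2. p1 v1 v2 + p2 v1 v2 \<le> 1)"

definition reduced_form_auction ::
  "real measure \<Rightarrow> real measure \<Rightarrow> (real \<Rightarrow> real) \<Rightarrow> (real \<Rightarrow> real) \<Rightarrow> bool" where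
  "reduced_form_auction G1 G2 q1 q2 \<longleftrightarrow>
     mono_on (space G1) q1 \<and> mono_on (space G2) q2 \<and>
     (\<exists>p1 p2 t1 t2. mechanism G1 G2 p1 p2 t1 t2 \<and>
        (\<forall>v1\<in>space G1. q1 v1 = (\<integral>v2. p1 v1 v2 \<partial>G2)) \<and>
        (\<forall>v2\<in>space G2. q2 v2 = (\<integral>v1. p2 v1 v2 \<partial>G1)))"

text \<open>The quantile is meant for \<open>s\<close> in the unit interval; at \<open>s = 0\<close> it is the lower end of the
  value interval.\<close>

definition quantile :: "real measure \<Rightarrow> real \<Rightarrow> real" where
  "quantile G s = Inf {v \<in> space G. s \<le> measure G {w \<in> space G. w \<le> v}}"

definition quantile_allocation :: "real measure \<Rightarrow> (real \<Rightarrow> real) \<Rightarrow> real \<Rightarrow> real" where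
  "quantile_allocation G q s = q (quantile G s)"

definition mono_inverse :: "(real \<Rightarrow> real) \<Rightarrow> real \<Rightarrow> real" where
  "mono_inverse g z =
     (if {x \<in> {0..1}. g x > z} = {} then 1 else Inf {x \<in> {0..1}. g x > z})"

text \<open>Only meant for functions that are nondecreasing on the unit interval, for which the
  integrals exist.\<close>

definition weakly_majorized :: "(real \<Rightarrow> real) \<Rightarrow> (real \<Rightarrow> real) \<Rightarrow> bool"  (infix "\<preceq>\<^sub>w" 50) where
  "g1 \<preceq>\<^sub>w g2 \<longleftrightarrow> (\<forall>x\<in>{0..1}. (LBINT z:{x..1}. g1 z) \<le> (LBINT z:{x..1}. g2 z))"

definition ae_equal :: "(real \<Rightarrow> real) \<Rightarrow> (real \<Rightarrow> real) \<Rightarrow> bool"  (infix "\<equiv>\<^sub>a\<^sub>e" 50) where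
  "f \<equiv>\<^sub>a\<^sub>e g \<longleftrightarrow> (AE s in lborel. s \<in> {0..1} \<longrightarrow> f s = g s)"

definition reduced_form_quantile_pairs ::
  "real measure \<Rightarrow> real measure \<Rightarrow> ((real \<Rightarrow> real) \<times> (real \<Rightarrow> real)) set" where
  "reduced_form_quantile_pairs G1 G2 =
     {(quantile_allocation G1 q1, quantile_allocation G2 q2) | q1 q2.
        reduced_form_auction G1 G2 q1 q2}"

text \<open>Extreme points of a set of pairs of functions on the unit interval, where functions that
  are equal almost everywhere are identified: the point lies in the set and in no open segment
  between two distinct points of the set (compare \<open>extreme_point_of\<close>, which needs a vector space
  type and hence is not applicable to these equivalence classes).\<close>

definition ae_extreme_point ::
  "(real \<Rightarrow> real) \<times> (real \<Rightarrow> real) \<Rightarrow> ((real \<Rightarrow> real) \<times> (real \<Rightarrow> real)) set \<Rightarrow> bool" where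
  "ae_extreme_point f S \<longleftrightarrow>
     f \<in> S \<and>
     (\<forall>a\<in>S. \<forall>b\<in>S. \<forall>u. 0 < u \<and> u < 1 \<and>
        fst f \<equiv>\<^sub>a\<^sub>e (\<lambda>s. (1 - u) * fst a s + u * fst b s) \<and>
        snd f \<equiv>\<^sub>a\<^sub>e (\<lambda>s. (1 - u) * snd a s + u * snd b s) \<longrightarrow>
        fst a \<equiv>\<^sub>a\<^sub>e fst b \<and> snd a \<equiv>\<^sub>a\<^sub>e snd b)"

end

(* Border's condition for two bidders says that the slack
   1 - x y - int_x^1 r1 - int_y^1 r2 of the quantile allocations r1, r2 is nonnegative on the unit
   square; its minimum over y is attained at y = r2^-1(x) and equals int_x^1 (r2^-1 - r1).

   Sufficiency. Serving bidder 1 whenever his quantile exceeds q2(v2) gives a 0/1 kernel P(s, v2)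
   with row integrals r2^-1. Averaging P(., v2) over an interval of quantiles on which the tail
   integral of the row probabilities exceeds a tangent line of x |-> int_x^1 r1 cuts the tail
   integral down to that line, keeps P monotone in s and keeps the column integrals. For every v2 the
   tail integrals of P(., v2) decrease along countably many such cuts, so the kernels converge almost
   everywhere, to a kernel with row integrals r1. Its conditional expectation given the values is the
   allocation of bidder 1; bidder 2 receives a fixed fraction, depending on v2, of the rest.

   Extreme points. Perturb r_i to r_i + psi_i o r_i with psi_i nonexpansive and vanishing at 0 and 1;
   this keeps monotonicity and the atoms. The tight pairs (x, y) form a chain. In a gap of the chain
   either r1 takes infinitely many values and can be perturbed alone, or it stays away from the bounds
   of the gap, and r1 can be raised by a constant there while r2 is lowered. So the chain is a
   monotone curve down from (1, 1); below its lowest point both allocations vanish. *)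

theory Submission
  imports Defs
begin

section \<open>Border slack of a pair of monotone functions\<close>

text \<open>For fixed \<open>y\<close> the slack is convex in \<open>x\<close> with slope
  \<open>f x - y\<close>. A tight pair is therefore a minimum, which bounds \<open>f\<close> on
  either side of it, and a positive distance from that bound makes the slack grow linearly.
  Perturbations are capped so that their tail integrals are linear of the same order; this is what
  makes them affordable right up to a tight pair, where the slack has no positive lower bound. In
  the existence half the obstacle is compactness: a weak limit of allocations would be needed in
  general. Monotonicity of each section in the quantile replaces it, because convergence of tail
  integrals then forces pointwise convergence. Lines suffice as cuts since the target tail, being
  concave, is the infimum of its tangents at rational points, and a concave tail exceeds a line on a
  single interval. Two repairs come after the limit. Several quantiles may belong to one value, so
  the kernel has to be averaged over them. Interim probabilities are then correct only almost
  everywhere, while a reduced form prescribes them at every value.\<close>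

lemmas interval_integral_combine = Henstock_Kurzweil_Integration.integral_combine
lemmas Bochner_integral_cong = Bochner_Integration.integral_cong

lemma integral_le_open_interval:
  fixes f g :: "real \<Rightarrow> real"
  assumes "f integrable_on {a..b}" "g integrable_on {a..b}" "\<And>s. a < s \<Longrightarrow> s < b \<Longrightarrow> f s \<le> g s"
  shows "integral {a..b} f \<le> integral {a..b} g"
proof -
  have "integral {a<..<b} f \<le> integral {a<..<b} g"
    using assms by (intro integral_le) (auto simp: integrable_on_open_interval_real)
  then show ?thesis
    by (simp add: integral_open_interval_real)
qed

lemma integral_const_open_interval:
  fixes f :: "real \<Rightarrow> real"
  assumes "a \<le> b" "f integrable_on {a..b}" "\<And>s. a < s \<Longrightarrow> s < b \<Longrightarrow> f s = c"
  shows "integral {a..b} f = c * (b - a)"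
proof -
  have "integral {a..b} f \<le> integral {a..b} (\<lambda>_. c)" "integral {a..b} (\<lambda>_. c) \<le> integral {a..b} f"
    using assms by (auto intro!: integral_le_open_interval simp del: integral_const_real)
  then show ?thesis
    using assms(1) by (simp add: mult.commute)
qed

section \<open>Bumps on the value axis and admissible perturbations\<close>

definition tent :: "real \<Rightarrow> real \<Rightarrow> real \<Rightarrow> real" where
  "tent a b z = max 0 (min (z - a) (b - z))"

text \<open>The condition is invariant under change of sign and makes both
  \<open>z + \<psi> z\<close> and \<open>z - \<psi> z\<close> nondecreasing self-maps of the unit
  interval, so a single \<open>\<psi>\<close> supplies both ends of a segment through an
  allocation.\<close>

definition admissible :: "(real \<Rightarrow> real) \<Rightarrow> bool" where
  "admissible \<psi> \<longleftrightarrow> (\<forall>x y. x \<le> y \<longrightarrow> \<bar>\<psi> y - \<psi> x\<bar> \<le> y - x) \<and> \<psi> 0 = 0 \<and> \<psi> 1 = 0"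

lemma tent_nonneg: "0 \<le> tent a b z"
  by (simp add: tent_def)

lemma tent_le_one: "0 \<le> a \<Longrightarrow> b \<le> 1 \<Longrightarrow> tent a b z \<le> 1"
  by (auto simp: tent_def)

lemma tent_lipschitz: "x \<le> y \<Longrightarrow> \<bar>tent a b y - tent a b x\<bar> \<le> y - x"
  by (auto simp: tent_def)

lemma admissible_tent: "0 \<le> a \<Longrightarrow> b \<le> 1 \<Longrightarrow> admissible (tent a b)"
  by (auto simp: admissible_def tent_def)

lemma admissible_min_tent: "0 \<le> a \<Longrightarrow> b \<le> 1 \<Longrightarrow> 0 \<le> k \<Longrightarrow> admissible (\<lambda>z. min k (tent a b z))"
unfolding admissible_def
proof (intro conjI allI impI)
  fix x y :: real assume "x \<le> y"
  then have "\<bar>tent a b y - tent a b x\<bar> \<le> y - x" by (rule tent_lipschitz)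
  then show "\<bar>min k (tent a b y) - min k (tent a b x)\<bar> \<le> y - x"
    using \<open>x \<le> y\<close> by (smt (verit) min_def)
qed (simp_all add: tent_def)

lemma admissible_scale:
  assumes "admissible \<psi>" "\<bar>c\<bar> \<le> 1"
  shows "admissible (\<lambda>z. c * \<psi> z)"
proof -
  have "\<bar>c * \<psi> y - c * \<psi> x\<bar> \<le> y - x" if "x \<le> y" for x y
  proof -
    have "\<bar>c * \<psi> y - c * \<psi> x\<bar> = \<bar>c\<bar> * \<bar>\<psi> y - \<psi> x\<bar>"
      by (simp add: abs_mult[symmetric] right_diff_distrib)
    also have "\<dots> \<le> 1 * (y - x)"
      using assms that by (intro mult_mono) (auto simp: admissible_def)
    finally show ?thesis by simp
  qed
  then show ?thesis
    using assms by (auto simp: admissible_def)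
qed

lemma admissible_zero: "admissible (\<lambda>_. 0)"
  by (auto simp: admissible_def)

text \<open>The composition need not be monotone, but it is the difference of the monotone functions
  \<open>f s + \<psi> (f s)\<close> and \<open>f s\<close>.\<close>

lemma integrable_admissible:
  fixes f :: "real \<Rightarrow> real"
  assumes "admissible \<psi>" "mono_on {a..b} f"
  shows "(\<lambda>s. \<psi> (f s)) integrable_on {a..b}"
proof -
  have "mono_on {a..b} (\<lambda>s. f s + \<psi> (f s))"
  proof (rule mono_onI)
    fix r s assume "r \<in> {a..b}" "s \<in> {a..b}" "r \<le> s"
    with assms(2) have "f r \<le> f s" by (auto simp: mono_on_def)
    with assms(1) have "\<bar>\<psi> (f s) - \<psi> (f r)\<bar> \<le> f s - f r" by (auto simp: admissible_def)
    then show "f r + \<psi> (f r) \<le> f s + \<psi> (f s)" by linarith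
  qed
  then have "(\<lambda>s. (f s + \<psi> (f s)) - f s) integrable_on {a..b}"
    using assms(2) by (intro integrable_diff integrable_on_mono_on)
  then show ?thesis by simp
qed

text \<open>For independent uniform quantiles, \<open>1 - x * y\<close> is the probability that
  bidder 1 lies above \<open>x\<close> or bidder 2 above \<open>y\<close>; the integrals are the
  probabilities that bidder 1 wins from above \<open>x\<close> and that bidder 2 wins from above
  \<open>y\<close>.\<close>

definition border_slack :: "(real \<Rightarrow> real) \<Rightarrow> (real \<Rightarrow> real) \<Rightarrow> real \<Rightarrow> real \<Rightarrow> real" where
  "border_slack f g x y = 1 - x * y - integral {x..1} f - integral {y..1} g"

lemma border_slack_swap: "border_slack g f y x = border_slack f g x y"
  by (simp add: border_slack_def mult.commute)

locale border_pair =
  fixes f g :: "real \<Rightarrow> real"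
  assumes mono_f: "mono_on {0..1} f" and range_f: "f \<in> {0..1} \<rightarrow> {0..1}"
    and mono_g: "mono_on {0..1} g" and range_g: "g \<in> {0..1} \<rightarrow> {0..1}"
    and slack_nonneg: "x \<in> {0..1} \<Longrightarrow> y \<in> {0..1} \<Longrightarrow> 0 \<le> border_slack f g x y"
begin

abbreviation slack :: "real \<Rightarrow> real \<Rightarrow> real" where "slack \<equiv> border_slack f g"

text \<open>By this symmetry every fact about \<open>f\<close> along \<open>x\<close> also serves
  \<open>g\<close> along \<open>y\<close>.\<close>

lemma swap: "border_pair g f"
  using mono_f range_f mono_g range_g slack_nonneg
  by unfold_locales (auto simp: border_slack_swap)

lemma fD: "0 \<le> x \<Longrightarrow> x \<le> y \<Longrightarrow> y \<le> 1 \<Longrightarrow> f x \<le> f y"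
  using mono_f by (auto simp: mono_on_def)

lemma f_range: "0 \<le> x \<Longrightarrow> x \<le> 1 \<Longrightarrow> 0 \<le> f x \<and> f x \<le> 1"
  using range_f by (auto simp: Pi_iff)

lemma f_int: "0 \<le> a \<Longrightarrow> b \<le> 1 \<Longrightarrow> f integrable_on {a..b}"
  using mono_f by (intro integrable_on_mono_on) (auto simp: mono_on_def)

lemma adm_int: "admissible \<psi> \<Longrightarrow> 0 \<le> a \<Longrightarrow> b \<le> 1 \<Longrightarrow> (\<lambda>s. \<psi> (f s)) integrable_on {a..b}"
  using mono_f by (intro integrable_admissible) (auto simp: mono_on_def)

lemma int_lower: "0 \<le> x \<Longrightarrow> x \<le> z \<Longrightarrow> z \<le> 1 \<Longrightarrow> (z - x) * f x \<le> integral {x..z} f"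
  using integral_le_open_interval[of "\<lambda>_. f x" x z f] f_int[of x z] fD by auto

lemma int_upper: "0 \<le> x \<Longrightarrow> x \<le> z \<Longrightarrow> z \<le> 1 \<Longrightarrow> integral {x..z} f \<le> (z - x) * f z"
  using integral_le_open_interval[of f x z "\<lambda>_. f z"] f_int[of x z] fD by auto

text \<open>In integrated form: the slope of the slack in \<open>x\<close> is
  \<open>f x - y\<close>. As \<open>f\<close> is nondecreasing, the slack is convex in
  \<open>x\<close> for each \<open>y\<close>.\<close>

lemma slack_diff:
  assumes "0 \<le> x" "x \<le> z" "z \<le> 1"
  shows "slack x y = slack z y + y * (z - x) - integral {x..z} f"
  using interval_integral_combine[of x z 1 f] f_int[of x 1] assms
  by (simp add: border_slack_def algebra_simps)

lemma slack_continuous: "continuous_on ({0..1} \<times> {0..1}) (\<lambda>p. slack (fst p) (snd p))"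
proof -
  have f: "continuous_on {0..1} (\<lambda>x. integral {x..1} f)"
    and g: "continuous_on {0..1} (\<lambda>x. integral {x..1} g)"
    using mono_f mono_g by (auto intro!: indefinite_integral_continuous_1' integrable_on_mono_on)
  have fs: "continuous_on ({0..1} \<times> {0..1}) (fst :: real \<times> real \<Rightarrow> real)"
    "continuous_on ({0..1} \<times> {0..1}) (snd :: real \<times> real \<Rightarrow> real)"
    by (intro continuous_on_fst continuous_on_snd continuous_on_id)+
  have "continuous_on ({0..1} \<times> {0..1}) (\<lambda>p :: real \<times> real. integral {fst p..1} f)"
    by (rule continuous_on_compose2[OF f fs(1)]) (simp add: fst_image_times)
  moreover have "continuous_on ({0..1} \<times> {0..1}) (\<lambda>p :: real \<times> real. integral {snd p..1} g)"
    by (rule continuous_on_compose2[OF g fs(2)]) (simp add: snd_image_times)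
  ultimately show ?thesis
    unfolding border_slack_def by (intro continuous_intros)
qed

section \<open>Tight pairs: chain property and consequences of convexity\<close>

lemma slack_one: "slack 1 1 = 0"
  by (simp add: border_slack_def)

text \<open>Strict supermodularity of \<open>- x * y\<close> makes the set of tight pairs a chain.\<close>

lemma tight_chain:
  assumes "x \<in> {0..1}" "y \<in> {0..1}" "x' \<in> {0..1}" "y' \<in> {0..1}"
    "slack x y = 0" "slack x' y' = 0" "x < x'"
  shows "y \<le> y'"
proof (rule ccontr)
  assume "\<not> y \<le> y'"
  then have "0 < (x' - x) * (y - y')" using assms by simp
  moreover have "slack x y + slack x' y' =
      slack x y' + slack x' y + (x' - x) * (y - y')"
    by (simp add: border_slack_def algebra_simps)
  moreover have "0 \<le> slack x y'" "0 \<le> slack x' y"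
    using assms slack_nonneg by auto
  ultimately show False using assms by linarith
qed

text \<open>A nonnegative convex function with two zeros vanishes between them. Concretely, positive
  slack at \<open>x\<close> forces \<open>f x < y\<close>, so the slack decreases up to
  \<open>x\<close> and is larger still at \<open>a\<close>.\<close>

lemma tight_convex:
  assumes "0 \<le> a" "a < x" "x < b" "b \<le> 1" "y \<in> {0..1}"
    "slack a y = 0" "slack b y = 0"
  shows "slack x y = 0"
proof (rule ccontr)
  assume "slack x y \<noteq> 0"
  with slack_nonneg[of x y] assms have pos: "0 < slack x y" by auto
  have "slack x y = y * (b - x) - integral {x..b} f"
    using slack_diff[of x b y] assms by simp
  with int_lower[of x b] assms have "slack x y \<le> (b - x) * (y - f x)"
    by (simp add: algebra_simps)
  with pos have "0 < (b - x) * (y - f x)" by linarith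
  then have "f x < y" using assms by (simp add: zero_less_mult_iff)
  then have "0 < (x - a) * (y - f x)" using assms by simp
  moreover have "slack a y = slack x y + y * (x - a) - integral {a..x} f"
    using slack_diff[of a x y] assms by simp
  moreover have "integral {a..x} f \<le> (x - a) * f x" using int_upper[of a x] assms by simp
  ultimately show False using pos assms by (simp add: algebra_simps)
qed

text \<open>As the slack is nonnegative, \<open>b\<close> minimizes it in \<open>x\<close> at height
  \<open>d\<close>; convexity makes the slope \<open>f s - d\<close> nonpositive to the left of
  \<open>b\<close>. A zero slope at \<open>s\<close> makes \<open>s\<close> another
  minimizer.\<close>

lemma tight_upper:
  assumes "b \<in> {0..1}" "d \<in> {0..1}" "slack b d = 0" "0 \<le> s" "s < b"
  shows "f s \<le> d" and "f s = d \<Longrightarrow> slack s d = 0"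
proof -
  have *: "slack s d = d * (b - s) - integral {s..b} f"
    using slack_diff[of s b d] assms by simp
  also have "\<dots> \<le> (b - s) * (d - f s)"
    using int_lower[of s b] assms by (simp add: algebra_simps)
  finally have le: "slack s d \<le> (b - s) * (d - f s)" .
  moreover have nn: "0 \<le> slack s d"
    using slack_nonneg assms by auto
  ultimately have "0 \<le> (b - s) * (d - f s)" by linarith
  then show "f s \<le> d" using assms by (simp add: zero_le_mult_iff)
  show "slack s d = 0" if "f s = d" using le nn that by simp
qed

lemma tight_lower:
  assumes "a \<in> {0..1}" "c \<in> {0..1}" "slack a c = 0" "a < s" "s \<le> 1"
  shows "c \<le> f s" and "f s = c \<Longrightarrow> slack s c = 0"
proof -
  have *: "slack s c = integral {a..s} f - c * (s - a)"
    using slack_diff[of a s c] assms by simp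
  also have "\<dots> \<le> (s - a) * (f s - c)"
    using int_upper[of a s] assms by (simp add: algebra_simps)
  finally have le: "slack s c \<le> (s - a) * (f s - c)" .
  moreover have nn: "0 \<le> slack s c"
    using slack_nonneg assms by auto
  ultimately have "0 \<le> (s - a) * (f s - c)" by linarith
  then show "c \<le> f s" using assms by (simp add: zero_le_mult_iff)
  show "slack s c = 0" if "f s = c" using le nn that by simp
qed

section \<open>Lower bounds of the slack away from tight pairs and next to them\<close>

lemma slack_bounded_below:
  assumes "0 \<le> a" "a \<le> b" "b \<le> 1"
    "\<And>x y. a \<le> x \<Longrightarrow> x \<le> b \<Longrightarrow> y \<in> {0..1} \<Longrightarrow> slack x y \<noteq> 0"
  obtains \<eta> where "0 < \<eta>"
    "\<And>x y. a \<le> x \<Longrightarrow> x \<le> b \<Longrightarrow> y \<in> {0..1} \<Longrightarrow> \<eta> \<le> slack x y"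
proof -
  have "continuous_on ({a..b} \<times> {0..1}) (\<lambda>p. slack (fst p) (snd p))"
    using assms by (auto intro: continuous_on_subset[OF slack_continuous])
  then obtain p where p: "p \<in> {a..b} \<times> {0..1}"
    "\<forall>q\<in>{a..b} \<times> {0..1}. slack (fst p) (snd p) \<le> slack (fst q) (snd q)"
    using continuous_attains_inf[of "{a..b} \<times> {0..1::real}" "\<lambda>p. slack (fst p) (snd p)"]
      assms by (auto simp: compact_Times)
  show ?thesis
  proof
    show "0 < slack (fst p) (snd p)"
      using p(1) assms slack_nonneg[of "fst p" "snd p"]
      by (auto simp: less_le mem_Times_iff)
  qed (use p(2) in auto)
qed

text \<open>Up to \<open>- x * y\<close> the slack is a function of \<open>x\<close> plus a function
  of \<open>y\<close>; this expands it at a tight corner, with the bilinear remainder.\<close>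

lemma slack_corner:
  assumes "slack b d = 0"
  shows "slack x y = slack x d + slack b y - (b - x) * (d - y)"
  using assms by (simp add: border_slack_def algebra_simps)

text \<open>With \<open>f\<close> at distance \<open>k\<close> below \<open>d\<close>, the slack
  along \<open>y = d\<close> grows at rate at least \<open>k\<close> to the left of
  \<open>b\<close>. For \<open>y\<close> at most \<open>k / 2\<close> below \<open>d\<close> the
  bilinear remainder consumes at most half of this growth; the other half is left for
  perturbations.\<close>

lemma slack_upper_corner:
  assumes "b \<in> {0..1}" "d \<in> {0..1}" "slack b d = 0" "0 < k"
    "\<And>s. 0 \<le> s \<Longrightarrow> s < b \<Longrightarrow> f s \<le> d - k"
    and "x \<in> {0..1}" "y \<in> {0..1}" "d - k / 2 \<le> y"
  shows "k / 2 * max 0 (b - x) + (if y \<le> d then slack b y else 0) \<le> slack x y"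
proof -
  have nn: "0 \<le> slack x y" "0 \<le> slack x d" "0 \<le> slack b y"
    using assms slack_nonneg by auto
  have U: "k * (b - x) \<le> slack x d" if "x \<le> b"
  proof -
    have "integral {x..b} f \<le> integral {x..b} (\<lambda>_. d - k)"
      using assms by (intro integral_le_open_interval f_int) auto
    then have "integral {x..b} f \<le> (b - x) * (d - k)" using that by simp
    with slack_diff[of x b d] that assms show ?thesis by (simp add: algebra_simps)
  qed
  note eq = slack_corner[OF assms(3), of x y]
  \<comment> \<open>The remainder is harmful only when both coordinates lie on the same side of the
    corner. Below it, the growth rate compensates; above it, the claimed bound is zero.\<close>
  consider "x \<le> b" "y \<le> d" | "x \<le> b" "d < y" | "b < x" "y \<le> d" | "b < x" "d < y" by linarith
  then show ?thesis
  proof cases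
    case 1
    have "(b - x) * (d - y) \<le> (b - x) * (k / 2)"
      using 1 assms by (intro mult_left_mono) auto
    with U 1 eq have "k / 2 * (b - x) + slack b y \<le> slack x y"
      by (simp add: mult.commute[of k])
    with 1 show ?thesis by (simp add: max_def)
  next
    case 2
    have "(b - x) * (d - y) \<le> 0" using 2 by (simp add: mult_nonneg_nonpos)
    moreover have "0 \<le> k * (b - x)" using 2 assms by simp
    ultimately show ?thesis using U 2 eq nn by (simp add: max_def)
  next
    case 3
    have "(b - x) * (d - y) \<le> 0" using 3 by (simp add: mult_nonpos_nonneg)
    with 3 eq nn show ?thesis by (simp add: max_def)
  next
    case 4
    with nn show ?thesis by simp
  qed
qed

lemma slack_lower_corner:
  assumes "a \<in> {0..1}" "c \<in> {0..1}" "slack a c = 0" "0 < k"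
    "\<And>s. a < s \<Longrightarrow> s \<le> 1 \<Longrightarrow> c + k \<le> f s"
    and "x \<in> {0..1}" "y \<in> {0..1}" "y \<le> c + k / 2"
  shows "k / 2 * max 0 (x - a) + (if c \<le> y then slack a y else 0) \<le> slack x y"
proof -
  have nn: "0 \<le> slack x y" "0 \<le> slack x c" "0 \<le> slack a y"
    using assms slack_nonneg by auto
  have U: "k * (x - a) \<le> slack x c" if "a \<le> x"
  proof -
    have "integral {a..x} (\<lambda>_. c + k) \<le> integral {a..x} f"
      using assms by (intro integral_le_open_interval f_int) auto
    then have "(x - a) * (c + k) \<le> integral {a..x} f" using that by simp
    with slack_diff[of a x c] that assms show ?thesis by (simp add: algebra_simps)
  qed
  have eq: "slack x y = slack x c + slack a y - (x - a) * (y - c)"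
    using slack_corner[OF assms(3), of x y] by (simp add: algebra_simps)
  consider "a \<le> x" "c \<le> y" | "a \<le> x" "y < c" | "x < a" "c \<le> y" | "x < a" "y < c" by linarith
  then show ?thesis
  proof cases
    case 1
    have "(x - a) * (y - c) \<le> (x - a) * (k / 2)"
      using 1 assms by (intro mult_left_mono) auto
    with U 1 eq have "k / 2 * (x - a) + slack a y \<le> slack x y"
      by (simp add: mult.commute[of k])
    with 1 show ?thesis by (simp add: max_def)
  next
    case 2
    have "(x - a) * (y - c) \<le> 0" using 2 by (simp add: mult_nonneg_nonpos)
    moreover have "0 \<le> k * (x - a)" using 2 assms by simp
    ultimately show ?thesis using U 2 eq nn by (simp add: max_def)
  next
    case 3
    have "(x - a) * (y - c) \<le> 0" using 3 by (simp add: mult_nonpos_nonneg)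
    with 3 eq nn show ?thesis by (simp add: max_def)
  next
    case 4
    with nn show ?thesis by simp
  qed
qed

text \<open>\<open>f\<close> may jump over the support of the tent, so positivity is drawn from two
  points with values inside it, between which the tent of \<open>f\<close> is bounded below.\<close>

lemma integral_tent_pos:
  assumes "0 \<le> a" "b \<le> 1" "0 \<le> p" "p < q" "q \<le> 1" "a < f p" "f q < b"
  shows "0 < integral {0..1} (\<lambda>s. tent a b (f s))"
proof -
  note int = adm_int[OF admissible_tent[OF assms(1,2)]]
  have "0 < (q - p) * min (f p - a) (b - f q)" using assms by simp
  also have "\<dots> = integral {p..q} (\<lambda>_. min (f p - a) (b - f q))" using assms by simp
  also have "\<dots> \<le> integral {p..q} (\<lambda>s. tent a b (f s))"
  proof (rule integral_le_open_interval)
    fix s assume "p < s" "s < q"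
    then have "f p \<le> f s" "f s \<le> f q" using fD assms by auto
    then show "min (f p - a) (b - f q) \<le> tent a b (f s)" by (auto simp: tent_def)
  qed (use int assms in auto)
  also have "\<dots> \<le> integral {0..1} (\<lambda>s. tent a b (f s))"
    using int assms by (intro integral_subset_le) (auto simp: tent_nonneg)
  finally show ?thesis .
qed

lemma integral_tent_le_one:
  assumes "0 \<le> a" "b \<le> 1"
  shows "integral {0..1} (\<lambda>s. tent a b (f s)) \<le> 1"
proof -
  have "integral {0..1} (\<lambda>s. tent a b (f s)) \<le> integral {0..1::real} (\<lambda>_. 1)"
    using assms adm_int[OF admissible_tent[OF assms]]
    by (intro integral_le_open_interval) (auto simp: tent_le_one)
  then show ?thesis by simp
qed

end

section \<open>The set of tight pairs\<close>

text \<open>Linear in the distance to the edge of the support, so that it can be set against the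
  corner bounds of the slack.\<close>

lemma integral_upper_support:
  fixes h :: "real \<Rightarrow> real"
  assumes "h integrable_on {0..1}" "x \<in> {0..1}" "b \<in> {0..1}"
    "\<And>s. b < s \<Longrightarrow> s < 1 \<Longrightarrow> h s = 0" "\<And>s. 0 \<le> s \<Longrightarrow> s \<le> 1 \<Longrightarrow> h s \<le> k"
  shows "integral {x..1} h \<le> k * max 0 (b - x)"
proof -
  have int: "h integrable_on {u..v}" if "0 \<le> u" "v \<le> 1" for u v
    using that by (intro integrable_on_subinterval[OF assms(1)]) auto
  show ?thesis
  proof (cases "x \<le> b")
    case True
    have "integral {b..1} h = 0"
      using integral_const_open_interval[of b 1 h 0] int assms by auto
    moreover have "integral {x..b} h \<le> integral {x..b} (\<lambda>_. k)"
      using int assms by (intro integral_le_open_interval) auto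
    ultimately show ?thesis
      using interval_integral_combine[of x b 1 h] int[of x 1] True assms
      by (simp add: mult.commute)
  next
    case False
    then show ?thesis
      using integral_const_open_interval[of x 1 h 0] int assms by auto
  qed
qed

lemma integral_lower_support:
  fixes h :: "real \<Rightarrow> real"
  assumes "h integrable_on {0..1}" "x \<in> {0..1}" "a \<in> {0..1}"
    "\<And>s. 0 < s \<Longrightarrow> s < a \<Longrightarrow> h s = 0" "\<And>s. 0 \<le> s \<Longrightarrow> s \<le> 1 \<Longrightarrow> h s \<le> k"
  shows "integral {0..x} h \<le> k * max 0 (x - a)"
proof -
  have int: "h integrable_on {u..v}" if "0 \<le> u" "v \<le> 1" for u v
    using that by (intro integrable_on_subinterval[OF assms(1)]) auto
  show ?thesis
  proof (cases "a \<le> x")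
    case True
    have "integral {0..a} h = 0"
      using integral_const_open_interval[of 0 a h 0] int assms by auto
    moreover have "integral {a..x} h \<le> integral {a..x} (\<lambda>_. k)"
      using int assms by (intro integral_le_open_interval) auto
    ultimately show ?thesis
      using interval_integral_combine[of 0 a x h] int[of 0 x] True assms
      by (simp add: mult.commute)
  next
    case False
    then show ?thesis
      using integral_const_open_interval[of 0 x h 0] int assms by auto
  qed
qed

text \<open>Extremality with the distributions abstracted away: the absolute value says that the
  perturbation is affordable with both signs, and such a perturbation must vanish almost
  everywhere.\<close>

locale rigid_pair = border_pair +
  assumes rigid: "\<lbrakk>admissible \<psi>; admissible \<phi>;
      \<And>x y. x \<in> {0..1} \<Longrightarrow> y \<in> {0..1} \<Longrightarrow>
        \<bar>integral {x..1} (\<lambda>s. \<psi> (f s)) + integral {y..1} (\<lambda>s. \<phi> (g s))\<bar> \<le> border_slack f g x y\<rbrakk>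
    \<Longrightarrow> integral {0..1} (\<lambda>s. \<bar>\<psi> (f s)\<bar>) = 0 \<and> integral {0..1} (\<lambda>s. \<bar>\<phi> (g s)\<bar>) = 0"
begin

lemma rigid_swap: "rigid_pair g f"
proof -
  interpret s: border_pair g f by (rule swap)
  show ?thesis
  proof
    fix \<psi> \<phi> :: "real \<Rightarrow> real"
    assume "admissible \<psi>" "admissible \<phi>"
      and le: "\<And>x y. x \<in> {0..1} \<Longrightarrow> y \<in> {0..1} \<Longrightarrow>
        \<bar>integral {x..1} (\<lambda>s. \<psi> (g s)) + integral {y..1} (\<lambda>s. \<phi> (f s))\<bar> \<le> border_slack g f x y"
    moreover have "\<bar>integral {x..1} (\<lambda>s. \<phi> (f s)) + integral {y..1} (\<lambda>s. \<psi> (g s))\<bar> \<le> slack x y"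
      if "x \<in> {0..1}" "y \<in> {0..1}" for x y
      using le[OF that(2,1)] by (simp only: border_slack_swap[of g f] add.commute)
    ultimately have "integral {0..1} (\<lambda>s. \<bar>\<phi> (f s)\<bar>) = 0 \<and> integral {0..1} (\<lambda>s. \<bar>\<psi> (g s)\<bar>) = 0"
      by (intro rigid)
    then show "integral {0..1} (\<lambda>s. \<bar>\<psi> (g s)\<bar>) = 0 \<and> integral {0..1} (\<lambda>s. \<bar>\<phi> (f s)\<bar>) = 0"
      by simp
  qed
qed

text \<open>Infinitely many values leave room for two bumps of opposite sign on disjoint ranges of
  values, weighted to cancel in total. They change tail integrals only inside the interval, on a
  compact part of which the slack is bounded away from zero.\<close>

lemma finite_values:
  assumes ab: "0 \<le> \<alpha>" "\<beta> \<le> 1"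
    and nt: "\<And>x y. \<alpha> < x \<Longrightarrow> x < \<beta> \<Longrightarrow> y \<in> {0..1} \<Longrightarrow> slack x y \<noteq> 0"
  shows "finite (f ` {\<alpha><..<\<beta>})"
proof (rule ccontr)
  assume "infinite (f ` {\<alpha><..<\<beta>})"
  \<comment> \<open>Seven values: \<open>z 0\<close>, \<open>z 3\<close> and \<open>z 6\<close>
    bound two adjacent tents, and two further values lie inside each, as
    \<open>integral_tent_pos\<close> demands.\<close>
  then obtain B where B: "B \<subseteq> f ` {\<alpha><..<\<beta>}" "finite B" "card B = 7"
    by (metis infinite_arbitrarily_large)
  define z where "z = (!) (sorted_list_of_set B)"
  have len: "length (sorted_list_of_set B) = 7"
    using B by simp
  have "z i \<in> f ` {\<alpha><..<\<beta>}" if "i < 7" for i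
    using B that len nth_mem[of i "sorted_list_of_set B"] by (auto simp: z_def)
  then have "\<forall>i<7. \<exists>x. \<alpha> < x \<and> x < \<beta> \<and> f x = z i"
    by (metis (no_types, lifting) greaterThanLessThan_iff imageE)
  then obtain x where x: "\<alpha> < x i" "x i < \<beta>" "f (x i) = z i" if "i < 7" for i
    by metis
  have z: "z i < z j" if "i < j" "j < 7" for i j
    using sorted_wrt_nth_less[OF sorted_list_of_set.strict_sorted_key_list_of_set, of i j B] that len
    by (simp add: z_def)
  have xl: "x i < x j" if "i < j" "j < 7" for i j
    using z[OF that] x[of i] x[of j] fD[of "x j" "x i"] that ab by force
  have z01: "0 \<le> z i" "z i \<le> 1" if "i < 7" for i
    using f_range[of "x i"] x[of i] that ab by force+
  have x01: "0 \<le> x i" "x i \<le> 1" if "i < 7" for i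
    using x[of i] that ab by force+
  let ?t1 = "tent (z 0) (z 3)" and ?t2 = "tent (z 3) (z 6)"
  define m1 where "m1 = integral {0..1} (\<lambda>s. ?t1 (f s))"
  define m2 where "m2 = integral {0..1} (\<lambda>s. ?t2 (f s))"
  have m1: "0 < m1" "m1 \<le> 1"
    unfolding m1_def using z z01 x x01 xl
    by (intro integral_tent_pos[of _ _ "x 1" "x 2"] integral_tent_le_one; simp)+
  have m2: "0 < m2" "m2 \<le> 1"
    unfolding m2_def using z z01 x x01 xl
    by (intro integral_tent_pos[of _ _ "x 4" "x 5"] integral_tent_le_one; simp)+
  obtain \<eta> where \<eta>: "0 < \<eta>"
    "\<And>u y. x 0 \<le> u \<Longrightarrow> u \<le> x 6 \<Longrightarrow> y \<in> {0..1} \<Longrightarrow> \<eta> \<le> slack u y"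
  proof (rule slack_bounded_below[of "x 0" "x 6"])
    show "slack u y \<noteq> 0" if "x 0 \<le> u" "u \<le> x 6" "y \<in> {0..1}" for u y
      using nt[of u y] that x[of 0] x[of 6] by simp
  qed (use x01[of 0] x01[of 6] xl[of 0 6] in auto)
  \<comment> \<open>The bound \<open>1 / 2\<close> keeps the weighted difference of two tents
    nonexpansive; the bound \<open>\<eta>\<close> keeps its tail integrals under the slack.\<close>
  define e where "e = min (1 / 2) \<eta>"
  have e: "0 < e" "e \<le> 1 / 2" "e \<le> \<eta>" using \<eta> by (auto simp: e_def)
  \<comment> \<open>Each tent is weighted by the integral of the other, so the total integral is
    zero.\<close>
  define \<psi> where "\<psi> v = e * (m2 * ?t1 v - m1 * ?t2 v)" for v
  have t01: "0 \<le> ?t1 v" "?t1 v \<le> 1" "0 \<le> ?t2 v" "?t2 v \<le> 1" for v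
    using z01[of 0] z01[of 3] z01[of 6] by (auto simp: tent_nonneg tent_le_one)
  have adm12: "admissible ?t1" "admissible ?t2"
    using z01[of 0] z01[of 3] z01[of 6] by (auto intro: admissible_tent)
  have adm: "admissible \<psi>"
    unfolding admissible_def
  proof (intro conjI allI impI)
    fix u v :: real assume uv: "u \<le> v"
    have "\<psi> v - \<psi> u = e * (m2 * (?t1 v - ?t1 u) - m1 * (?t2 v - ?t2 u))"
      by (simp add: \<psi>_def algebra_simps)
    then have "\<bar>\<psi> v - \<psi> u\<bar> = e * \<bar>m2 * (?t1 v - ?t1 u) - m1 * (?t2 v - ?t2 u)\<bar>"
      using e by (simp add: abs_mult)
    also have "\<dots> \<le> e * (\<bar>m2 * (?t1 v - ?t1 u)\<bar> + \<bar>m1 * (?t2 v - ?t2 u)\<bar>)"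
      using e by (intro mult_left_mono abs_triangle_ineq4) auto
    also have "\<dots> \<le> 1 / 2 * (1 * (v - u) + 1 * (v - u))"
      unfolding abs_mult using e m1 m2 uv tent_lipschitz[OF uv]
      by (intro mult_mono add_mono) auto
    finally show "\<bar>\<psi> v - \<psi> u\<bar> \<le> v - u" by simp
  qed (use adm12 in \<open>auto simp: \<psi>_def admissible_def\<close>)
  have int: "(\<lambda>s. \<psi> (f s)) integrable_on {u..1}" if "0 \<le> u" for u
    using adm_int[OF adm] that by auto
  have le_e: "\<bar>\<psi> v\<bar> \<le> e" for v
  proof -
    have "0 \<le> m2 * ?t1 v" "m2 * ?t1 v \<le> 1" "0 \<le> m1 * ?t2 v" "m1 * ?t2 v \<le> 1"
      using m1 m2 t01[of v] by (auto intro: mult_le_one)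
    then have "\<bar>m2 * ?t1 v - m1 * ?t2 v\<bar> \<le> 1" by linarith
    then show ?thesis using e by (simp add: \<psi>_def abs_mult)
  qed
  have out: "\<psi> v = 0" if "v \<le> z 0 \<or> z 6 \<le> v" for v
    using that z[of 0 3] z[of 3 6] by (auto simp: \<psi>_def tent_def)
  have tot: "integral {0..1} (\<lambda>s. \<psi> (f s)) = 0"
  proof -
    have "integral {0..1} (\<lambda>s. \<psi> (f s)) = e * (m2 * m1 - m1 * m2)"
      unfolding \<psi>_def
      using adm_int[OF adm12(1), of 0 1] adm_int[OF adm12(2), of 0 1]
      by (simp add: integral_diff integrable_on_mult_right flip: m1_def m2_def)
    then show ?thesis by simp
  qed
  have H: "\<bar>integral {u..1} (\<lambda>s. \<psi> (f s))\<bar> \<le> slack u y"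
    if u: "u \<in> {0..1}" and y: "y \<in> {0..1}" for u y
  proof -
    have nn: "0 \<le> slack u y" using slack_nonneg u y by auto
    \<comment> \<open>Left of \<open>x 0\<close> the tail is the whole integral, which is zero;
      right of \<open>x 6\<close> the perturbation itself vanishes.\<close>
    consider "u \<le> x 0" | "x 0 \<le> u" "u \<le> x 6" | "x 6 \<le> u" by linarith
    then show ?thesis
    proof cases
      case 1
      have "integral {0..u} (\<lambda>s. \<psi> (f s)) = integral {0..u} (\<lambda>s. 0)"
        using 1 u x01[of 0] x[of 0] fD[of _ "x 0"] by (intro integral_cong out) force
      then have "integral {u..1} (\<lambda>s. \<psi> (f s)) = 0"
        using interval_integral_combine[of 0 u 1 "\<lambda>s. \<psi> (f s)"] int[of 0] tot u
        by simp
      then show ?thesis using nn by simp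
    next
      case 2
      have "norm (integral {u..1} (\<lambda>s. \<psi> (f s))) \<le> integral {u..1} (\<lambda>s. e)"
        using u le_e int[of u]
        by (intro Henstock_Kurzweil_Integration.integral_norm_bound_integral) auto
      also have "\<dots> \<le> e" using u e by (simp add: mult_left_le_one_le)
      also have "\<dots> \<le> slack u y" using \<eta>(2)[of u y] 2 y e by simp
      finally show ?thesis by simp
    next
      case 3
      have "integral {u..1} (\<lambda>s. \<psi> (f s)) = integral {u..1} (\<lambda>s. 0)"
        using 3 u x01[of 6] x[of 6] fD[of "x 6"] by (intro integral_cong out) force
      then show ?thesis using nn by simp
    qed
  qed
  have "integral {0..1} (\<lambda>s. \<bar>\<psi> (f s)\<bar>) = 0"
    using rigid[OF adm admissible_zero] H by simp
  moreover have "e * m2 * m1 \<le> integral {0..1} (\<lambda>s. \<bar>\<psi> (f s)\<bar>)"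
  proof -
    have "e * m2 * m1 = integral {0..1} (\<lambda>s. e * m2 * ?t1 (f s))"
      unfolding m1_def by simp
    also have "\<dots> \<le> integral {0..1} (\<lambda>s. \<bar>\<psi> (f s)\<bar>)"
    proof (rule integral_le)
      show "(\<lambda>s. e * m2 * ?t1 (f s)) integrable_on {0..1}"
        using adm_int[OF adm12(1), of 0 1] by (auto intro: integrable_on_mult_right)
      \<comment> \<open>The two tents are nowhere both positive, so the second cannot cancel the
        first.\<close>
      have "\<bar>e * m2 * ?t1 v\<bar> \<le> \<bar>\<psi> v\<bar>" for v
        using m1 m2 e t01[of v] z[of 0 3] z[of 3 6]
        by (cases "v \<le> z 3") (auto simp: \<psi>_def tent_def abs_mult)
      then show "e * m2 * ?t1 (f s) \<le> \<bar>\<psi> (f s)\<bar>" if "s \<in> {0..1}" for s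
        by (meson abs_ge_self order_trans)
      have "admissible (\<lambda>v. \<bar>\<psi> v\<bar>)"
        unfolding admissible_def
      proof (intro conjI allI impI)
        fix u v :: real assume "u \<le> v"
        with adm have "\<bar>\<psi> v - \<psi> u\<bar> \<le> v - u" by (simp add: admissible_def)
        then show "\<bar>\<bar>\<psi> v\<bar> - \<bar>\<psi> u\<bar>\<bar> \<le> v - u" by linarith
      qed (use adm in \<open>auto simp: admissible_def\<close>)
      then show "(\<lambda>s. \<bar>\<psi> (f s)\<bar>) integrable_on {0..1}" by (rule adm_int) auto
    qed
    finally show ?thesis .
  qed
  moreover have "0 < e * m2 * m1" using e m1 m2 by simp
  ultimately show False by linarith
qed

text \<open>Here nothing need be compensated: a nonzero \<open>f\<close> below the least tight pair
  could be moved up and down by itself. The danger lies next to \<open>x = \<beta>\<close>, where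
  the slack may tend to zero; but \<open>f\<close> has finitely many values before
  \<open>\<beta>\<close>, hence stays a distance \<open>k\<close> below \<open>\<delta>\<close>, and
  the corner bound applies.\<close>

lemma below_tight:
  assumes "\<beta> \<in> {0..1}" "\<delta> \<in> {0..1}" "slack \<beta> \<delta> = 0"
    and nx: "\<And>x y. 0 \<le> x \<Longrightarrow> x < \<beta> \<Longrightarrow> y \<in> {0..1} \<Longrightarrow> slack x y \<noteq> 0"
    and ny: "\<And>x y. x \<in> {0..1} \<Longrightarrow> 0 \<le> y \<Longrightarrow> y < \<delta> \<Longrightarrow> slack x y \<noteq> 0"
    and s: "0 \<le> s" "s < \<beta>"
  shows "f s = 0"
proof (rule ccontr)
  interpret s: border_pair g f by (rule swap)
  assume "f s \<noteq> 0"
  then have fs: "0 < f s" using f_range[of s] s assms(1) by auto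
  \<comment> \<open>Equality would make the pair \<open>(u, \<delta>)\<close> tight.\<close>
  have lt: "f u < \<delta>" if "0 \<le> u" "u < \<beta>" for u
    using tight_upper[OF assms(1,2,3) that] nx[OF that assms(2)] by fastforce
  have "finite (f ` {0<..<\<beta>})"
    using assms by (intro finite_values) auto
  moreover have ne: "{0<..<\<beta>} \<noteq> {}" using s by auto
  ultimately have Mx: "Max (f ` {0<..<\<beta>}) \<in> f ` {0<..<\<beta>}"
    and Mx2: "\<And>u. 0 < u \<Longrightarrow> u < \<beta> \<Longrightarrow> f u \<le> Max (f ` {0<..<\<beta>})"
    by (auto intro!: Max_in Max_ge)
  define k where "k = \<delta> - Max (f ` {0<..<\<beta>})"
  have k: "0 < k" using Mx lt by (auto simp: k_def)
  have fk': "f u \<le> \<delta> - k" if "0 < u" "u < \<beta>" for u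
    using Mx2[OF that] by (simp add: k_def)
  have fk: "f u \<le> \<delta> - k" if "0 \<le> u" "u < \<beta>" for u
    using fk'[of "(u + \<beta>) / 2"] fD[of u "(u + \<beta>) / 2"] that assms by auto
  have k\<delta>: "k < \<delta>" using fk[OF s] fs by linarith
  then have "k \<le> 1" using assms by auto
  obtain \<eta> where \<eta>: "0 < \<eta>"
    "\<And>y x. 0 \<le> y \<Longrightarrow> y \<le> \<delta> - k / 2 \<Longrightarrow> x \<in> {0..1} \<Longrightarrow> \<eta> \<le> border_slack g f y x"
  proof (rule s.slack_bounded_below[of 0 "\<delta> - k / 2"])
    show "border_slack g f y x \<noteq> 0" if "0 \<le> y" "y \<le> \<delta> - k / 2" "x \<in> {0..1}" for y x
      using ny[of x y] that k by (simp add: border_slack_swap)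
  qed (use k k\<delta> assms in auto)
  \<comment> \<open>The factor \<open>1 / 2\<close> fits the corner bound for \<open>y\<close> above
    \<open>\<delta> - k / 2\<close>, the factor \<open>\<eta>\<close> the uniform bound for smaller
    \<open>y\<close>.\<close>
  define e where "e = min (1 / 2) \<eta>"
  have e: "0 < e" "e \<le> 1 / 2" "e \<le> \<eta>" using \<eta> by (auto simp: e_def)
  \<comment> \<open>The cap \<open>k\<close> brings the tail integral down to
    \<open>k * (\<beta> - x)\<close> for \<open>x \<le> \<beta>\<close>, the order of the slack at
    the corner.\<close>
  let ?h = "\<lambda>v. min k (tent 0 \<delta> v)"
  have adm0: "admissible ?h" using assms k by (intro admissible_min_tent) auto
  then have adm: "admissible (\<lambda>v. e * ?h v)" using e by (intro admissible_scale) auto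
  note int0 = adm_int[OF adm0]
  have H: "integral {x..1} (\<lambda>s. ?h (f s)) \<le> k * max 0 (\<beta> - x)" if "x \<in> {0..1}" for x
  proof (rule integral_upper_support)
    show "?h (f u) = 0" if "\<beta> < u" "u < 1" for u
      using tight_lower(1)[OF assms(1,2,3), of u] that k by (auto simp: tent_def)
  qed (use int0 that assms in auto)
  have Hn: "0 \<le> integral {x..1} (\<lambda>s. ?h (f s))" if "x \<in> {0..1}" for x
    using int0[of x 1] that k by (intro integral_nonneg) (auto simp: tent_nonneg)
  have "\<bar>integral {x..1} (\<lambda>s. e * ?h (f s)) + integral {y..1} (\<lambda>s. 0)\<bar> \<le> slack x y"
    if x: "x \<in> {0..1}" and y: "y \<in> {0..1}" for x y
  proof -
    have eq: "\<bar>integral {x..1} (\<lambda>s. e * ?h (f s)) + integral {y..1} (\<lambda>s. 0)\<bar>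
      = e * integral {x..1} (\<lambda>s. ?h (f s))"
      using e Hn[OF x] by (simp add: abs_mult)
    show ?thesis
    proof (cases "\<delta> - k / 2 \<le> y")
      case True
      have "e * integral {x..1} (\<lambda>s. ?h (f s)) \<le> 1 / 2 * (k * max 0 (\<beta> - x))"
        using e H[OF x] Hn[OF x] by (intro mult_mono) auto
      also have "\<dots> \<le> slack x y"
        using slack_upper_corner[OF assms(1,2,3) k fk x y True]
          slack_nonneg[of \<beta> y] assms y by (auto split: if_splits)
      finally show ?thesis using eq by simp
    next
      case False
      have "k * max 0 (\<beta> - x) \<le> 1 * 1"
        using \<open>k \<le> 1\<close> k assms x by (intro mult_mono) auto
      then have "e * integral {x..1} (\<lambda>s. ?h (f s)) \<le> e * 1"
        using e H[OF x] by (intro mult_left_mono) auto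
      also have "\<dots> \<le> slack x y"
        using \<eta>(2)[of y x] False x y e by (simp add: border_slack_swap)
      finally show ?thesis using eq by simp
    qed
  qed
  then have "integral {0..1} (\<lambda>s. \<bar>e * ?h (f s)\<bar>) = 0"
    using rigid[OF adm admissible_zero] by blast
  moreover have "\<bar>e * ?h (f s)\<bar> = e * ?h (f s)" for s
    using e k by (simp add: tent_nonneg)
  ultimately have "integral {0..1} (\<lambda>s. ?h (f s)) = 0"
    using e by simp
  \<comment> \<open>Both factors are at most one, so the product stays below \<open>k\<close> and
    below the tent; the capped tent inherits positivity of its integral from the tent.\<close>
  moreover have "k * integral {0..1} (\<lambda>s. tent 0 \<delta> (f s)) \<le> integral {0..1} (\<lambda>s. ?h (f s))"
  proof -
    have "admissible (tent 0 \<delta>)" using assms by (auto intro: admissible_tent)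
    then have ti: "(\<lambda>s. tent 0 \<delta> (f s)) integrable_on {0..1}" by (intro adm_int) auto
    have "integral {0..1} (\<lambda>s. k * tent 0 \<delta> (f s)) \<le> integral {0..1} (\<lambda>s. ?h (f s))"
    proof (rule integral_le)
      have t: "0 \<le> tent 0 \<delta> v" "tent 0 \<delta> v \<le> 1" for v
        using assms by (auto simp: tent_nonneg tent_le_one)
      show "k * tent 0 \<delta> (f s) \<le> ?h (f s)" for s
        using t[of "f s"] k \<open>k \<le> 1\<close> mult_right_mono[of k 1 "tent 0 \<delta> (f s)"]
        by (simp add: mult_left_le)
    qed (use int0[of 0 1] ti in \<open>auto intro: integrable_on_mult_right\<close>)
    then show ?thesis by simp
  qed
  moreover have "0 < integral {0..1} (\<lambda>s. tent 0 \<delta> (f s))"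
    using fs s lt[of "(s + \<beta>) / 2"] assms
    by (intro integral_tent_pos[of _ _ s "(s + \<beta>) / 2"]) auto
  ultimately show False using k by (simp add: mult_le_0_iff)
qed

text \<open>Between consecutive tight pairs \<open>f\<close> rises by a capped tent on the values in
  \<open>(\<gamma>, \<delta>)\<close> and \<open>g\<close> falls by a tent on the values in
  \<open>(\<alpha>, \<beta>)\<close>, scaled to equal total mass. Near the upper corner the tail
  integrals are small; near the lower corner the complementary integrals are, and these may be used
  because the totals cancel.\<close>

lemma no_gap:
  assumes ab: "0 \<le> \<alpha>" "\<alpha> < \<beta>" "\<beta> \<le> 1" and cd: "0 \<le> \<gamma>" "\<gamma> < \<delta>" "\<delta> \<le> 1"
    and ta: "slack \<alpha> \<gamma> = 0" and tb: "slack \<beta> \<delta> = 0"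
    and nx: "\<And>x y. \<alpha> < x \<Longrightarrow> x < \<beta> \<Longrightarrow> y \<in> {0..1} \<Longrightarrow> slack x y \<noteq> 0"
    and ny: "\<And>x y. x \<in> {0..1} \<Longrightarrow> \<gamma> < y \<Longrightarrow> y < \<delta> \<Longrightarrow> slack x y \<noteq> 0"
  shows False
proof -
  interpret s: border_pair g f by (rule swap)
  have mem: "\<alpha> \<in> {0..1}" "\<beta> \<in> {0..1}" "\<gamma> \<in> {0..1}" "\<delta> \<in> {0..1}" using ab cd by auto
  have tas: "border_slack g f \<gamma> \<alpha> = 0" and tbs: "border_slack g f \<delta> \<beta> = 0"
    using ta tb by (simp_all add: border_slack_swap)
  have lt: "f u < \<delta>" if "\<alpha> < u" "u < \<beta>" for u
    using tight_upper[OF mem(2,4) tb, of u] nx[OF that mem(4)] that ab by fastforce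
  have gt: "\<gamma> < f u" if "\<alpha> < u" "u < \<beta>" for u
    using tight_lower[OF mem(1,3) ta, of u] nx[OF that mem(3)] that ab by fastforce
  define F where "F = f ` {\<alpha><..<\<beta>}"
  have "finite F" unfolding F_def
    using ab nx by (intro finite_values) auto
  moreover have "F \<noteq> {}" using ab by (auto simp: F_def)
  ultimately have M: "Max F \<in> F" "\<And>v. v \<in> F \<Longrightarrow> v \<le> Max F" "Min F \<in> F" "\<And>v. v \<in> F \<Longrightarrow> Min F \<le> v"
    by auto
  \<comment> \<open>Distance of the finitely many values of \<open>f\<close> on the gap from both
    bounds. On the gap the capped tent below equals \<open>k\<close>, so \<open>f\<close> is shifted
    there by a constant.\<close>
  define k where "k = min (\<delta> - Max F) (Min F - \<gamma>)"
  have k: "0 < k" using M(1,3) lt gt by (auto simp: k_def F_def)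
  \<comment> \<open>Hence \<open>\<gamma> + k / 2\<close> lies below
    \<open>\<delta> - k / 2\<close>, and the zones of the two corners do not meet.\<close>
  have k2: "2 * k \<le> \<delta> - \<gamma>" using M(2)[OF M(3)] by (simp add: k_def min_def)
  then have "k \<le> 1" using cd k by auto
  have fk1': "f u \<le> \<delta> - k" and fk2': "\<gamma> + k \<le> f u" if "\<alpha> < u" "u < \<beta>" for u
    using M(2,4)[of "f u"] that by (auto simp: k_def F_def)
  let ?mid = "(\<alpha> + \<beta>) / 2"
  have mid: "f ?mid \<le> \<delta> - k" "\<gamma> + k \<le> f ?mid" using fk1'[of ?mid] fk2'[of ?mid] ab by auto
  have fk1: "f u \<le> \<delta> - k" if "0 \<le> u" "u < \<beta>" for u
    using fk1'[of u] fD[of u ?mid] mid that ab by (cases "\<alpha> < u") auto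
  have fk2: "\<gamma> + k \<le> f u" if "\<alpha> < u" "u \<le> 1" for u
    using fk2'[of u] fD[of ?mid u] mid that ab by (cases "u < \<beta>") auto
  obtain \<eta> where \<eta>: "0 < \<eta>"
    "\<And>y x. \<gamma> + k / 2 \<le> y \<Longrightarrow> y \<le> \<delta> - k / 2 \<Longrightarrow> x \<in> {0..1} \<Longrightarrow> \<eta> \<le> border_slack g f y x"
  proof (rule s.slack_bounded_below[of "\<gamma> + k / 2" "\<delta> - k / 2"])
    show "border_slack g f y x \<noteq> 0" if "\<gamma> + k / 2 \<le> y" "y \<le> \<delta> - k / 2" "x \<in> {0..1}" for y x
      using ny[of x y] that k by (simp add: border_slack_swap)
  qed (use k k2 cd in auto)
  define e where "e = min (1 / 2) \<eta>"
  have e: "0 < e" "e \<le> 1 / 2" "e \<le> \<eta>" using \<eta> by (auto simp: e_def)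
  let ?h = "\<lambda>v. min k (tent \<gamma> \<delta> v)" and ?t = "tent \<alpha> \<beta>"
  have adm0: "admissible ?h" using cd k by (intro admissible_min_tent) auto
  have admt: "admissible ?t" using ab by (intro admissible_tent) auto
  note int0 = adm_int[OF adm0] and intt = s.adm_int[OF admt]
  define H1 where "H1 x = integral {x..1} (\<lambda>s. ?h (f s))" for x
  define H2 where "H2 y = integral {y..1} (\<lambda>s. ?t (g s))" for y
  have H1c: "H1 0 - H1 x = integral {0..x} (\<lambda>s. ?h (f s))" if "x \<in> {0..1}" for x
    using interval_integral_combine[of 0 x 1 "\<lambda>s. ?h (f s)"] int0[of 0 1] that
    by (simp add: H1_def)
  have H2c: "H2 0 - H2 y = integral {0..y} (\<lambda>s. ?t (g s))" if "y \<in> {0..1}" for y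
    using interval_integral_combine[of 0 y 1 "\<lambda>s. ?t (g s)"] intt[of 0 1] that
    by (simp add: H2_def)
  have Hu: "H1 x \<le> k * max 0 (\<beta> - x)" if "x \<in> {0..1}" for x
    unfolding H1_def
  proof (rule integral_upper_support)
    show "?h (f u) = 0" if "\<beta> < u" "u < 1" for u
      using tight_lower(1)[OF mem(2,4) tb, of u] that k by (auto simp: tent_def)
  qed (use int0 that mem in auto)
  have Hl: "H1 0 - H1 x \<le> k * max 0 (x - \<alpha>)" if "x \<in> {0..1}" for x
    unfolding H1c[OF that]
  proof (rule integral_lower_support)
    show "?h (f u) = 0" if "0 < u" "u < \<alpha>" for u
      using tight_upper(1)[OF mem(1,3) ta, of u] that k by (auto simp: tent_def)
  qed (use int0 that mem in auto)
  have H1n: "0 \<le> H1 x" "0 \<le> H1 0 - H1 x" if "x \<in> {0..1}" for x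
    unfolding H1c[OF that] unfolding H1_def
    using int0[of x 1] int0[of 0 x] that k by (auto intro!: integral_nonneg simp: tent_nonneg)
  have H2n: "0 \<le> H2 y" "0 \<le> H2 0 - H2 y" if "y \<in> {0..1}" for y
    unfolding H2c[OF that] unfolding H2_def
    using intt[of y 1] intt[of 0 y] that by (auto intro!: integral_nonneg simp: tent_nonneg)
  \<comment> \<open>Before \<open>\<delta>\<close> the tent of \<open>g\<close> is at most
    \<open>\<beta> - g\<close>, whose integral over \<open>{y..\<delta>}\<close> is exactly
    \<open>slack \<beta> y\<close>, the second term of the corner bound.\<close>
  have H2u: "H2 y \<le> (if y \<le> \<delta> then slack \<beta> y else 0)" if y: "\<gamma> \<le> y" "y \<le> 1" for y
  proof -
    have z: "?t (g u) = 0" if "\<delta> < u" "u < 1" for u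
      using s.tight_lower(1)[OF mem(4,2) tbs, of u] that by (auto simp: tent_def)
    show ?thesis
    proof (cases "y \<le> \<delta>")
      case True
      have "integral {\<delta>..1} (\<lambda>s. ?t (g s)) = 0 * (1 - \<delta>)"
        using z intt cd by (intro integral_const_open_interval) auto
      then have "H2 y = integral {y..\<delta>} (\<lambda>s. ?t (g s))"
        using interval_integral_combine[of y \<delta> 1 "\<lambda>s. ?t (g s)"]
          intt[of y 1] True y cd by (simp add: H2_def)
      also have "\<dots> \<le> integral {y..\<delta>} (\<lambda>s. \<beta> - g s)"
      proof (rule integral_le_open_interval)
        fix u assume "y < u" "u < \<delta>"
        then show "?t (g u) \<le> \<beta> - g u"
          using s.tight_upper(1)[OF mem(4,2) tbs, of u] y cd by (auto simp: tent_def)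
      qed (use intt s.f_int y cd in \<open>auto intro!: integrable_diff\<close>)
      also have "\<dots> = integral {y..\<delta>} (\<lambda>s. \<beta>) - integral {y..\<delta>} g"
        using s.f_int[of y \<delta>] y cd by (intro Henstock_Kurzweil_Integration.integral_diff) auto
      also have "\<dots> = slack \<beta> y"
        using s.slack_diff[of y \<delta> \<beta>] s.f_int[of y \<delta>] tbs True y cd
        by (simp add: border_slack_swap[of g f] algebra_simps)
      finally show ?thesis using True by simp
    next
      case False
      have "H2 y = 0 * (1 - y)" unfolding H2_def
        using z intt y False cd by (intro integral_const_open_interval) auto
      then show ?thesis using False by simp
    qed
  qed
  have H2l: "H2 0 - H2 y \<le> (if \<gamma> \<le> y then slack \<alpha> y else 0)" if y: "0 \<le> y" "y \<le> \<delta>" for y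
  proof -
    have z: "?t (g u) = 0" if "0 < u" "u < \<gamma>" for u
      using s.tight_upper(1)[OF mem(3,1) tas, of u] that by (auto simp: tent_def)
    have y1: "y \<in> {0..1}" using y cd by auto
    show ?thesis
    proof (cases "\<gamma> \<le> y")
      case True
      have "integral {0..\<gamma>} (\<lambda>s. ?t (g s)) = 0 * (\<gamma> - 0)"
        using z intt cd by (intro integral_const_open_interval) auto
      then have "H2 0 - H2 y = integral {\<gamma>..y} (\<lambda>s. ?t (g s))"
        using interval_integral_combine[of 0 \<gamma> y "\<lambda>s. ?t (g s)"]
          intt[of 0 y] True y cd by (simp add: H2c[OF y1])
      also have "\<dots> \<le> integral {\<gamma>..y} (\<lambda>s. g s - \<alpha>)"
      proof (rule integral_le_open_interval)
        fix u assume "\<gamma> < u" "u < y"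
        then show "?t (g u) \<le> g u - \<alpha>"
          using s.tight_lower(1)[OF mem(3,1) tas, of u] y cd by (auto simp: tent_def)
      qed (use intt s.f_int y cd in \<open>auto intro!: integrable_diff\<close>)
      also have "\<dots> = integral {\<gamma>..y} g - integral {\<gamma>..y} (\<lambda>s. \<alpha>)"
        using s.f_int[of \<gamma> y] y cd by (intro Henstock_Kurzweil_Integration.integral_diff) auto
      also have "\<dots> = slack \<alpha> y"
        using s.slack_diff[of \<gamma> y \<alpha>] s.f_int[of \<gamma> y] tas True y cd
        by (simp add: border_slack_swap[of g f] algebra_simps)
      finally show ?thesis using True by simp
    next
      case False
      have "H2 0 - H2 y = 0 * (y - 0)" unfolding H2c[OF y1]
        using z intt y False cd by (intro integral_const_open_interval) auto
      then show ?thesis using False by simp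
    qed
  qed
  define m1 m2 where "m1 = H1 0" and "m2 = H2 0"
  have m1: "0 \<le> m1" "m1 \<le> 1"
  proof -
    show "0 \<le> m1" using H1n[of 0] by (simp add: m1_def)
    have "k * max 0 (\<beta> - 0) \<le> 1 * 1" using k \<open>k \<le> 1\<close> ab by (intro mult_mono) auto
    then show "m1 \<le> 1" using Hu[of 0] by (simp add: m1_def)
  qed
  have m2: "0 \<le> m2" "m2 \<le> 1"
    using H2n[of 0] s.integral_tent_le_one[of \<alpha> \<beta>] ab by (auto simp: m2_def H2_def)
  \<comment> \<open>Otherwise \<open>g\<close> jumps over \<open>(\<alpha>, \<beta>)\<close>: it is
    at most \<open>\<alpha>\<close> on the lower half of \<open>(\<gamma>, \<delta>)\<close> or at
    least \<open>\<beta>\<close> on the upper half. Then the slack at \<open>\<alpha>\<close> or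
    \<open>\<beta>\<close> vanishes at the midpoint as well, inside the gap.\<close>
  have m2_pos: "0 < m2"
  proof (rule ccontr)
    assume "\<not> 0 < m2"
    then have z: "\<not> (\<alpha> < g p \<and> g q < \<beta>)" if "0 \<le> p" "p < q" "q \<le> 1" for p q
      using s.integral_tent_pos[of \<alpha> \<beta> p q] that ab by (auto simp: m2_def H2_def)
    let ?y = "(\<gamma> + \<delta>) / 2"
    have y: "\<gamma> < ?y" "?y < \<delta>" using cd by auto
    show False
    proof (cases "g ?y < \<beta>")
      case True
      have "integral {\<gamma>..?y} g \<le> integral {\<gamma>..?y} (\<lambda>_. \<alpha>)"
      proof (rule integral_le_open_interval)
        fix u assume "\<gamma> < u" "u < ?y"
        then show "g u \<le> \<alpha>" using z[of u ?y] True cd by auto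
      qed (use s.f_int cd in auto)
      then have "border_slack g f ?y \<alpha> \<le> 0"
        using s.slack_diff[of \<gamma> ?y \<alpha>] tas y cd by (simp add: field_simps)
      moreover have "0 \<le> border_slack g f ?y \<alpha>" using s.slack_nonneg y ab cd by auto
      ultimately show False using ny[of \<alpha> ?y] y mem by (simp add: border_slack_swap)
    next
      case False
      have "integral {?y..\<delta>} (\<lambda>_. \<beta>) \<le> integral {?y..\<delta>} g"
      proof (rule integral_le_open_interval)
        fix u assume "?y < u" "u < \<delta>"
        then show "\<beta> \<le> g u" using s.fD[of ?y u] False y cd by auto
      qed (use s.f_int cd in auto)
      then have "border_slack g f ?y \<beta> \<le> 0"
        using s.slack_diff[of ?y \<delta> \<beta>] tbs y cd by (simp add: field_simps)
      moreover have "0 \<le> border_slack g f ?y \<beta>" using s.slack_nonneg y ab cd by auto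
      ultimately show False using ny[of \<beta> ?y] y mem by (simp add: border_slack_swap)
    qed
  qed
  have m1_pos: "0 < m1"
  proof -
    \<comment> \<open>An interval with both ends inside the gap, on which the capped tent is the
      constant \<open>k\<close>.\<close>
    let ?p = "(3 * \<alpha> + \<beta>) / 4"
    have "0 < k * (?mid - ?p)" using k ab by simp
    also have "\<dots> = integral {?p..?mid} (\<lambda>_. k)" using ab by simp
    also have "\<dots> = integral {?p..?mid} (\<lambda>s. ?h (f s))"
    proof (rule integral_cong)
      fix s assume "s \<in> {?p..?mid}"
      then have "\<gamma> + k \<le> f s" "f s \<le> \<delta> - k" using fk1'[of s] fk2'[of s] ab by auto
      then show "k = ?h (f s)" by (simp add: tent_def)
    qed
    also have "\<dots> \<le> m1" unfolding m1_def H1_def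
      using int0 k ab by (intro integral_subset_le) (auto simp: tent_nonneg)
    finally show ?thesis .
  qed
  have adm1: "admissible (\<lambda>v. (e * m2) * ?h v)"
    using e m2 by (intro admissible_scale adm0) (simp add: abs_mult mult_le_one)
  have adm2: "admissible (\<lambda>v. (- (e * m1)) * ?t v)"
    using e m1 by (intro admissible_scale admt) (simp add: abs_mult mult_le_one)
  have "\<bar>integral {x..1} (\<lambda>s. (e * m2) * ?h (f s)) + integral {y..1} (\<lambda>s. (- (e * m1)) * ?t (g s))\<bar>
      \<le> slack x y"
    if x: "x \<in> {0..1}" and y: "y \<in> {0..1}" for x y
  proof -
    have "integral {x..1} (\<lambda>s. (e * m2) * ?h (f s)) + integral {y..1} (\<lambda>s. (- (e * m1)) * ?t (g s))
      = e * (m2 * H1 x - m1 * H2 y)"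
      unfolding H1_def H2_def by (simp add: algebra_simps)
    then have eq: "\<bar>integral {x..1} (\<lambda>s. (e * m2) * ?h (f s)) + integral {y..1} (\<lambda>s. (- (e * m1)) * ?t (g s))\<bar>
      = e * \<bar>m2 * H1 x - m1 * H2 y\<bar>" using e by (simp add: abs_mult)
    have scale: "0 \<le> m2 * u \<and> m2 * u \<le> u \<and> 0 \<le> m1 * u \<and> m1 * u \<le> u" if "0 \<le> u" for u
      using m1 m2 that by (simp add: mult_left_le_one_le)
    \<comment> \<open>A difference of nonnegative numbers is at most the larger one, and half of
      \<open>max K V\<close> lies below \<open>K / 2 + V\<close>, the form of both corner
      bounds.\<close>
    have fin: "e * \<bar>m2 * H1 x - m1 * H2 y\<bar> \<le> B"
      if "\<bar>m2 * H1 x - m1 * H2 y\<bar> \<le> max K V" "0 \<le> K" "0 \<le> V" "K / 2 + V \<le> B" for K V B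
    proof -
      have "e * \<bar>m2 * H1 x - m1 * H2 y\<bar> \<le> 1 / 2 * max K V"
        using that e by (intro mult_mono) auto
      then show ?thesis using that by linarith
    qed
    consider "\<delta> - k / 2 \<le> y" | "y \<le> \<gamma> + k / 2" | "\<gamma> + k / 2 \<le> y" "y \<le> \<delta> - k / 2" by linarith
    then have "e * \<bar>m2 * H1 x - m1 * H2 y\<bar> \<le> slack x y"
    proof cases
      case 1
      let ?K = "k * max 0 (\<beta> - x)" and ?V = "if y \<le> \<delta> then slack \<beta> y else 0"
      have yg: "\<gamma> \<le> y" using 1 k k2 by linarith
      have V: "0 \<le> ?V" using slack_nonneg[OF mem(2) y] by auto
      show ?thesis
      proof (rule fin)
        show "\<bar>m2 * H1 x - m1 * H2 y\<bar> \<le> max ?K ?V"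
          using scale[OF H1n(1)[OF x]] scale[OF H2n(1)[OF y]] Hu[OF x] H2u[OF yg] y by auto
        show "?K / 2 + ?V \<le> slack x y"
          using slack_upper_corner[OF mem(2,4) tb k fk1 x y 1] by simp
      qed (use k V in auto)
    next
      case 2
      let ?K = "k * max 0 (x - \<alpha>)" and ?V = "if \<gamma> \<le> y then slack \<alpha> y else 0"
      have yd: "y \<le> \<delta>" using 2 k k2 by linarith
      have V: "0 \<le> ?V" using slack_nonneg[OF mem(1) y] by auto
      \<comment> \<open>The total masses cancel, so tails may be exchanged for integrals over
        initial segments, the small ones near the lower corner.\<close>
      have id: "m2 * H1 x - m1 * H2 y = m1 * (H2 0 - H2 y) - m2 * (H1 0 - H1 x)"
        by (simp add: m1_def m2_def algebra_simps)
      show ?thesis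
      proof (rule fin)
        show "\<bar>m2 * H1 x - m1 * H2 y\<bar> \<le> max ?K ?V"
          using scale[OF H1n(2)[OF x]] scale[OF H2n(2)[OF y]] Hl[OF x] H2l[OF _ yd] y
          unfolding id by auto
        show "?K / 2 + ?V \<le> slack x y"
          using slack_lower_corner[OF mem(1,3) ta k fk2 x y 2] by simp
      qed (use k V in auto)
    next
      case 3
      have "H1 x \<le> m1" "H2 y \<le> m2" using H1n(2)[OF x] H2n(2)[OF y] by (auto simp: m1_def m2_def)
      then have "\<bar>m2 * H1 x - m1 * H2 y\<bar> \<le> 1"
        using scale[OF H1n(1)[OF x]] scale[OF H2n(1)[OF y]] m1 m2 by (smt (verit))
      then have "e * \<bar>m2 * H1 x - m1 * H2 y\<bar> \<le> e * 1" using e by (intro mult_left_mono) auto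
      also have "\<dots> \<le> slack x y"
        using \<eta>(2)[of y x] 3 x e by (simp add: border_slack_swap)
      finally show ?thesis .
    qed
    then show ?thesis using eq by simp
  qed
  then have "integral {0..1} (\<lambda>s. \<bar>(e * m2) * ?h (f s)\<bar>) = 0"
    using rigid[OF adm1 adm2] by blast
  moreover have "\<bar>(e * m2) * ?h (f s)\<bar> = (e * m2) * ?h (f s)" for s
    using e k m2 by (simp add: tent_nonneg)
  ultimately have "e * m2 * m1 = 0" by (simp add: m1_def H1_def)
  then show False using e m1_pos m2_pos by simp
qed

section \<open>Compactness and connectedness of the tight set\<close>

lemma tight_compact:
  "compact {p \<in> {0..1} \<times> {0..1}. slack (fst p) (snd p) = 0}"
proof -
  have "closed ({0..1::real} \<times> {0..1::real})"
    by (intro closed_Times) auto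
  from continuous_closed_preimage_constant[OF slack_continuous this, of 0]
  have "closed {p \<in> {0..1} \<times> {0..1}. slack (fst p) (snd p) = 0}"
    by simp
  then have "compact (({0..1} \<times> {0..1}) \<inter> {p \<in> {0..1} \<times> {0..1}. slack (fst p) (snd p) = 0})"
    by (intro compact_Int_closed compact_Times) auto
  moreover have "({0..1} \<times> {0..1}) \<inter> {p \<in> {0..1} \<times> {0..1}. slack (fst p) (snd p) = 0}
      = {p \<in> {0..1} \<times> {0..1}. slack (fst p) (snd p) = 0}" by blast
  ultimately show ?thesis by simp
qed

lemma tight_extremal_y:
  assumes "x \<in> {0..1}" "\<exists>y\<in>{0..1}. slack x y = 0"
  obtains c d where "c \<in> {0..1}" "d \<in> {0..1}" "slack x c = 0" "slack x d = 0"
    "\<And>y. y \<in> {0..1} \<Longrightarrow> slack x y = 0 \<Longrightarrow> c \<le> y \<and> y \<le> d"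
proof -
  let ?Y = "snd ` ({p \<in> {0..1} \<times> {0..1}. slack (fst p) (snd p) = 0} \<inter> {x} \<times> {0..1})"
  have "compact ?Y"
    by (intro compact_continuous_image continuous_on_snd continuous_on_id compact_Int_closed
        tight_compact closed_Times) auto
  moreover have eq: "?Y = {y \<in> {0..1}. slack x y = 0}"
    using assms(1) by force
  ultimately have "compact {y \<in> {0..1}. slack x y = 0}" by simp
  note cp = this
  have ne: "{y \<in> {0..1}. slack x y = 0} \<noteq> {}" using assms(2) by blast
  obtain c where c: "c \<in> {y \<in> {0..1}. slack x y = 0}"
    "\<forall>y\<in>{y \<in> {0..1}. slack x y = 0}. c \<le> y"
    using compact_attains_inf[OF cp ne] by blast
  obtain d where d: "d \<in> {y \<in> {0..1}. slack x y = 0}"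
    "\<forall>y\<in>{y \<in> {0..1}. slack x y = 0}. y \<le> d"
    using compact_attains_sup[OF cp ne] by blast
  show ?thesis using c d by (intro that[of c d]) blast+
qed

definition tight_x :: "real set" where
  "tight_x = {x \<in> {0..1}. \<exists>y\<in>{0..1}. slack x y = 0}"

lemma compact_tight_x: "compact tight_x"
proof -
  have "compact (fst ` {p \<in> {0..1} \<times> {0..1}. slack (fst p) (snd p) = 0})"
    by (intro compact_continuous_image continuous_on_fst continuous_on_id tight_compact)
  moreover have "fst ` {p \<in> {0..1} \<times> {0..1}. slack (fst p) (snd p) = 0} = tight_x"
    by (force simp: tight_x_def)
  ultimately show ?thesis by simp
qed

text \<open>A missing \<open>x\<close> lies between nearest tight abscissae \<open>\<alpha>\<close>
  and \<open>\<beta>\<close>. For the largest partner \<open>\<gamma>\<close> of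
  \<open>\<alpha>\<close> and the least partner \<open>\<delta>\<close> of \<open>\<beta>\<close>,
  the chain property excludes tight pairs with \<open>y\<close> strictly between, and convexity
  excludes \<open>\<gamma> = \<delta>\<close>. What remains is a gap as in
  \<open>no_gap\<close>.\<close>

lemma tight_x_connected:
  assumes "a \<in> tight_x" "b \<in> tight_x" "a \<le> x" "x \<le> b"
  shows "x \<in> tight_x"
proof (rule ccontr)
  assume x: "x \<notin> tight_x"
  have "compact (tight_x \<inter> {..x})" "compact (tight_x \<inter> {x..})"
    by (auto intro: compact_Int_closed compact_tight_x)
  moreover have "tight_x \<inter> {..x} \<noteq> {}" "tight_x \<inter> {x..} \<noteq> {}" using assms by auto
  ultimately have "\<exists>\<alpha>\<in>tight_x \<inter> {..x}. \<forall>u\<in>tight_x \<inter> {..x}. u \<le> \<alpha>"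
    "\<exists>\<beta>\<in>tight_x \<inter> {x..}. \<forall>u\<in>tight_x \<inter> {x..}. \<beta> \<le> u"
    using compact_attains_sup compact_attains_inf by blast+
  then obtain \<alpha> \<beta> where \<alpha>: "\<alpha> \<in> tight_x" "\<alpha> \<le> x" "\<And>u. u \<in> tight_x \<Longrightarrow> u \<le> x \<Longrightarrow> u \<le> \<alpha>"
    and \<beta>: "\<beta> \<in> tight_x" "x \<le> \<beta>" "\<And>u. u \<in> tight_x \<Longrightarrow> x \<le> u \<Longrightarrow> \<beta> \<le> u"
    by blast
  have "\<alpha> \<noteq> x" "x \<noteq> \<beta>" using \<alpha>(1) \<beta>(1) x by auto
  with \<alpha>(2) \<beta>(2) have lt: "\<alpha> < x" "x < \<beta>" by auto
  have nx: "slack u y \<noteq> 0" if "\<alpha> < u" "u < \<beta>" "y \<in> {0..1}" for u y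
  proof
    assume "slack u y = 0"
    with that \<alpha>(1) \<beta>(1) have "u \<in> tight_x" by (auto simp: tight_x_def)
    with \<alpha>(3)[of u] \<beta>(3)[of u] that show False by linarith
  qed
  have ab: "\<alpha> \<in> {0..1}" "\<beta> \<in> {0..1}" using \<alpha>(1) \<beta>(1) by (auto simp: tight_x_def)
  have ex_gamma: "\<exists>y\<in>{0..1}. slack \<alpha> y = 0" using \<alpha>(1) by (simp add: tight_x_def)
  obtain \<gamma> where \<gamma>: "\<gamma> \<in> {0..1}" "slack \<alpha> \<gamma> = 0"
    "\<And>y. y \<in> {0..1} \<Longrightarrow> slack \<alpha> y = 0 \<Longrightarrow> y \<le> \<gamma>"
    using tight_extremal_y[OF ab(1) ex_gamma] by metis
  have ex_delta: "\<exists>y\<in>{0..1}. slack \<beta> y = 0" using \<beta>(1) by (simp add: tight_x_def)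
  obtain \<delta> where \<delta>: "\<delta> \<in> {0..1}" "slack \<beta> \<delta> = 0"
    "\<And>y. y \<in> {0..1} \<Longrightarrow> slack \<beta> y = 0 \<Longrightarrow> \<delta> \<le> y"
    using tight_extremal_y[OF ab(2) ex_delta] by metis
  have "\<gamma> \<le> \<delta>" using tight_chain[OF ab(1) \<gamma>(1) ab(2) \<delta>(1)] \<gamma>(2) \<delta>(2) lt by auto
  moreover have "\<gamma> \<noteq> \<delta>"
    using tight_convex[of \<alpha> x \<beta> \<gamma>] nx[OF lt] ab \<gamma> \<delta> lt by auto
  ultimately have "\<gamma> < \<delta>" by simp
  moreover have "slack u y \<noteq> 0" if "u \<in> {0..1}" "\<gamma> < y" "y < \<delta>" for u y
  proof
    assume t: "slack u y = 0"
    have y: "y \<in> {0..1}" using that \<gamma> \<delta> by auto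
    consider "u < \<alpha>" | "u = \<alpha>" | "\<alpha> < u" "u < \<beta>" | "u = \<beta>" | "\<beta> < u" by linarith
    then show False
    proof cases
      case 1
      then show False using tight_chain[OF that(1) y ab(1) \<gamma>(1) t \<gamma>(2)] that by simp
    next
      case 2
      then show False using \<gamma>(3)[OF y] t that by simp
    next
      case 3
      then show False using nx[OF 3 y] t by simp
    next
      case 4
      then show False using \<delta>(3)[OF y] t that by simp
    next
      case 5
      then show False using tight_chain[OF ab(2) \<delta>(1) that(1) y \<delta>(2) t] that by simp
    qed
  qed
  ultimately show False
    using no_gap[of \<alpha> \<beta> \<gamma> \<delta>] nx ab lt \<gamma> \<delta> by auto
qed

text \<open>In a compact chain the least abscissa and its least partner are least in both
  coordinates.\<close>

lemma least_tight:
  "\<exists>k1\<in>{0..1}. \<exists>k2\<in>{0..1}. slack k1 k2 = 0 \<and>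
    (\<forall>x\<in>{0..1}. \<forall>y\<in>{0..1}. slack x y = 0 \<longrightarrow> k1 \<le> x \<and> k2 \<le> y)"
proof -
  have "1 \<in> tight_x" using slack_one by (auto simp: tight_x_def intro!: bexI[of _ 1])
  then have "tight_x \<noteq> {}" by blast
  from compact_attains_inf[OF compact_tight_x this]
  obtain k1 where k1: "k1 \<in> tight_x" "\<And>u. u \<in> tight_x \<Longrightarrow> k1 \<le> u" by blast
  then have k1m: "k1 \<in> {0..1}" by (auto simp: tight_x_def)
  have ex_k2: "\<exists>y\<in>{0..1}. slack k1 y = 0" using k1(1) by (simp add: tight_x_def)
  obtain k2 where k2: "k2 \<in> {0..1}" "slack k1 k2 = 0"
    "\<And>y. y \<in> {0..1} \<Longrightarrow> slack k1 y = 0 \<Longrightarrow> k2 \<le> y"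
    using tight_extremal_y[OF k1m ex_k2] by metis
  have "\<forall>x\<in>{0..1}. \<forall>y\<in>{0..1}. slack x y = 0 \<longrightarrow> k1 \<le> x \<and> k2 \<le> y"
  proof (intro ballI impI)
    fix x y :: real assume xy: "x \<in> {0..1}" "y \<in> {0..1}" "slack x y = 0"
    then have "x \<in> tight_x" by (auto simp: tight_x_def)
    then have "k1 \<le> x" by (rule k1(2))
    moreover from this have "k2 \<le> y"
      using tight_chain[OF k1m k2(1) xy(1,2) k2(2) xy(3)] k2(3)[OF xy(2)] xy(3) by (cases "x = k1") auto
    ultimately show "k1 \<le> x \<and> k2 \<le> y" ..
  qed
  then show ?thesis using k1m k2(1,2) by blast
qed

lemma rigid_structure:
  obtains k1 k2 where "k1 \<in> {0..1}" "k2 \<in> {0..1}"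
    "\<And>s. 0 \<le> s \<Longrightarrow> s < k1 \<Longrightarrow> f s = 0" "\<And>s. 0 \<le> s \<Longrightarrow> s < k2 \<Longrightarrow> g s = 0"
    "\<And>x. x \<in> {k1..1} \<Longrightarrow> \<exists>y\<in>{0..1}. slack x y = 0"
    "\<And>y. y \<in> {k2..1} \<Longrightarrow> \<exists>x\<in>{0..1}. slack x y = 0"
proof -
  interpret s: rigid_pair g f by (rule rigid_swap)
  \<comment> \<open>Both thresholds come from one point, the least tight pair.\<close>
  obtain k1 k2 where k: "k1 \<in> {0..1}" "k2 \<in> {0..1}" "slack k1 k2 = 0"
    "\<And>x y. x \<in> {0..1} \<Longrightarrow> y \<in> {0..1} \<Longrightarrow> slack x y = 0 \<Longrightarrow> k1 \<le> x \<and> k2 \<le> y"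
    using least_tight by blast
  show ?thesis
  proof
    show "f s = 0" if "0 \<le> s" "s < k1" for s
    proof (rule below_tight[OF k(1-3) _ _ that])
      show "slack x y \<noteq> 0" if "0 \<le> x" "x < k1" "y \<in> {0..1}" for x y
        using k(4)[of x y] that k(1) by auto
      show "slack x y \<noteq> 0" if "x \<in> {0..1}" "0 \<le> y" "y < k2" for x y
        using k(4)[of x y] that k(2) by auto
    qed
    show "g s = 0" if "0 \<le> s" "s < k2" for s
    proof (rule s.below_tight[OF k(2,1) _ _ _ that])
      show "border_slack g f k2 k1 = 0" using k(3) by (simp add: border_slack_swap)
      show "border_slack g f y x \<noteq> 0" if "0 \<le> y" "y < k2" "x \<in> {0..1}" for x y
        using k(4)[of x y] that k(2) by (auto simp: border_slack_swap)
      show "border_slack g f y x \<noteq> 0" if "y \<in> {0..1}" "0 \<le> x" "x < k1" for x y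
        using k(4)[of x y] that k(1) by (auto simp: border_slack_swap)
    qed
    show "\<exists>y\<in>{0..1}. slack x y = 0" if "x \<in> {k1..1}" for x
    proof -
      have "k1 \<in> tight_x" unfolding tight_x_def using k(1-3) by blast
      moreover have "1 \<in> tight_x" using slack_one by (auto simp: tight_x_def intro!: bexI[of _ 1])
      ultimately have "x \<in> tight_x" by (rule tight_x_connected) (use that in simp_all)
      then show ?thesis by (simp add: tight_x_def)
    qed
    show "\<exists>x\<in>{0..1}. slack x y = 0" if "y \<in> {k2..1}" for y
    proof -
      have "border_slack g f k2 k1 = 0" using k(3) by (simp add: border_slack_swap)
      then have "k2 \<in> s.tight_x" unfolding s.tight_x_def using k(1,2) by blast
      moreover have "1 \<in> s.tight_x" using s.slack_one by (auto simp: s.tight_x_def intro!: bexI[of _ 1])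
      ultimately have "y \<in> s.tight_x" by (rule s.tight_x_connected) (use that in simp_all)
      then obtain x where "x \<in> {0..1}" "border_slack g f y x = 0" by (auto simp: s.tight_x_def)
      then show ?thesis by (auto simp: border_slack_swap)
    qed
  qed (use k in auto)
qed

end

section \<open>Quantiles\<close>

abbreviation unit_lborel :: "real measure" where
  "unit_lborel \<equiv> restrict_space lborel {0..1}"

lemma prob_space_unit_lborel: "prob_space unit_lborel"
  by (auto simp: space_restrict_space emeasure_restrict_space intro!: prob_spaceI)

lemma space_unit_lborel [simp]: "space unit_lborel = {0..1}"
  by (simp add: space_restrict_space)

lemma sets_unit_lborel: "sets unit_lborel = sets (restrict_space borel {0..1})"
  by (rule sets_restrict_space_cong) simp

lemma mono_on_measurable_unit:
  "mono_on {0..1} f \<Longrightarrow> f \<in> borel_measurable unit_lborel" for f :: "real \<Rightarrow> real"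
  using borel_measurable_mono_on_fnc[of "{0..1}" f]
  by (simp add: measurable_cong_sets[OF sets_unit_lborel refl])

lemma measurable_ident_unit [measurable]: "(\<lambda>s. s) \<in> borel_measurable unit_lborel"
  by (rule mono_on_measurable_unit) (simp add: mono_on_def)

locale value_interval =
  fixes lo hi :: real and G :: "real measure"
  assumes vd: "value_distribution lo hi G"
begin

lemma prob: "prob_space G" and sets_G: "sets G = sets (restrict_space borel {lo..hi})"
  using vd by (auto simp: value_distribution_def)

sublocale prob_space G by (rule prob)

lemma space_G: "space G = {lo..hi}"
  using sets_eq_imp_space_eq[OF sets_G] by (simp add: space_restrict_space)

lemma lo_le_hi: "lo \<le> hi"
  using not_empty by (auto simp: space_G)

lemma sets_G_borel: "A \<in> sets G \<Longrightarrow> A \<in> sets borel"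
  by (auto simp: sets_G sets_restrict_space)

lemma measurable_atMost: "{w \<in> space G. w \<le> v} \<in> sets G"
proof -
  have "{w \<in> space G. w \<le> v} = {..v} \<inter> {lo..hi}" by (auto simp: space_G)
  then show ?thesis by (auto simp: sets_G sets_restrict_space)
qed

lemma mono_on_measurable:
  "mono_on {lo..hi} q \<Longrightarrow> q \<in> borel_measurable G" for q :: "real \<Rightarrow> real"
  using borel_measurable_mono_on_fnc[of "{lo..hi}" q]
  by (simp add: measurable_cong_sets[OF sets_G refl])

lemma quantile_set:
  assumes "s \<le> 1"
  shows "hi \<in> {v \<in> space G. s \<le> measure G {w \<in> space G. w \<le> v}}"
    and "bdd_below {v \<in> space G. s \<le> measure G {w \<in> space G. w \<le> v}}"
proof -
  have "{w \<in> space G. w \<le> hi} = space G" by (auto simp: space_G)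
  then show "hi \<in> {v \<in> space G. s \<le> measure G {w \<in> space G. w \<le> v}}"
    using assms lo_le_hi by (simp add: space_G prob_space[unfolded space_G])
  show "bdd_below {v \<in> space G. s \<le> measure G {w \<in> space G. w \<le> v}}"
    by (rule bdd_belowI[of _ lo]) (auto simp: space_G)
qed

lemma quantile_in: "s \<le> 1 \<Longrightarrow> quantile G s \<in> {lo..hi}"
  using quantile_set[of s] unfolding quantile_def
  by (auto intro: cInf_lower intro!: cInf_greatest simp: space_G)

lemma quantile_mono: "s \<le> t \<Longrightarrow> t \<le> 1 \<Longrightarrow> quantile G s \<le> quantile G t"
  using quantile_set[of s] quantile_set[of t] unfolding quantile_def
  by (intro cInf_superset_mono) auto

text \<open>The infimum is attained because the distribution function is right continuous.\<close>

lemma quantile_le_iff: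
  assumes s: "s \<le> 1" and v: "v \<in> {lo..hi}"
  shows "quantile G s \<le> v \<longleftrightarrow> s \<le> measure G {w \<in> space G. w \<le> v}"
proof
  assume "s \<le> measure G {w \<in> space G. w \<le> v}"
  then show "quantile G s \<le> v"
    using quantile_set[OF s] v unfolding quantile_def by (intro cInf_lower) (auto simp: space_G)
next
  assume le: "quantile G s \<le> v"
  define B where "B n = {w \<in> space G. w \<le> v + 1 / real (Suc n)}" for n
  have "s \<le> measure G (B n)" for n
  proof -
    let ?A = "{v \<in> space G. s \<le> measure G {w \<in> space G. w \<le> v}}"
    have "Inf ?A < v + 1 / real (Suc n)"
      using le unfolding quantile_def by (rule order_le_less_trans) simp
    then obtain u where u: "u \<in> ?A" "u < v + 1 / real (Suc n)"
      using quantile_set[OF s] cInf_less_iff[of ?A] by blast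
    then have "measure G {w \<in> space G. w \<le> u} \<le> measure G (B n)"
      by (intro finite_measure_mono) (auto simp: B_def measurable_atMost)
    then show ?thesis using u by simp
  qed
  moreover have "(\<lambda>n. measure G (B n)) \<longlonglongrightarrow> measure G (\<Inter>n. B n)"
  proof (rule finite_Lim_measure_decseq)
    show "decseq B"
    proof (rule decseq_SucI)
      fix n
      have "1 / real (Suc (Suc n)) \<le> 1 / real (Suc n)" by (simp add: frac_le)
      then show "B (Suc n) \<le> B n" by (force simp: B_def)
    qed
  qed (auto simp: B_def measurable_atMost)
  moreover have "(\<Inter>n. B n) = {w \<in> space G. w \<le> v}"
  proof -
    have "w \<le> v" if "\<And>n. w \<le> v + 1 / real (Suc n)" for w
    proof (rule field_le_epsilon)
      fix e :: real assume "0 < e"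
      then obtain n where "1 / real (Suc n) < e" using nat_approx_posE by blast
      then show "w \<le> v + e" using that[of n] by linarith
    qed
    moreover have "0 \<le> 1 / real (Suc n)" for n by simp
    ultimately show ?thesis by (auto simp: B_def intro: order_trans)
  qed
  ultimately show "s \<le> measure G {w \<in> space G. w \<le> v}"
    using LIMSEQ_le_const by metis
qed

lemma quantile_measurable: "quantile G \<in> unit_lborel \<rightarrow>\<^sub>M G"
proof -
  have "mono_on {0..1} (quantile G)"
    by (auto intro!: mono_onI quantile_mono)
  then have "quantile G \<in> borel_measurable unit_lborel"
    by (rule mono_on_measurable_unit)
  then have "quantile G \<in> unit_lborel \<rightarrow>\<^sub>M restrict_space borel {lo..hi}"
    using quantile_in by (intro measurable_restrict_space2) auto
  then show ?thesis
    by (simp add: measurable_cong_sets[OF refl sets_G])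
qed

text \<open>Distribution functions determine measures on \<open>borel\<close>, whereas these live on
  the trace of \<open>borel\<close> on the value interval; hence the push to the line by the
  identity and the return at the end. By \<open>quantile_le_iff\<close> the quantiles of values up
  to \<open>v\<close> form an interval starting at 0 whose length is the distribution function,
  atoms and gaps included.\<close>

lemma distr_quantile: "distr unit_lborel G (quantile G) = G"
proof -
  interpret U: prob_space unit_lborel by (rule prob_space_unit_lborel)
  let ?D = "distr unit_lborel G (quantile G)"
  have id: "(\<lambda>x. x) \<in> G \<rightarrow>\<^sub>M borel"
    using mono_on_measurable[of "\<lambda>x. x"] by (simp add: mono_on_def)
  then have id': "(\<lambda>x. x) \<in> ?D \<rightarrow>\<^sub>M borel" by simp
  interpret Dp: prob_space ?D by (rule U.prob_space_distr[OF quantile_measurable])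
  have rd: "real_distribution (distr M borel (\<lambda>x. x))" if "prob_space M" "(\<lambda>x. x) \<in> M \<rightarrow>\<^sub>M borel"
    for M :: "real measure"
    using prob_space.prob_space_distr[OF that] by (simp add: real_distribution_def real_distribution_axioms_def)
  have cdf_G: "cdf (distr G borel (\<lambda>x. x)) v = measure G {w \<in> space G. w \<le> v}" for v
    unfolding cdf_def using id
    by (subst measure_distr) (auto intro!: arg_cong[where f = "measure G"])
  have cdf_D: "cdf (distr ?D borel (\<lambda>x. x)) v = measure unit_lborel {s \<in> {0..1}. quantile G s \<le> v}" for v
  proof -
    have "cdf (distr ?D borel (\<lambda>x. x)) v = measure ?D {w \<in> space G. w \<le> v}"
      unfolding cdf_def using id'
      by (subst measure_distr) (auto intro!: arg_cong[where f = "measure ?D"])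
    also have "\<dots> = measure unit_lborel (quantile G -` {w \<in> space G. w \<le> v} \<inter> space unit_lborel)"
      by (rule measure_distr[OF quantile_measurable measurable_atMost])
    also have "quantile G -` {w \<in> space G. w \<le> v} \<inter> space unit_lborel = {s \<in> {0..1}. quantile G s \<le> v}"
      using quantile_in by (auto simp: space_G)
    finally show ?thesis .
  qed
  have "cdf (distr ?D borel (\<lambda>x. x)) v = cdf (distr G borel (\<lambda>x. x)) v" for v
  proof -
    \<comment> \<open>\<open>quantile_le_iff\<close> speaks of values in the interval only; outside
      it both distribution functions are 0 or 1.\<close>
    consider "v < lo" | "v \<in> {lo..hi}" | "hi < v" by force
    then show ?thesis
    proof cases
      case 1
      then have "{s \<in> {0..1}. quantile G s \<le> v} = {}" "{w \<in> space G. w \<le> v} = {}"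
        using quantile_in by (force simp: space_G)+
      note sets = this
      show ?thesis unfolding cdf_G cdf_D sets by simp
    next
      case 2
      let ?F = "measure G {w \<in> space G. w \<le> v}"
      have "{s \<in> {0..1}. quantile G s \<le> v} = {0..?F}"
      proof (rule set_eqI)
        fix s
        have "s \<le> ?F \<Longrightarrow> s \<le> 1" using prob_le_1 order_trans by blast
        then show "s \<in> {s \<in> {0..1}. quantile G s \<le> v} \<longleftrightarrow> s \<in> {0..?F}"
          using quantile_le_iff[OF _ 2, of s] by auto
      qed
      then show ?thesis unfolding cdf_G cdf_D using prob_le_1[of "{w \<in> space G. w \<le> v}"]
        by (simp add: measure_restrict_space)
    next
      case 3
      then have "{s \<in> {0..1}. quantile G s \<le> v} = {0..1}" "{w \<in> space G. w \<le> v} = space G"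
        using quantile_in by (force simp: space_G)+
      note sets = this
      show ?thesis unfolding cdf_G cdf_D sets using U.prob_space by (simp add: prob_space)
    qed
  qed
  then have eq: "distr ?D borel (\<lambda>x. x) = distr G borel (\<lambda>x. x)"
    by (intro cdf_unique rd ext Dp.prob_space_axioms prob id id')
  show ?thesis
  proof (rule measure_eqI)
    fix A assume "A \<in> sets ?D"
    then have A: "A \<in> sets G" by simp
    then have *: "A \<inter> space G = A" using sets.sets_into_space by blast
    have "emeasure (distr ?D borel (\<lambda>x. x)) A = emeasure ?D A"
      using emeasure_distr[OF id' sets_G_borel[OF A]] * by simp
    moreover have "emeasure (distr G borel (\<lambda>x. x)) A = emeasure G A"
      using emeasure_distr[OF id sets_G_borel[OF A]] * by simp
    ultimately show "emeasure ?D A = emeasure G A" using eq by simp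
  qed simp
qed

lemma integral_quantile:
  fixes h :: "real \<Rightarrow> real"
  assumes "h \<in> borel_measurable G"
  shows "(\<integral>s. h (quantile G s) \<partial>unit_lborel) = (\<integral>v. h v \<partial>G)"
  using integral_distr[OF quantile_measurable, of h] assms by (simp add: distr_quantile)

lemma quantile_allocation_mono:
  "mono_on {lo..hi} q \<Longrightarrow> mono_on {0..1} (quantile_allocation G q)"
  using quantile_in quantile_mono
  by (intro mono_onI) (auto simp: quantile_allocation_def mono_on_def)

lemma quantile_allocation_range:
  "q \<in> {lo..hi} \<rightarrow> {0..1} \<Longrightarrow> quantile_allocation G q \<in> {0..1} \<rightarrow> {0..1}"
  using quantile_in by (force simp: quantile_allocation_def)

end

section \<open>Weak majorization in terms of the Border slack\<close>

lemma set_integrable_unit: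
  fixes k :: "real \<Rightarrow> real"
  assumes "k \<in> borel_measurable unit_lborel" "\<And>s. s \<in> {0..1} \<Longrightarrow> \<bar>k s\<bar> \<le> C" "0 \<le> a" "b \<le> 1"
  shows "set_integrable lborel {a..b} k"
proof -
  interpret U: prob_space unit_lborel by (rule prob_space_unit_lborel)
  have "integrable unit_lborel k"
    using assms by (intro U.integrable_const_bound[of k C] AE_I2) auto
  then have "set_integrable lborel {0..1} k"
    by (simp add: integrable_restrict_space set_integrable_def)
  then show ?thesis
    using assms by (elim set_integrable_subset) auto
qed

lemma integral_unit_lborel:
  fixes k :: "real \<Rightarrow> real"
  assumes "0 \<le> a" "b \<le> 1"
  shows "(\<integral>s. indicator {a..b} s * k s \<partial>unit_lborel) = (LBINT s:{a..b}. k s)"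
proof -
  have "indicator {0..1} s * (indicator {a..b} s * k s) = indicator {a..b} s * k s" for s :: real
    using assms by (auto simp: indicator_def)
  note eq = this
  have "(\<integral>s. indicator {a..b} s * k s \<partial>unit_lborel) = (LBINT s. indicator {0..1} s * (indicator {a..b} s * k s))"
    by (subst integral_restrict_space) auto
  also have "\<dots> = (LBINT s. indicator {a..b} s * k s)" unfolding eq ..
  finally show ?thesis
    by (simp add: set_lebesgue_integral_def)
qed

lemma integral_unit_lborel':
  fixes k :: "real \<Rightarrow> real"
  assumes "k \<in> borel_measurable unit_lborel" "\<And>s. s \<in> {0..1} \<Longrightarrow> \<bar>k s\<bar> \<le> C" "0 \<le> a" "b \<le> 1"
  shows "(\<integral>s. indicator {a..b} s * k s \<partial>unit_lborel) = integral {a..b} k"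
  using set_borel_integral_eq_integral(2)[OF set_integrable_unit[OF assms]]
  by (simp add: integral_unit_lborel assms)

text \<open>Layer cake by Fubini: for fixed \<open>w\<close> the condition
  \<open>h w \<le> s\<close> cuts \<open>{x..1}\<close> down to \<open>{max x (h w)..1}\<close>. The
  general probability space lets it serve both for quantiles and for values of the opponent.\<close>

lemma (in prob_space) integral_distribution_function:
  fixes h :: "'a \<Rightarrow> real"
  assumes h[measurable]: "h \<in> borel_measurable M" and h01: "\<And>w. w \<in> space M \<Longrightarrow> h w \<in> {0..1}"
    and x: "x \<in> {0..1}"
  shows "(LBINT s:{x..1}. measure M {w \<in> space M. h w \<le> s}) = 1 - (\<integral>w. max x (h w) \<partial>M)"
proof -
  interpret U: prob_space unit_lborel by (rule prob_space_unit_lborel)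
  interpret P: pair_prob_space unit_lborel M ..
  define F :: "real \<Rightarrow> 'a \<Rightarrow> real" where "F s w = indicator {x..1} s * of_bool (h w \<le> s)" for s w
  have "case_prod F \<in> borel_measurable (unit_lborel \<Otimes>\<^sub>M M)"
    unfolding F_def by measurable
  then have int: "integrable (unit_lborel \<Otimes>\<^sub>M M) (case_prod F)"
    by (intro P.integrable_const_bound[of _ 1] AE_I2) (auto simp: F_def indicator_def)
  have 1: "(\<integral>w. F s w \<partial>M) = indicator {x..1} s * measure M {w \<in> space M. h w \<le> s}" for s
  proof -
    have "(\<integral>w. F s w \<partial>M) = (\<integral>w. indicator {x..1} s * indicator {w \<in> space M. h w \<le> s} w \<partial>M)"
      by (intro Bochner_integral_cong) (auto simp: F_def indicator_def)
    then show ?thesis by simp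
  qed
  have 2: "(\<integral>s. F s w \<partial>unit_lborel) = 1 - max x (h w)" if "w \<in> space M" for w
  proof -
    let ?m = "max x (h w)"
    have m: "0 \<le> ?m" "?m \<le> 1" using x h01[OF that] by auto
    have "(\<integral>s. F s w \<partial>unit_lborel) = (\<integral>s. indicator {?m..1} s * 1 \<partial>unit_lborel)"
      by (intro Bochner_integral_cong) (auto simp: F_def indicator_def)
    also have "\<dots> = integral {?m..1} (\<lambda>_. 1)"
      using m by (intro integral_unit_lborel'[where C = 1]) auto
    finally show ?thesis using m by simp
  qed
  have "(LBINT s:{x..1}. measure M {w \<in> space M. h w \<le> s}) = (\<integral>s. (\<integral>w. F s w \<partial>M) \<partial>unit_lborel)"
    unfolding 1 using x by (simp add: integral_unit_lborel)
  also have "\<dots> = (\<integral>w. (\<integral>s. F s w \<partial>unit_lborel) \<partial>M)"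
    by (rule P.Fubini_integral[OF int, symmetric])
  also have "\<dots> = (\<integral>w. 1 - max x (h w) \<partial>M)"
    by (intro Bochner_integral_cong 2) auto
  also have "\<dots> = 1 - (\<integral>w. max x (h w) \<partial>M)"
    using x h01 by (subst Bochner_Integration.integral_diff)
      (auto simp: prob_space intro!: integrable_const_bound[of _ 1] AE_I2)
  finally show ?thesis .
qed

section \<open>The generalized inverse and the minimum of the slack\<close>

lemma mono_inverse_empty: "{x \<in> {0..1}. g x > z} = {} \<Longrightarrow> mono_inverse g z = 1"
  and mono_inverse_nonempty:
    "{x \<in> {0..1}. g x > z} \<noteq> {} \<Longrightarrow> mono_inverse g z = Inf {x \<in> {0..1}. g x > z}"
  unfolding mono_inverse_def by (simp_all only: if_True if_False simp_thms)

text \<open>The set where \<open>g \<le> z\<close> is an initial interval ending at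
  \<open>mono_inverse g z\<close>, with or without its end, so the generalized inverse is the
  distribution function of \<open>g\<close> under Lebesgue measure. The default value 1 fits
  this.\<close>

lemma mono_inverse_eq_measure:
  assumes mono: "mono_on {0..1} g"
  shows "mono_inverse g z = measure unit_lborel {t \<in> space unit_lborel. g t \<le> z}"
proof -
  interpret U: prob_space unit_lborel by (rule prob_space_unit_lborel)
  let ?S = "{t \<in> space unit_lborel. g t \<le> z}" and ?m = "mono_inverse g z"
  let ?X = "{x \<in> {0..1}. g x > z}"
  have bdd: "bdd_below ?X" by (rule bdd_belowI[of _ 0]) auto
  have m01: "?m \<in> {0..1}"
  proof (cases "?X = {}")
    case False
    then obtain x where "x \<in> ?X" by blast
    then have "Inf ?X \<le> 1" using cInf_lower[OF \<open>x \<in> ?X\<close> bdd] by auto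
    moreover have "0 \<le> Inf ?X" using False by (intro cInf_greatest) auto
    ultimately show ?thesis using mono_inverse_nonempty[OF False] by simp
  next
    case True
    then show ?thesis using mono_inverse_empty[OF True] by simp
  qed
  have sub1: "{0..<?m} \<subseteq> ?S"
  proof
    fix t assume t: "t \<in> {0..<?m}"
    have "\<not> g t > z"
    proof
      assume "g t > z"
      then have "t \<in> ?X" using t m01 by auto
      with cInf_lower[OF this bdd] mono_inverse_nonempty[of z g] have "?m \<le> t" by force
      then show False using t by simp
    qed
    then show "t \<in> ?S" using t m01 by auto
  qed
  have sub2: "?S \<subseteq> {0..?m}"
  proof
    fix t assume t: "t \<in> ?S"
    have "t \<le> ?m"
    proof (rule ccontr)
      assume n: "\<not> t \<le> ?m"
      then have ne: "?X \<noteq> {}" using t mono_inverse_empty[of z g] by auto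
      then have "Inf ?X < t" using n mono_inverse_nonempty[of z g] by simp
      then obtain x where "x \<in> ?X" "x < t" using cInf_less_iff[OF ne bdd] by blast
      then have "g x \<le> g t" using t mono by (auto simp: mono_on_def)
      then show False using t \<open>x \<in> ?X\<close> by auto
    qed
    then show "t \<in> {0..?m}" using t by auto
  qed
  have S: "?S \<in> sets unit_lborel"
    using mono_on_measurable_unit[OF mono] by measurable
  have "{0..<?m} \<in> sets unit_lborel" "{0..?m} \<in> sets unit_lborel"
    using m01 by (auto simp: sets_restrict_space_iff)
  then have "measure unit_lborel {0..<?m} \<le> measure unit_lborel ?S"
    "measure unit_lborel ?S \<le> measure unit_lborel {0..?m}"
    using sub1 sub2 S by (intro U.finite_measure_mono; simp)+
  moreover have "measure unit_lborel {0..<?m} = ?m" "measure unit_lborel {0..?m} = ?m"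
    using m01 by (auto simp: measure_restrict_space subset_iff)
  ultimately show ?thesis by simp
qed

lemma mono_inverse_range: "mono_on {0..1} g \<Longrightarrow> mono_inverse g z \<in> {0..1}"
  using prob_space.prob_le_1[OF prob_space_unit_lborel] by (simp add: mono_inverse_eq_measure)

lemma mono_inverse_mono: "mono_on {0..1} g \<Longrightarrow> mono_on A (mono_inverse g)"
proof (rule mono_onI)
  interpret U: prob_space unit_lborel by (rule prob_space_unit_lborel)
  fix r s :: real assume g: "mono_on {0..1} g" and "r \<le> s"
  moreover have "{t \<in> space unit_lborel. g t \<le> s} \<in> sets unit_lborel"
    using mono_on_measurable_unit[OF g] by measurable
  ultimately show "mono_inverse g r \<le> mono_inverse g s"
    by (auto simp: mono_inverse_eq_measure intro!: U.finite_measure_mono)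
qed

lemma mono_inverse_le: "x \<in> {0..1} \<Longrightarrow> z < g x \<Longrightarrow> mono_inverse g z \<le> x"
  by (auto simp: mono_inverse_def intro!: cInf_lower bdd_belowI[of _ 0])

lemma less_mono_inverse:
  assumes "mono_on {0..1} g" "mono_inverse g z < x" "x \<le> 1"
  shows "z < g x"
proof -
  have ne: "{x \<in> {0..1}. g x > z} \<noteq> {}" using assms mono_inverse_empty[of z g] by auto
  then have "Inf {x \<in> {0..1}. g x > z} < x" using assms mono_inverse_nonempty[of z g] by simp
  then obtain y where "y \<in> {x \<in> {0..1}. g x > z}" "y < x"
    using cInf_less_iff[OF ne] by (metis (no_types, lifting) atLeastAtMost_iff bdd_belowI mem_Collect_eq)
  then show ?thesis using assms by (auto simp: mono_on_def intro: less_le_trans)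
qed

lemma set_lebesgue_integral_mono_on:
  fixes f :: "real \<Rightarrow> real"
  assumes "mono_on {0..1} f" "f \<in> {0..1} \<rightarrow> {0..1}" "0 \<le> a" "b \<le> 1"
  shows "(LBINT s:{a..b}. f s) = integral {a..b} f"
  using assms mono_on_measurable_unit[OF assms(1)]
  by (intro set_borel_integral_eq_integral(2) set_integrable_unit[where C = 1]) (auto simp: Pi_iff)

lemma integral_mono_inverse:
  assumes g: "mono_on {0..1} g" "g \<in> {0..1} \<rightarrow> {0..1}" and x: "x \<in> {0..1}"
  shows "integral {x..1} (mono_inverse g) = 1 - integral {0..1} (\<lambda>t. max x (g t))"
proof -
  interpret U: prob_space unit_lborel by (rule prob_space_unit_lborel)
  have m: "g \<in> borel_measurable unit_lborel" by (rule mono_on_measurable_unit[OF g(1)])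
  have "integral {x..1} (mono_inverse g) = (LBINT s:{x..1}. mono_inverse g s)"
    using mono_inverse_range[OF g(1)] x
    by (intro set_lebesgue_integral_mono_on[symmetric] mono_inverse_mono g(1)) auto
  also have "\<dots> = 1 - (\<integral>t. max x (g t) \<partial>unit_lborel)"
    unfolding mono_inverse_eq_measure[OF g(1)]
    using U.integral_distribution_function[OF m _ x] g(2) by (auto simp: Pi_iff)
  also have "(\<integral>t. max x (g t) \<partial>unit_lborel) = (\<integral>t. indicator {0..1} t * max x (g t) \<partial>unit_lborel)"
    by (intro Bochner_integral_cong) auto
  also have "\<dots> = integral {0..1} (\<lambda>t. max x (g t))"
    using m g(2) x by (intro integral_unit_lborel'[where C = 1]) (auto simp: Pi_iff abs_le_iff)
  finally show ?thesis .
qed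

lemma integrable_max_mono_on:
  fixes g :: "real \<Rightarrow> real"
  assumes "mono_on {0..1} g" "0 \<le> a" "b \<le> 1"
  shows "(\<lambda>t. max x (g t)) integrable_on {a..b}"
  using assms by (intro integrable_on_mono_on) (auto simp: mono_on_def intro: max.coboundedI2)

text \<open>\<open>max x (g t)\<close> is at least \<open>x\<close> on \<open>{0..y}\<close> and at
  least \<open>g t\<close> on \<open>{y..1}\<close>; the left side falls short of the slack by
  exactly the loss in these two bounds.\<close>

lemma majorization_gap_le_slack:
  assumes g: "mono_on {0..1} g" "g \<in> {0..1} \<rightarrow> {0..1}" and x: "x \<in> {0..1}" and y: "y \<in> {0..1}"
  shows "integral {x..1} (mono_inverse g) - integral {x..1} f \<le> border_slack f g x y"
proof -
  have gi: "g integrable_on {y..1}" using g y by (intro integrable_on_mono_on) (auto simp: mono_on_def)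
  have "x * y = integral {0..y} (\<lambda>_. x)" using y by simp
  also have "\<dots> \<le> integral {0..y} (\<lambda>t. max x (g t))"
    using y integrable_max_mono_on[OF g(1), of 0 y] by (intro integral_le) auto
  finally have "x * y \<le> integral {0..y} (\<lambda>t. max x (g t))" .
  moreover have "integral {y..1} g \<le> integral {y..1} (\<lambda>t. max x (g t))"
    using y gi integrable_max_mono_on[OF g(1), of y 1] by (intro integral_le) auto
  moreover have "integral {0..y} (\<lambda>t. max x (g t)) + integral {y..1} (\<lambda>t. max x (g t))
      = integral {0..1} (\<lambda>t. max x (g t))"
    using y integrable_max_mono_on[OF g(1), of 0 1]
    by (intro interval_integral_combine) auto
  ultimately show ?thesis
    unfolding border_slack_def using integral_mono_inverse[OF g x] by linarith
qed

text \<open>Neither bound loses anything when \<open>y\<close> is the place where \<open>g\<close>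
  crosses the level \<open>x\<close>.\<close>

lemma majorization_gap_eq_slack:
  assumes g: "mono_on {0..1} g" "g \<in> {0..1} \<rightarrow> {0..1}" and x: "x \<in> {0..1}"
  shows "integral {x..1} (mono_inverse g) - integral {x..1} f = border_slack f g x (mono_inverse g x)"
proof -
  let ?y = "mono_inverse g x"
  have y: "?y \<in> {0..1}" by (rule mono_inverse_range[OF g(1)])
  have gi: "g integrable_on {?y..1}" using g y by (intro integrable_on_mono_on) (auto simp: mono_on_def)
  have "integral {0..?y} (\<lambda>t. max x (g t)) = x * (?y - 0)"
  proof (rule integral_const_open_interval)
    fix t assume "0 < t" "t < ?y"
    then have "\<not> x < g t" using mono_inverse_le[of t x g] y by auto
    then show "max x (g t) = x" by simp
  qed (use y integrable_max_mono_on[OF g(1), of 0 ?y] in auto)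
  moreover have "integral {?y..1} (\<lambda>t. max x (g t)) \<le> integral {?y..1} g"
  proof (rule integral_le_open_interval)
    fix t assume "?y < t" "t < 1"
    then show "max x (g t) \<le> g t" using less_mono_inverse[OF g(1), of x t] by simp
  qed (use y gi integrable_max_mono_on[OF g(1), of ?y 1] in auto)
  moreover have "integral {0..?y} (\<lambda>t. max x (g t)) + integral {?y..1} (\<lambda>t. max x (g t))
      = integral {0..1} (\<lambda>t. max x (g t))"
    using y integrable_max_mono_on[OF g(1), of 0 1]
    by (intro interval_integral_combine) auto
  moreover have "integral {x..1} (mono_inverse g) - integral {x..1} f \<le> border_slack f g x ?y"
    by (rule majorization_gap_le_slack[OF g x y])
  ultimately show ?thesis
    unfolding border_slack_def using integral_mono_inverse[OF g x] by simp
qed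

lemma weakly_majorized_iff_border:
  assumes f: "mono_on {0..1} f" "f \<in> {0..1} \<rightarrow> {0..1}" and g: "mono_on {0..1} g" "g \<in> {0..1} \<rightarrow> {0..1}"
  shows "f \<preceq>\<^sub>w mono_inverse g \<longleftrightarrow> border_pair f g"
proof -
  have eq: "(LBINT z:{x..1}. f z) \<le> (LBINT z:{x..1}. mono_inverse g z) \<longleftrightarrow>
      integral {x..1} f \<le> integral {x..1} (mono_inverse g)" if "x \<in> {0..1}" for x
    using that mono_inverse_range[OF g(1)] f
    by (simp add: set_lebesgue_integral_mono_on mono_inverse_mono g(1))
  show ?thesis
  proof
    assume "f \<preceq>\<^sub>w mono_inverse g"
    then have "0 \<le> border_slack f g x y" if "x \<in> {0..1}" "y \<in> {0..1}" for x y
      using majorization_gap_le_slack[OF g that, of f] eq[OF that(1)] that(1)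
      by (force simp: weakly_majorized_def)
    then show "border_pair f g" using f g by unfold_locales auto
  next
    assume "border_pair f g"
    then interpret border_pair f g .
    show "f \<preceq>\<^sub>w mono_inverse g"
      unfolding weakly_majorized_def
    proof
      fix x :: real assume x: "x \<in> {0..1}"
      have "0 \<le> border_slack f g x (mono_inverse g x)"
        using slack_nonneg x mono_inverse_range[OF g(1)] by blast
      then show "(LBINT z:{x..1}. f z) \<le> (LBINT z:{x..1}. mono_inverse g z)"
        using majorization_gap_eq_slack[OF g x, of f] eq[OF x] by simp
    qed
  qed
qed

section \<open>Limits of monotone functions whose integrals converge\<close>

lemma mono_on_integral_bounds:
  fixes f :: "real \<Rightarrow> real"
  assumes "mono_on {a..b} f" "a \<le> b"
  shows "(b - a) * f a \<le> integral {a..b} f" "integral {a..b} f \<le> (b - a) * f b"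
proof -
  have f: "f integrable_on {a..b}" by (rule integrable_on_mono_on[OF assms(1)])
  have "integral {a..b} (\<lambda>_. f a) \<le> integral {a..b} f" "integral {a..b} f \<le> integral {a..b} (\<lambda>_. f b)"
    using f assms by (intro integral_le; auto simp: mono_on_def)+
  then show "(b - a) * f a \<le> integral {a..b} f" "integral {a..b} f \<le> (b - a) * f b"
    using assms(2) by simp_all
qed

lemma integral_tail_diff:
  fixes f :: "real \<Rightarrow> real"
  assumes "mono_on {0..1} f" "0 \<le> s" "s \<le> t" "t \<le> 1"
  shows "integral {s..1} f - integral {t..1} f = integral {s..t} f"
proof -
  have "f integrable_on {s..1}"
    using assms by (intro integrable_on_mono_on) (auto simp: mono_on_def)
  then show ?thesis
    using interval_integral_combine[of s t 1 f] assms by simp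
qed

lemma mono_tail_bounds:
  fixes f :: "real \<Rightarrow> real"
  assumes "mono_on {0..1} f" "0 \<le> s" "s \<le> t" "t \<le> 1"
  shows "(t - s) * f s \<le> integral {s..1} f - integral {t..1} f"
    "integral {s..1} f - integral {t..1} f \<le> (t - s) * f t"
  unfolding integral_tail_diff[OF assms]
  using assms mono_on_integral_bounds[of s t f] by (auto simp: mono_on_def)

text \<open>A monotone function at \<open>s\<close> lies between its means over adjacent intervals,
  and these are difference quotients of tail integrals. Their limits are controlled by values of
  \<open>a\<close> near \<open>s\<close>, so convergence holds wherever \<open>a\<close> is
  continuous, hence off a countable set.\<close>

lemma mono_limit_AE:
  fixes f :: "nat \<Rightarrow> real \<Rightarrow> real"
  assumes mono: "\<And>n. mono_on {0..1} (f n)" and c: "0 \<le> c"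
    and lim: "\<And>x. c \<le> x \<Longrightarrow> x \<le> 1 \<Longrightarrow> (\<lambda>n. integral {x..1} (f n)) \<longlonglongrightarrow> L x"
    and a: "mono_on {c<..<1} a"
    and La: "\<And>s t. c < s \<Longrightarrow> s < t \<Longrightarrow> t < 1 \<Longrightarrow> (t - s) * a s \<le> L s - L t \<and> L s - L t \<le> (t - s) * a t"
  shows "AE s in lborel. c < s \<and> s < 1 \<longrightarrow> (\<lambda>n. f n s) \<longlonglongrightarrow> a s"
proof -
  let ?D = "{s \<in> {c<..<1}. \<not> isCont a s}"
  have cD: "countable ?D" using mono_on_ctble_discont_open[of "{c<..<1}" a] a by simp
  have conv: "(\<lambda>n. f n s) \<longlonglongrightarrow> a s" if s: "c < s" "s < 1" and cont: "isCont a s" for s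
  proof (rule order_tendstoI)
    fix y assume y: "a s < y"
    have "eventually (\<lambda>t. a t < y) (at_right s)"
      using order_tendstoD(2)[OF cont[unfolded isCont_def] y] by (rule filter_leD[OF at_le, rotated]) simp
    moreover have "eventually (\<lambda>t. t < 1) (at_right s)" "eventually (\<lambda>t. s < t) (at_right s)"
      using s by (auto intro: eventually_at_rightI[of s 1])
    ultimately have "eventually (\<lambda>t. a t < y \<and> t < 1 \<and> s < t) (at_right s)"
      by eventually_elim simp
    then obtain t where t: "a t < y" "t < 1" "s < t"
      using eventually_happens'[OF trivial_limit_at_right_real] by blast
    have "(\<lambda>n. integral {s..1} (f n) - integral {t..1} (f n)) \<longlonglongrightarrow> L s - L t"
      using s t by (intro tendsto_diff lim) auto
    moreover have "L s - L t < (t - s) * y"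
      using La[of s t] s t mult_strict_left_mono[of "a t" y "t - s"] by linarith
    ultimately have "eventually (\<lambda>n. integral {s..1} (f n) - integral {t..1} (f n) < (t - s) * y) sequentially"
      by (rule order_tendstoD(2))
    then show "eventually (\<lambda>n. f n s < y) sequentially"
    proof eventually_elim
      case (elim n)
      with mono_tail_bounds(1)[OF mono[of n], of s t] s t c have "(t - s) * f n s < (t - s) * y" by linarith
      then show ?case using t by simp
    qed
  next
    fix y assume y: "y < a s"
    have "eventually (\<lambda>t. y < a t) (at_left s)"
      using order_tendstoD(1)[OF cont[unfolded isCont_def] y] by (rule filter_leD[OF at_le, rotated]) simp
    moreover have "eventually (\<lambda>t. c < t) (at_left s)" "eventually (\<lambda>t. t < s) (at_left s)"
      using s by (auto intro: eventually_at_leftI[of c s])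
    ultimately have "eventually (\<lambda>t. y < a t \<and> c < t \<and> t < s) (at_left s)"
      by eventually_elim simp
    then obtain t where t: "y < a t" "c < t" "t < s"
      using eventually_happens'[OF trivial_limit_at_left_real] by blast
    have "(\<lambda>n. integral {t..1} (f n) - integral {s..1} (f n)) \<longlonglongrightarrow> L t - L s"
      using s t by (intro tendsto_diff lim) auto
    moreover have "(s - t) * y < L t - L s"
      using La[of t s] s t mult_strict_left_mono[of y "a t" "s - t"] by linarith
    ultimately have "eventually (\<lambda>n. (s - t) * y < integral {t..1} (f n) - integral {s..1} (f n)) sequentially"
      by (rule order_tendstoD(1))
    then show "eventually (\<lambda>n. y < f n s) sequentially"
    proof eventually_elim
      case (elim n)
      with mono_tail_bounds(2)[OF mono[of n], of t s] s t c have "(s - t) * y < (s - t) * f n s" by linarith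
      then show ?case using t by simp
    qed
  qed
  have "AE s in lborel. s \<notin> ?D"
    using cD by (intro AE_not_in countable_imp_null_set_lborel)
  then show ?thesis
    by eventually_elim (use conv in auto)
qed

text \<open>No limit function is given here. The limit \<open>L\<close> of the tails is concave, and
  the right-hand derivative of \<open>- L\<close>, written as an infimum of chord slopes, serves as
  the limit. This suits the sections of the kernels, whose tails are only known to decrease.\<close>

lemma mono_integrals_convergent_AE:
  fixes f :: "nat \<Rightarrow> real \<Rightarrow> real"
  assumes mono: "\<And>n. mono_on {0..1} (f n)" and range: "\<And>n. f n \<in> {0..1} \<rightarrow> {0..1}"
    and lim: "\<And>x. 0 \<le> x \<Longrightarrow> x \<le> 1 \<Longrightarrow> (\<lambda>n. integral {x..1} (f n)) \<longlonglongrightarrow> L x"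
  shows "AE s in lborel. 0 < s \<and> s < 1 \<longrightarrow> convergent (\<lambda>n. f n s)"
proof -
  define K where "K s t = (L s - L t) / (t - s)" for s t
  define a where "a s = (INF t\<in>{s<..<1}. K s t)" for s
  have K01: "0 \<le> K s t" if "0 < s" "s < t" "t < 1" for s t
  proof -
    have "(\<lambda>n. integral {s..1} (f n) - integral {t..1} (f n)) \<longlonglongrightarrow> L s - L t"
      using that by (intro tendsto_diff lim) auto
    moreover have "0 \<le> integral {s..1} (f n) - integral {t..1} (f n)" for n
    proof -
      have "0 \<le> (t - s) * f n s" using that range[of n] by (auto simp: Pi_iff)
      then show ?thesis using mono_tail_bounds(1)[OF mono[of n], of s t] that by linarith
    qed
    ultimately have "0 \<le> L s - L t" by (intro LIMSEQ_le_const) auto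
    then show ?thesis using that by (simp add: K_def)
  qed
  \<comment> \<open>For each \<open>n\<close> the value \<open>f n t\<close> separates the mean over
    \<open>{s..t}\<close> from the mean over \<open>{t..u}\<close>.\<close>
  have Kmono: "K s t \<le> K t u" if "0 < s" "s < t" "t < u" "u < 1" for s t u
  proof -
    have "(\<lambda>n. (integral {s..1} (f n) - integral {t..1} (f n)) / (t - s)) \<longlonglongrightarrow> K s t"
      "(\<lambda>n. (integral {t..1} (f n) - integral {u..1} (f n)) / (u - t)) \<longlonglongrightarrow> K t u"
      unfolding K_def using that by (intro tendsto_divide tendsto_diff tendsto_const lim; simp)+
    moreover have "(integral {s..1} (f n) - integral {t..1} (f n)) / (t - s)
        \<le> (integral {t..1} (f n) - integral {u..1} (f n)) / (u - t)" for n
    proof -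
      have "(integral {s..1} (f n) - integral {t..1} (f n)) / (t - s) \<le> f n t"
        using mono_tail_bounds(2)[OF mono[of n], of s t] that by (simp add: divide_le_eq mult.commute)
      also have "f n t \<le> (integral {t..1} (f n) - integral {u..1} (f n)) / (u - t)"
        using mono_tail_bounds(1)[OF mono[of n], of t u] that by (simp add: le_divide_eq mult.commute)
      finally show ?thesis .
    qed
    ultimately show ?thesis by (intro LIMSEQ_le) auto
  qed
  have bdd: "bdd_below (K s ` {s<..<1})" if "0 < s" for s
    using K01[of s] that by (intro bdd_belowI[of _ 0]) auto
  have a_le: "a s \<le> K s t" if "0 < s" "s < t" "t < 1" for s t
    unfolding a_def using that bdd by (intro cINF_lower) auto
  have le_a: "K s t \<le> a t" if "0 < s" "s < t" "t < 1" for s t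
    unfolding a_def using that Kmono[of s t] by (intro cINF_greatest) auto
  have "AE s in lborel. 0 < s \<and> s < 1 \<longrightarrow> (\<lambda>n. f n s) \<longlonglongrightarrow> a s"
  proof (rule mono_limit_AE[OF mono _ lim])
    show "mono_on {0<..<1} a"
    proof (rule mono_onI)
      fix s t :: real assume "s \<in> {0<..<1}" "t \<in> {0<..<1}" "s \<le> t"
      then show "a s \<le> a t" using a_le[of s t] le_a[of s t] by (cases "s = t") auto
    qed
    show "(t - s) * a s \<le> L s - L t \<and> L s - L t \<le> (t - s) * a t" if "0 < s" "s < t" "t < 1" for s t
      using a_le[OF that] le_a[OF that] that by (simp add: K_def field_simps)
  qed auto
  then show ?thesis
    by eventually_elim (auto intro: convergentI)
qed

lemma mono_equal_tails_AE:
  fixes f g :: "real \<Rightarrow> real"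
  assumes f: "mono_on {0..1} f" and g: "mono_on {0..1} g" and c: "0 \<le> c"
    and eq: "\<And>x. c \<le> x \<Longrightarrow> x \<le> 1 \<Longrightarrow> integral {x..1} f = integral {x..1} g"
  shows "AE s in lborel. c < s \<and> s < 1 \<longrightarrow> f s = g s"
proof -
  \<comment> \<open>For a constant sequence, convergence is equality.\<close>
  have "AE s in lborel. c < s \<and> s < 1 \<longrightarrow> (\<lambda>n :: nat. f s) \<longlonglongrightarrow> g s"
  proof (rule mono_limit_AE[where f = "\<lambda>_. f" and L = "\<lambda>x. integral {x..1} f"])
    show "mono_on {c<..<1} g" using g c by (auto simp: mono_on_def)
    show "(t - s) * g s \<le> integral {s..1} f - integral {t..1} f \<and>
        integral {s..1} f - integral {t..1} f \<le> (t - s) * g t" if "c < s" "s < t" "t < 1" for s t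
      using mono_tail_bounds[OF g, of s t] eq[of s] eq[of t] that c by auto
  qed (use f c in auto)
  then show ?thesis
    by eventually_elim (auto simp: LIMSEQ_const_iff)
qed

context rigid_pair
begin

text \<open>A tight pair at \<open>x\<close> squeezes the integral of
  \<open>mono_inverse g - f\<close> over \<open>{x..1}\<close> to zero. When this happens for all
  \<open>x\<close> from \<open>k\<close> on, the tail integrals agree there, and so do the monotone
  functions almost everywhere.\<close>

lemma rigid_inverse_one:
  assumes "k \<in> {0..1}" "\<And>s. 0 \<le> s \<Longrightarrow> s < k \<Longrightarrow> f s = 0"
    "\<And>x. x \<in> {k..1} \<Longrightarrow> \<exists>y\<in>{0..1}. border_slack f g x y = 0"
  shows "f \<equiv>\<^sub>a\<^sub>e (\<lambda>s. mono_inverse g s * indicator {k..1} s)"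
proof -
  have eq: "integral {x..1} f = integral {x..1} (mono_inverse g)" if x: "k \<le> x" "x \<le> 1" for x
  proof -
    have x01: "x \<in> {0..1}" using x assms(1) by auto
    obtain y where "y \<in> {0..1}" "border_slack f g x y = 0" using assms(3)[of x] x by auto
    then have "integral {x..1} (mono_inverse g) - integral {x..1} f \<le> 0"
      using majorization_gap_le_slack[OF mono_g range_g x01, of y f] by simp
    moreover have "0 \<le> border_slack f g x (mono_inverse g x)"
      using slack_nonneg[OF x01 mono_inverse_range[OF mono_g]] .
    ultimately show ?thesis using majorization_gap_eq_slack[OF mono_g range_g x01, of f] by linarith
  qed
  have "AE s in lborel. k < s \<and> s < 1 \<longrightarrow> f s = mono_inverse g s"
    using assms(1) eq by (intro mono_equal_tails_AE mono_f mono_inverse_mono mono_g) auto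
  moreover have "AE s in lborel. s \<noteq> k" "AE s in lborel. s \<noteq> 1"
    by (rule AE_lborel_singleton)+
  ultimately show ?thesis
    unfolding ae_equal_def
    by eventually_elim (use assms(2) in \<open>auto simp: indicator_def\<close>)
qed

lemma rigid_inverse:
  "\<exists>k1\<in>{0..1}. \<exists>k2\<in>{0..1}. f \<equiv>\<^sub>a\<^sub>e (\<lambda>s. mono_inverse g s * indicator {k1..1} s) \<and>
     g \<equiv>\<^sub>a\<^sub>e (\<lambda>s. mono_inverse f s * indicator {k2..1} s)"
proof -
  interpret s: rigid_pair g f by (rule rigid_swap)
  obtain k1 k2 where k: "k1 \<in> {0..1}" "k2 \<in> {0..1}"
    "\<And>s. 0 \<le> s \<Longrightarrow> s < k1 \<Longrightarrow> f s = 0" "\<And>s. 0 \<le> s \<Longrightarrow> s < k2 \<Longrightarrow> g s = 0"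
    "\<And>x. x \<in> {k1..1} \<Longrightarrow> \<exists>y\<in>{0..1}. border_slack f g x y = 0"
    "\<And>y. y \<in> {k2..1} \<Longrightarrow> \<exists>x\<in>{0..1}. border_slack f g x y = 0"
    using rigid_structure by blast
  have "f \<equiv>\<^sub>a\<^sub>e (\<lambda>s. mono_inverse g s * indicator {k1..1} s)"
    using k by (intro rigid_inverse_one) auto
  moreover have "g \<equiv>\<^sub>a\<^sub>e (\<lambda>s. mono_inverse f s * indicator {k2..1} s)"
    using k(2,4,6) by (intro s.rigid_inverse_one) (auto simp: border_slack_swap)
  ultimately show ?thesis using k(1,2) by blast
qed

end

section \<open>Averaging a monotone function over an interval\<close>

definition average_on :: "real \<Rightarrow> real \<Rightarrow> (real \<Rightarrow> real) \<Rightarrow> real \<Rightarrow> real" where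
  "average_on c d f s = (if c \<le> s \<and> s < d then integral {c..d} f / (d - c) else f s)"

definition unit_mono :: "(real \<Rightarrow> real) \<Rightarrow> bool" where
  "unit_mono f \<longleftrightarrow> mono_on {0..1} f \<and> f \<in> {0..1} \<rightarrow> {0..1}"

lemma unit_monoD:
  assumes "unit_mono f" "0 \<le> s" "s \<le> t" "t \<le> 1"
  shows "f s \<le> f t" "0 \<le> f s" "f s \<le> 1"
proof -
  have "s \<in> {0..1}" "t \<in> {0..1}" using assms(2-4) by auto
  then show "f s \<le> f t" "0 \<le> f s" "f s \<le> 1"
    using assms(1,3) by (auto simp: unit_mono_def mono_on_def Pi_iff)
qed

lemma unit_mono_integrable: "unit_mono f \<Longrightarrow> 0 \<le> a \<Longrightarrow> b \<le> 1 \<Longrightarrow> f integrable_on {a..b}"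
  by (intro integrable_on_mono_on) (auto simp: unit_mono_def mono_on_def)

lemma unit_mono_integral_bounds:
  assumes "unit_mono f" "0 \<le> a" "a \<le> b" "b \<le> 1"
  shows "(b - a) * f a \<le> integral {a..b} f" "integral {a..b} f \<le> (b - a) * f b"
  using assms mono_on_integral_bounds[of a b f] by (auto simp: unit_mono_def mono_on_def)

lemma unit_mono_tail:
  assumes "unit_mono f" "0 \<le> s" "s \<le> t" "t \<le> 1"
  shows "integral {s..1} f = integral {s..t} f + integral {t..1} f"
  using integral_tail_diff[of f s t] assms by (simp add: unit_mono_def)

lemma average_bounds:
  assumes f: "unit_mono f" and cd: "0 \<le> c" "c < d" "d \<le> 1"
  shows "f c \<le> integral {c..d} f / (d - c)" "integral {c..d} f / (d - c) \<le> f d"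
  using unit_mono_integral_bounds[OF f, of c d] cd by (simp_all add: field_simps)

lemma unit_mono_average:
  assumes f: "unit_mono f" and cd: "0 \<le> c" "c < d" "d \<le> 1"
  shows "unit_mono (average_on c d f)"
proof -
  note fd = unit_monoD[OF f]
  obtain A where A: "integral {c..d} f / (d - c) = A" by blast
  note b = average_bounds[OF assms, unfolded A]
  have "average_on c d f s \<le> average_on c d f t" if "0 \<le> s" "s \<le> t" "t \<le> 1" for s t
    using b fd(1)[of s t] fd(1)[of s c] fd(1)[of d t] that cd by (auto simp: average_on_def A)
  moreover have "average_on c d f s \<in> {0..1}" if "0 \<le> s" "s \<le> 1" for s
    using b fd(2)[of c c] fd(3)[of d d] fd(2,3)[of s s] that cd by (auto simp: average_on_def A)
  ultimately show ?thesis by (auto simp: unit_mono_def mono_on_def Pi_iff)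
qed

lemma average_tail:
  assumes f: "unit_mono f" and cd: "0 \<le> c" "c < d" "d \<le> 1" and x: "x \<in> {0..1}"
  shows "x \<le> c \<or> d \<le> x \<Longrightarrow> integral {x..1} (average_on c d f) = integral {x..1} f"
    and "c \<le> x \<Longrightarrow> x \<le> d \<Longrightarrow>
      integral {x..1} (average_on c d f) = (d - x) * (integral {c..d} f / (d - c)) + integral {d..1} f"
proof -
  let ?f = "average_on c d f"
  note um = unit_mono_average[OF f cd]
  have right: "integral {y..1} ?f = integral {y..1} f" if "d \<le> y" for y
    using that cd by (intro integral_cong) (auto simp: average_on_def)
  have mid: "integral {y..1} ?f = (d - y) * (integral {c..d} f / (d - c)) + integral {d..1} f"
    if "c \<le> y" "y \<le> d" for y
  proof -
    have "integral {y..d} ?f = (integral {c..d} f / (d - c)) * (d - y)"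
      using that cd unit_mono_integrable[OF um]
      by (intro integral_const_open_interval) (auto simp: average_on_def)
    then show ?thesis
      using unit_mono_tail[OF um, of y d] right[of d] that cd by simp
  qed
  show "integral {x..1} ?f = (d - x) * (integral {c..d} f / (d - c)) + integral {d..1} f"
    if "c \<le> x" "x \<le> d" using mid that by simp
  show "integral {x..1} ?f = integral {x..1} f" if xx: "x \<le> c \<or> d \<le> x"
  proof (cases "x \<le> c")
    case True
    have "integral {x..c} ?f = integral {x..c} f"
    proof (rule antisym)
      show "integral {x..c} ?f \<le> integral {x..c} f" "integral {x..c} f \<le> integral {x..c} ?f"
        using unit_mono_integrable[OF um, of x c] unit_mono_integrable[OF f, of x c] x cd
        by (intro integral_le_open_interval; simp add: average_on_def)+
    qed
    moreover have "integral {c..1} ?f = integral {c..1} f"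
      using mid[of c] unit_mono_tail[OF f, of c d] cd by simp
    ultimately show ?thesis
      using unit_mono_tail[OF um, of x c] unit_mono_tail[OF f, of x c] True x cd by simp
  next
    case False
    then show ?thesis using xx right by simp
  qed
qed

text \<open>The mean of a monotone function over \<open>{c..d}\<close> is at most its mean over
  \<open>{x..d}\<close>; geometrically, a concave tail integral lies above its chord.\<close>

lemma average_tail_le:
  assumes f: "unit_mono f" and cd: "0 \<le> c" "c < d" "d \<le> 1" and x: "x \<in> {0..1}"
  shows "integral {x..1} (average_on c d f) \<le> integral {x..1} f"
proof (cases "c \<le> x \<and> x \<le> d")
  case True
  have cx: "integral {c..x} f \<le> (x - c) * f x" and xd: "(d - x) * f x \<le> integral {x..d} f"
    using unit_mono_integral_bounds[OF f] True cd by auto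
  have "integral {c..d} f = integral {c..x} f + integral {x..d} f"
    using unit_mono_tail[OF f, of c x] unit_mono_tail[OF f, of c d] unit_mono_tail[OF f, of x d] True cd by simp
  moreover have "(d - x) * integral {c..x} f \<le> (d - x) * ((x - c) * f x)"
    using cx True by (intro mult_left_mono) auto
  moreover have "(x - c) * ((d - x) * f x) \<le> (x - c) * integral {x..d} f"
    using xd True by (intro mult_left_mono) auto
  ultimately have "(d - x) * integral {c..d} f \<le> (d - c) * integral {x..d} f"
    by (simp add: algebra_simps)
  then have "(d - x) * (integral {c..d} f / (d - c)) \<le> integral {x..d} f"
    using cd by (simp add: field_simps)
  then show ?thesis
    using average_tail(2)[OF assms] unit_mono_tail[OF f, of x d] True x cd by simp
next
  case False
  then show ?thesis using average_tail(1)[OF assms] by auto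
qed

text \<open>The tail integral of a monotone function is concave, so it exceeds a line on an interval;
  averaging over that interval replaces the arc above the line by the line itself.\<close>

lemma tail_quasiconcave:
  fixes \<rho> \<sigma> :: real
  assumes g: "unit_mono g" and uvw: "0 \<le> u" "u \<le> v" "v \<le> w" "w \<le> 1"
  defines "D \<equiv> \<lambda>x. integral {x..1} g - (\<rho> - \<sigma> * x)"
  shows "min (D u) (D w) \<le> D v"
proof (cases "D u \<le> D v")
  case False
  have "D u - D v = integral {u..v} g - \<sigma> * (v - u)"
    using unit_mono_tail[OF g, of u v] uvw by (simp add: D_def algebra_simps)
  moreover have "integral {u..v} g \<le> (v - u) * g v"
    using unit_mono_integral_bounds[OF g] uvw by auto
  ultimately have "0 < (v - u) * (g v - \<sigma>)" using False by (simp add: algebra_simps)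
  then have "\<sigma> \<le> g v" using uvw by (simp add: zero_less_mult_iff)
  then have "(w - v) * \<sigma> \<le> (w - v) * g v" using uvw by (intro mult_left_mono) auto
  also have "\<dots> \<le> integral {v..w} g" using unit_mono_integral_bounds[OF g] uvw by auto
  finally have "(w - v) * \<sigma> \<le> integral {v..w} g" .
  moreover have "D v - D w = integral {v..w} g - \<sigma> * (w - v)"
    using unit_mono_tail[OF g, of v w] uvw by (simp add: D_def algebra_simps)
  ultimately show ?thesis by (simp add: algebra_simps)
qed auto

lemma line_cut:
  assumes g: "unit_mono g"
    and ends: "integral {0..1} g \<le> \<rho>" "0 \<le> \<rho> - \<sigma>"
    and exceed: "\<not> (\<forall>x\<in>{0..1}. integral {x..1} g \<le> \<rho> - \<sigma> * x)"
  obtains c d where "0 \<le> c" "c < d" "d \<le> 1"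
    "\<And>x. x \<in> {0..1} \<Longrightarrow> integral {x..1} (average_on c d g) = min (integral {x..1} g) (\<rho> - \<sigma> * x)"
proof -
  define D where "D x = integral {x..1} g - (\<rho> - \<sigma> * x)" for x
  obtain m where m: "m \<in> {0..1}" "0 < D m" using exceed by (auto simp: D_def not_le)
  have cont: "continuous_on {0..1} D"
    unfolding D_def
    by (intro continuous_intros indefinite_integral_continuous_1' unit_mono_integrable g) auto
  have D01: "D 0 \<le> 0" "D 1 \<le> 0" using ends by (auto simp: D_def)
  obtain c where c: "0 \<le> c" "c \<le> m" "D c = 0"
    using IVT'[of D 0 0 m] D01 m cont continuous_on_subset[OF cont, of "{0..m}"] by auto
  obtain d where d: "m \<le> d" "d \<le> 1" "D d = 0"
    using IVT2'[of D 1 0 m] D01 m cont continuous_on_subset[OF cont, of "{m..1}"] by auto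
  have lt: "c < m" "m < d" using c d m by (auto simp: less_le)
  note qc = tail_quasiconcave[OF g, where \<rho> = \<rho> and \<sigma> = \<sigma>, folded D_def]
  have inner: "0 \<le> D x" if "c \<le> x" "x \<le> d" for x
    using qc[of c x d] c d that by simp
  \<comment> \<open>A positive value outside, together with \<open>D m > 0\<close>, would by
    quasiconcavity make \<open>D\<close> positive at the zero \<open>c\<close> or \<open>d\<close>
    in between.\<close>
  have outer: "D x \<le> 0" if "x \<in> {0..1}" "x \<le> c \<or> d \<le> x" for x
    using qc[of x c m] qc[of m d x] that c d lt m by (auto simp: min_le_iff_disj)
  \<comment> \<open>\<open>D\<close> vanishes at both ends, so the mean of \<open>g\<close> over
    \<open>{c..d}\<close> is \<open>\<sigma>\<close>.\<close>
  have avg: "(d - x) * (integral {c..d} g / (d - c)) + integral {d..1} g = \<rho> - \<sigma> * x" for x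
  proof -
    have "integral {c..d} g = \<sigma> * (d - c)"
      using unit_mono_tail[OF g, of c d] c d lt by (simp add: D_def algebra_simps)
    then have "integral {c..d} g / (d - c) = \<sigma>" using lt by simp
    then show ?thesis using d by (simp add: D_def algebra_simps)
  qed
  show ?thesis
  proof
    show cd: "0 \<le> c" "c < d" "d \<le> 1" using c d lt by auto
    fix x :: real assume x: "x \<in> {0..1}"
    show "integral {x..1} (average_on c d g) = min (integral {x..1} g) (\<rho> - \<sigma> * x)"
    proof (cases "x \<le> c \<or> d \<le> x")
      case True
      then show ?thesis
        using average_tail(1)[OF g cd x] outer[OF x] by (auto simp: D_def)
    next
      case False
      then show ?thesis
        using average_tail(2)[OF g cd x] avg[of x] inner[of x] by (auto simp: D_def)
    qed
  qed
qed

section \<open>Existence of an allocation with given interim probabilities\<close>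

context prob_space
begin

text \<open>Mixed coordinates: the row bidder enters by quantile, where monotonicity and averaging
  take place; the opponent enters by value, so that his constraint can be stated for each
  \<open>v\<close>.\<close>

definition unit_kernel :: "(real \<Rightarrow> 'a \<Rightarrow> real) \<Rightarrow> bool" where
  "unit_kernel P \<longleftrightarrow> case_prod P \<in> borel_measurable (unit_lborel \<Otimes>\<^sub>M M) \<and>
     (\<forall>v\<in>space M. unit_mono (\<lambda>s. P s v))"

lemma unit_kernel_section: "unit_kernel P \<Longrightarrow> v \<in> space M \<Longrightarrow> unit_mono (\<lambda>s. P s v)"
  by (simp add: unit_kernel_def)

lemma unit_kernel_range:
  "unit_kernel P \<Longrightarrow> v \<in> space M \<Longrightarrow> s \<in> {0..1} \<Longrightarrow> 0 \<le> P s v \<and> P s v \<le> 1"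
  using unit_monoD[of "\<lambda>s. P s v" s s] by (auto simp: unit_kernel_def)

lemma unit_kernel_measurable_row:
  assumes "unit_kernel P" "s \<in> {0..1}"
  shows "P s \<in> borel_measurable M"
proof -
  have "case_prod P \<in> borel_measurable (unit_lborel \<Otimes>\<^sub>M M)"
    using assms(1) by (simp add: unit_kernel_def)
  from measurable_Pair2[OF this, of s] show ?thesis using assms(2) by simp
qed

lemma unit_kernel_integrable_row:
  assumes "unit_kernel P" "s \<in> {0..1}"
  shows "integrable M (P s)"
  using unit_kernel_measurable_row[OF assms] unit_kernel_range[OF assms(1) _ assms(2)]
  by (intro integrable_const_bound[of _ 1]) auto

lemma unit_kernel_row_mono:
  assumes P: "unit_kernel P"
  shows "unit_mono (\<lambda>s. \<integral>v. P s v \<partial>M)"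
proof -
  have "(\<integral>v. P s v \<partial>M) \<le> (\<integral>v. P t v \<partial>M)" if "0 \<le> s" "s \<le> t" "t \<le> 1" for s t
    using that unit_kernel_integrable_row[OF P] unit_monoD(1)[OF unit_kernel_section[OF P]]
    by (intro integral_mono) auto
  moreover have "(\<integral>v. P s v \<partial>M) \<in> {0..1}" if "s \<in> {0..1}" for s
    using unit_kernel_range[OF P _ that] unit_kernel_integrable_row[OF P that]
    by (auto intro!: integral_nonneg_AE integral_le_const)
  ultimately show ?thesis by (auto simp: unit_mono_def mono_on_def Pi_iff)
qed

lemma unit_kernel_Fubini:
  assumes P: "unit_kernel P" and cd: "0 \<le> c" "d \<le> 1"
  shows "(\<lambda>v. integral {c..d} (\<lambda>s. P s v)) \<in> borel_measurable M"
    and "(\<integral>v. integral {c..d} (\<lambda>s. P s v) \<partial>M) = integral {c..d} (\<lambda>s. \<integral>v. P s v \<partial>M)"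
proof -
  interpret U: prob_space unit_lborel by (rule prob_space_unit_lborel)
  interpret PP: pair_prob_space unit_lborel M ..
  have [measurable]: "case_prod P \<in> borel_measurable (unit_lborel \<Otimes>\<^sub>M M)"
    using P by (simp add: unit_kernel_def)
  have m: "(\<lambda>(s, v). indicator {c..d} s * P s v) \<in> borel_measurable (unit_lborel \<Otimes>\<^sub>M M)"
    by measurable
  have int: "integrable (unit_lborel \<Otimes>\<^sub>M M) (\<lambda>(s, v). indicator {c..d} s * P s v)"
    using unit_kernel_range[OF P]
    by (intro PP.integrable_const_bound[of _ 1] AE_I2 m) (auto simp: indicator_def space_pair_measure)
  have col: "(\<integral>s. indicator {c..d} s * P s v \<partial>unit_lborel) = integral {c..d} (\<lambda>s. P s v)"
    if "v \<in> space M" for v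
    using unit_kernel_section[OF P that] unit_kernel_range[OF P that] cd
    by (intro integral_unit_lborel'[where C = 1] mono_on_measurable_unit) (auto simp: unit_mono_def)
  have "(\<lambda>v. \<integral>s. indicator {c..d} s * P s v \<partial>unit_lborel) \<in> borel_measurable M"
    by measurable
  then show "(\<lambda>v. integral {c..d} (\<lambda>s. P s v)) \<in> borel_measurable M"
    by (rule measurable_cong[THEN iffD1, rotated]) (rule col)
  have row: "unit_mono (\<lambda>s. \<integral>v. P s v \<partial>M)" by (rule unit_kernel_row_mono[OF P])
  have "(\<integral>v. integral {c..d} (\<lambda>s. P s v) \<partial>M) = (\<integral>v. (\<integral>s. indicator {c..d} s * P s v \<partial>unit_lborel) \<partial>M)"
    by (intro Bochner_integral_cong) (simp_all add: col)
  also have "\<dots> = (\<integral>s. (\<integral>v. indicator {c..d} s * P s v \<partial>M) \<partial>unit_lborel)"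
    by (rule PP.Fubini_integral[OF int])
  also have "\<dots> = (\<integral>s. indicator {c..d} s * (\<integral>v. P s v \<partial>M) \<partial>unit_lborel)"
    by simp
  also have "\<dots> = integral {c..d} (\<lambda>s. \<integral>v. P s v \<partial>M)"
    using row cd by (intro integral_unit_lborel'[where C = 1] mono_on_measurable_unit)
      (auto simp: unit_mono_def Pi_iff)
  finally show "(\<integral>v. integral {c..d} (\<lambda>s. P s v) \<partial>M) = integral {c..d} (\<lambda>s. \<integral>v. P s v \<partial>M)" .
qed

text \<open>Averaging every section over the same interval commutes with integration over
  \<open>v\<close>. Hence an interval found from the row integrals alone serves to cut the whole
  kernel.\<close>

lemma unit_kernel_average:
  assumes P: "unit_kernel P" and cd: "0 \<le> c" "c < d" "d \<le> 1"
  shows "unit_kernel (\<lambda>s v. average_on c d (\<lambda>s. P s v) s)"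
    and "s \<in> {0..1} \<Longrightarrow>
      (\<integral>v. average_on c d (\<lambda>s. P s v) s \<partial>M) = average_on c d (\<lambda>s. \<integral>v. P s v \<partial>M) s"
proof -
  have [measurable]: "case_prod P \<in> borel_measurable (unit_lborel \<Otimes>\<^sub>M M)"
    using P by (simp add: unit_kernel_def)
  note [measurable] = unit_kernel_Fubini(1)[OF P cd(1,3)]
  have "(\<lambda>(s, v). average_on c d (\<lambda>s. P s v) s) \<in> borel_measurable (unit_lborel \<Otimes>\<^sub>M M)"
    unfolding average_on_def by measurable
  then show "unit_kernel (\<lambda>s v. average_on c d (\<lambda>s. P s v) s)"
    using P cd unit_mono_average by (auto simp: unit_kernel_def)
  show "(\<integral>v. average_on c d (\<lambda>s. P s v) s \<partial>M) = average_on c d (\<lambda>s. \<integral>v. P s v \<partial>M) s"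
    using unit_kernel_Fubini(2)[OF P cd(1,3)]
    unfolding average_on_def by (cases "c \<le> s \<and> s < d") (simp_all only: simp_thms if_True if_False Bochner_Integration.integral_divide_zero)
qed

lemma unit_kernel_cut:
  assumes P: "unit_kernel P" and ends: "integral {0..1} (\<lambda>s. \<integral>v. P s v \<partial>M) \<le> \<rho>" "0 \<le> \<rho> - \<sigma>"
  shows "\<exists>P'. unit_kernel P' \<and>
    (\<forall>x\<in>{0..1}. integral {x..1} (\<lambda>s. \<integral>v. P' s v \<partial>M) =
       min (integral {x..1} (\<lambda>s. \<integral>v. P s v \<partial>M)) (\<rho> - \<sigma> * x)) \<and>
    (\<forall>v\<in>space M. \<forall>x\<in>{0..1}. integral {x..1} (\<lambda>s. P' s v) \<le> integral {x..1} (\<lambda>s. P s v))"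
proof (cases "\<forall>x\<in>{0..1}. integral {x..1} (\<lambda>s. \<integral>v. P s v \<partial>M) \<le> \<rho> - \<sigma> * x")
  case True
  then show ?thesis using P by (intro exI[of _ P]) auto
next
  case False
  from line_cut[OF unit_kernel_row_mono[OF P] ends this]
  obtain c d where cd: "0 \<le> c" "c < d" "d \<le> 1"
    and eq: "\<And>x. x \<in> {0..1} \<Longrightarrow> integral {x..1} (average_on c d (\<lambda>s. \<integral>v. P s v \<partial>M)) =
      min (integral {x..1} (\<lambda>s. \<integral>v. P s v \<partial>M)) (\<rho> - \<sigma> * x)" by metis
  let ?P = "\<lambda>s v. average_on c d (\<lambda>s. P s v) s"
  have "integral {x..1} (\<lambda>s. \<integral>v. ?P s v \<partial>M) = integral {x..1} (average_on c d (\<lambda>s. \<integral>v. P s v \<partial>M))"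
    if "x \<in> {0..1}" for x
    using that by (intro integral_cong unit_kernel_average(2)[OF P cd]) auto
  moreover have "integral {x..1} (\<lambda>s. ?P s v) \<le> integral {x..1} (\<lambda>s. P s v)"
    if "v \<in> space M" "x \<in> {0..1}" for v x
    using average_tail_le[OF unit_kernel_section[OF P that(1)] cd that(2)] by simp
  ultimately show ?thesis
    using unit_kernel_average(1)[OF P cd] eq by (intro exI[of _ ?P]) auto
qed

text \<open>Starting from the deterministic kernel that serves the row bidder whenever his quantile exceeds
  \<open>q v\<close>, truncated so that the total row mass is right, cut the tail integral of the row
  probabilities successively down to each of countably many tangent lines of the target.\<close>

lemma exists_unit_kernel_sequence:
  assumes q: "q \<in> borel_measurable M" "\<And>v. v \<in> space M \<Longrightarrow> q v \<in> {0..1}"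
    and a: "unit_mono a"
    and border: "\<And>x. x \<in> {0..1} \<Longrightarrow> integral {x..1} a \<le> 1 - (\<integral>v. max x (q v) \<partial>M)"
    and r: "\<And>n :: nat. r n \<in> {0..1}"
  shows "\<exists>P. \<forall>n. unit_kernel (P n) \<and>
    (\<forall>v\<in>space M. integral {0..1} (\<lambda>s. P n s v) \<le> 1 - q v) \<and>
    (\<forall>x\<in>{0..1}. integral {x..1} a \<le> integral {x..1} (\<lambda>s. \<integral>v. P n s v \<partial>M)) \<and>
    (\<forall>x\<in>{0..1}. integral {x..1} (\<lambda>s. \<integral>v. P (Suc n) s v \<partial>M) \<le>
       min (integral {x..1} (\<lambda>s. \<integral>v. P n s v \<partial>M)) (integral {r n..1} a - a (r n) * (x - r n))) \<and>
    (\<forall>v\<in>space M. \<forall>x\<in>{0..1}. integral {x..1} (\<lambda>s. P (Suc n) s v) \<le> integral {x..1} (\<lambda>s. P n s v))"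
proof -
  define A where "A x = integral {x..1} a" for x
  \<comment> \<open>\<open>A\<close> is concave, and \<open>- a r\<close> is the slope of a
    supporting line at \<open>r\<close>, also where \<open>a\<close> jumps.\<close>
  have tangent: "A x \<le> A r - a r * (x - r)" if "r \<in> {0..1}" "x \<in> {0..1}" for r x
  proof (cases "r \<le> x")
    case True
    then show ?thesis
      using unit_mono_tail[OF a, of r x] unit_mono_integral_bounds(1)[OF a, of r x] that
      by (simp add: A_def algebra_simps)
  next
    case False
    then show ?thesis
      using unit_mono_tail[OF a, of x r] unit_mono_integral_bounds(2)[OF a, of x r] that
      by (simp add: A_def algebra_simps)
  qed
  have Amono: "A t \<le> A s" if "0 \<le> s" "s \<le> t" "t \<le> 1" for s t
  proof -
    have "0 \<le> (t - s) * a s"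
      using unit_monoD(2)[OF a, of s s] that by (intro mult_nonneg_nonneg) auto
    then show ?thesis
      using unit_mono_tail[OF a that] unit_mono_integral_bounds(1)[OF a that] by (simp add: A_def)
  qed
  \<comment> \<open>The invariant of the cuts. Total row mass equal to \<open>A 0\<close> keeps
    every tangent line above the row tail at 0, as \<open>unit_kernel_cut\<close> demands.\<close>
  define good where "good P \<longleftrightarrow> unit_kernel P \<and>
    (\<forall>v\<in>space M. integral {0..1} (\<lambda>s. P s v) \<le> 1 - q v) \<and>
    (\<forall>x\<in>{0..1}. A x \<le> integral {x..1} (\<lambda>s. \<integral>v. P s v \<partial>M)) \<and>
    integral {0..1} (\<lambda>s. \<integral>v. P s v \<partial>M) = A 0" for P
  have "\<exists>P. good P"
  proof -
    define g where "g s = measure M {v \<in> space M. q v \<le> s}" for s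
    have qm: "{v \<in> space M. q v \<le> s} \<in> sets M" for s using q(1) by measurable
    have g: "unit_mono g"
      unfolding unit_mono_def g_def using qm
      by (auto intro!: mono_onI finite_measure_mono prob_le_1)
    have gA: "A x \<le> integral {x..1} g" if "x \<in> {0..1}" for x
      using border[OF that] integral_distribution_function[OF q that] g that
      by (simp add: A_def g_def[abs_def, symmetric] set_lebesgue_integral_mono_on unit_mono_def)
    have "continuous_on {0..1} (\<lambda>x. integral {x..1} g)"
      by (intro indefinite_integral_continuous_1' unit_mono_integrable[OF g]) auto
    moreover have "0 \<le> A 0" using Amono[of 0 1] by (simp add: A_def)
    \<comment> \<open>By Border's condition the untruncated kernel has row tails at least
      \<open>A\<close>; dropping the quantiles below \<open>y\<close> brings its total mass down to
      \<open>A 0\<close>.\<close>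
    ultimately obtain y where y: "y \<in> {0..1}" "integral {y..1} g = A 0"
      using IVT2'[of "\<lambda>x. integral {x..1} g" 1 "A 0" 0] gA[of 0] by auto
    define P where "P s v = (of_bool (q v \<le> s \<and> y \<le> s) :: real)" for s v
    note [measurable] = q(1)
    have "case_prod P \<in> borel_measurable (unit_lborel \<Otimes>\<^sub>M M)"
      unfolding P_def by measurable
    then have kP: "unit_kernel P"
      by (auto simp: unit_kernel_def unit_mono_def mono_on_def P_def)
    have row: "(\<integral>v. P s v \<partial>M) = (if y \<le> s then g s else 0)" for s
    proof -
      have "(\<integral>v. P s v \<partial>M) = (\<integral>v. of_bool (y \<le> s) * indicator {v \<in> space M. q v \<le> s} v \<partial>M)"
        by (intro Bochner_integral_cong) (auto simp: P_def indicator_def)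
      then show ?thesis using qm by (simp add: g_def)
    qed
    have tail: "integral {x..1} (\<lambda>s. \<integral>v. P s v \<partial>M) = integral {max x y..1} g" if "x \<in> {0..1}" for x
    proof -
      note rm = unit_kernel_row_mono[OF kP]
      let ?m = "max x y"
      have "integral {x..?m} (\<lambda>s. \<integral>v. P s v \<partial>M) = 0 * (?m - x)"
        using unit_mono_integrable[OF rm] that y
        by (intro integral_const_open_interval) (auto simp: row)
      moreover have "integral {?m..1} (\<lambda>s. \<integral>v. P s v \<partial>M) = integral {?m..1} g"
        by (intro integral_cong) (auto simp: row)
      ultimately show ?thesis
        using unit_mono_tail[OF rm, of x ?m] that y by auto
    qed
    have "integral {0..1} (\<lambda>s. P s v) \<le> 1 - q v" if v: "v \<in> space M" for v
    proof -
      have "integral {0..1} (\<lambda>s. P s v) \<le> 1 * max 0 (1 - q v)"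
        using integral_lower_support[of "\<lambda>s. P s v" 1 "q v" 1]
          unit_mono_integrable[OF unit_kernel_section[OF kP v]] q(2)[OF v]
        by (auto simp: P_def)
      then show ?thesis using q(2)[OF v] by simp
    qed
    \<comment> \<open>Right of \<open>y\<close> the truncation changes nothing; left of it the tail
      is already \<open>A 0\<close>, the maximum of \<open>A\<close>.\<close>
    moreover have "A x \<le> integral {x..1} (\<lambda>s. \<integral>v. P s v \<partial>M)" if x: "x \<in> {0..1}" for x
      using tail[OF x] gA[OF x] y Amono[of 0 x] x by (auto simp: max_def)
    ultimately have "good P"
      using kP tail[of 0] y by (auto simp: good_def)
    then show ?thesis by blast
  qed
  moreover have "\<exists>P'. good P' \<and>
      ((\<forall>x\<in>{0..1}. integral {x..1} (\<lambda>s. \<integral>v. P' s v \<partial>M) \<le>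
         min (integral {x..1} (\<lambda>s. \<integral>v. P s v \<partial>M)) (A (r n) - a (r n) * (x - r n))) \<and>
       (\<forall>v\<in>space M. \<forall>x\<in>{0..1}. integral {x..1} (\<lambda>s. P' s v) \<le> integral {x..1} (\<lambda>s. P s v)))"
    if "good P" for P n
  proof -
    \<comment> \<open>\<open>?\<rho> - ?\<sigma> * x\<close> is the tangent line of \<open>A\<close>
      at \<open>r n\<close>.\<close>
    let ?\<rho> = "A (r n) + a (r n) * r n" and ?\<sigma> = "a (r n)"
    have "A 0 \<le> ?\<rho>" "0 \<le> ?\<rho> - ?\<sigma>"
    proof -
      have "A 0 \<le> A (r n) - a (r n) * (0 - r n)" "A 1 \<le> A (r n) - a (r n) * (1 - r n)" "A 1 = 0"
        using tangent[OF r[of n], of 0] tangent[OF r[of n], of 1] by (simp_all add: A_def)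
      then show "A 0 \<le> ?\<rho>" "0 \<le> ?\<rho> - ?\<sigma>" by (simp_all add: right_diff_distrib)
    qed
    moreover from that have "unit_kernel P" "integral {0..1} (\<lambda>s. \<integral>v. P s v \<partial>M) = A 0"
      by (simp_all add: good_def)
    ultimately have "\<exists>P'. unit_kernel P' \<and>
      (\<forall>x\<in>{0..1}. integral {x..1} (\<lambda>s. \<integral>v. P' s v \<partial>M) =
         min (integral {x..1} (\<lambda>s. \<integral>v. P s v \<partial>M)) (?\<rho> - ?\<sigma> * x)) \<and>
      (\<forall>v\<in>space M. \<forall>x\<in>{0..1}. integral {x..1} (\<lambda>s. P' s v) \<le> integral {x..1} (\<lambda>s. P s v))"
      by (intro unit_kernel_cut) simp_all
    then obtain P' where P': "unit_kernel P'"
      "\<And>x. x \<in> {0..1} \<Longrightarrow> integral {x..1} (\<lambda>s. \<integral>v. P' s v \<partial>M) =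
         min (integral {x..1} (\<lambda>s. \<integral>v. P s v \<partial>M)) (?\<rho> - ?\<sigma> * x)"
      "\<And>v x. v \<in> space M \<Longrightarrow> x \<in> {0..1} \<Longrightarrow> integral {x..1} (\<lambda>s. P' s v) \<le> integral {x..1} (\<lambda>s. P s v)"
      by blast
    have line: "?\<rho> - ?\<sigma> * x = A (r n) - a (r n) * (x - r n)" for x by (simp add: algebra_simps)
    have "good P'"
      unfolding good_def
    proof (intro conjI ballI)
      show "integral {0..1} (\<lambda>s. P' s v) \<le> 1 - q v" if "v \<in> space M" for v
        using P'(3)[OF that, of 0] that \<open>good P\<close> by (force simp: good_def)
      show "A x \<le> integral {x..1} (\<lambda>s. \<integral>v. P' s v \<partial>M)" if "x \<in> {0..1}" for x
        using P'(2)[OF that] tangent[OF r that, of n] that \<open>good P\<close> by (auto simp: good_def line)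
      show "integral {0..1} (\<lambda>s. \<integral>v. P' s v \<partial>M) = A 0"
        using P'(2)[of 0] \<open>good P\<close> tangent[OF r, of 0 n] by (simp add: good_def line min_def)
    qed (rule P'(1))
    then show ?thesis using P'(2,3) by (auto simp: line)
  qed
  ultimately obtain P where "\<forall>n. good (P n) \<and>
      ((\<forall>x\<in>{0..1}. integral {x..1} (\<lambda>s. \<integral>v. P (Suc n) s v \<partial>M) \<le>
         min (integral {x..1} (\<lambda>s. \<integral>v. P n s v \<partial>M)) (A (r n) - a (r n) * (x - r n))) \<and>
       (\<forall>v\<in>space M. \<forall>x\<in>{0..1}. integral {x..1} (\<lambda>s. P (Suc n) s v) \<le> integral {x..1} (\<lambda>s. P n s v)))"
    using dependent_nat_choice[of "\<lambda>_. good"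
      "\<lambda>n P P'. (\<forall>x\<in>{0..1}. integral {x..1} (\<lambda>s. \<integral>v. P' s v \<partial>M) \<le>
         min (integral {x..1} (\<lambda>s. \<integral>v. P s v \<partial>M)) (A (r n) - a (r n) * (x - r n))) \<and>
       (\<forall>v\<in>space M. \<forall>x\<in>{0..1}. integral {x..1} (\<lambda>s. P' s v) \<le> integral {x..1} (\<lambda>s. P s v))"]
    by metis
  then show ?thesis unfolding good_def A_def by blast
qed

text \<open>Only countably many cuts are made, so tangents at rational points must recover the tail
  integral. As \<open>a\<close> has values in \<open>{0..1}\<close>, replacing \<open>x\<close> by
  \<open>r\<close> in the tail and the tangent term cost at most \<open>\<bar>x - r\<bar>\<close>
  each; hence the tolerance \<open>e / 2\<close>.\<close>

lemma tangent_approximation: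
  assumes a: "unit_mono a" and x: "x \<in> {0..1}" and e: "0 < e"
  shows "\<exists>r\<in>\<rat> \<inter> {0..1}. integral {r..1} a - a r * (x - r) < integral {x..1} a + e"
proof -
  have "\<exists>r\<in>\<rat>. r \<in> {0..1} \<and> \<bar>x - r\<bar> < e / 2"
  proof (cases "x = 0")
    case True
    then show ?thesis using e by (intro bexI[of _ 0]) auto
  next
    case False
    then have "max 0 (x - e / 2) < x" using x e by auto
    then obtain r where "r \<in> \<rat>" "max 0 (x - e / 2) < r" "r < x" using Rats_dense_in_real by blast
    then show ?thesis using x by (intro bexI[of _ r]) auto
  qed
  then obtain r where r: "r \<in> \<rat>" "r \<in> {0..1}" "\<bar>x - r\<bar> < e / 2" by blast
  have ar: "0 \<le> a r" "a r \<le> 1" using unit_monoD(2,3)[OF a, of r r] r by auto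
  have "\<bar>a r * (x - r)\<bar> \<le> 1 * \<bar>x - r\<bar>"
    unfolding abs_mult using ar by (intro mult_right_mono) auto
  moreover have "\<bar>integral {r..1} a - integral {x..1} a\<bar> \<le> \<bar>x - r\<bar>"
  proof -
    have *: "0 \<le> integral {s..t} a \<and> integral {s..t} a \<le> t - s" if "0 \<le> s" "s \<le> t" "t \<le> 1" for s t
    proof -
      have "0 \<le> (t - s) * a s" "(t - s) * a t \<le> (t - s) * 1"
        using unit_monoD(2)[OF a, of s s] unit_monoD(3)[OF a, of t t] that
        by (simp, intro mult_left_mono, auto)
      then show ?thesis using unit_mono_integral_bounds[OF a that] by simp
    qed
    show ?thesis
    proof (cases "r \<le> x")
      case True
      then show ?thesis using *[of r x] unit_mono_tail[OF a, of r x] x r(2) by simp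
    next
      case False
      then show ?thesis using *[of x r] unit_mono_tail[OF a, of x r] x r(2) by simp
    qed
  qed
  ultimately have "integral {r..1} a - a r * (x - r) < integral {x..1} a + e"
    using r(3) abs_le_D2[of "a r * (x - r)" "\<bar>x - r\<bar>"] by (simp add: abs_le_iff)
  then show ?thesis using r by blast
qed

lemma AE_unit_lborel_open:
  assumes "AE s in lborel. 0 < s \<and> s < 1 \<longrightarrow> Q s"
  shows "AE s in unit_lborel. Q s"
proof -
  have "AE s in lborel. s \<in> {0..1} \<longrightarrow> Q s"
    using assms AE_lborel_singleton[of 0] AE_lborel_singleton[of 1]
    by eventually_elim auto
  then show ?thesis by (subst AE_restrict_space_iff) auto
qed

text \<open>Row tails converge to those of \<open>a\<close> because every rational tangent gets cut,
  which fixes the limit of the row integrals. Section tails decrease and are nonnegative, which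
  gives a pointwise limit of the kernels. Dominated convergence joins the two.\<close>

lemma exists_interim_kernel:
  assumes q: "q \<in> borel_measurable M" "\<And>v. v \<in> space M \<Longrightarrow> q v \<in> {0..1}"
    and a: "unit_mono a"
    and border: "\<And>x. x \<in> {0..1} \<Longrightarrow> integral {x..1} a \<le> 1 - (\<integral>v. max x (q v) \<partial>M)"
  shows "\<exists>Q. case_prod Q \<in> borel_measurable (unit_lborel \<Otimes>\<^sub>M M) \<and> (\<forall>s v. Q s v \<in> {0..1}) \<and>
    (\<forall>v\<in>space M. (\<integral>s. Q s v \<partial>unit_lborel) \<le> 1 - q v) \<and>
    (AE s in unit_lborel. (\<integral>v. Q s v \<partial>M) = a s)"
proof -
  interpret U: prob_space unit_lborel by (rule prob_space_unit_lborel)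
  interpret PP: pair_prob_space unit_lborel M ..
  define r where "r = from_nat_into (\<rat> \<inter> {0..1::real})"
  have ne: "\<rat> \<inter> {0..1::real} \<noteq> {}" by (auto intro: Rats_0)
  have r01: "r n \<in> {0..1}" for n using from_nat_into[OF ne, of n] by (auto simp: r_def)
  have r_range: "range r = \<rat> \<inter> {0..1}"
    unfolding r_def using countable_rat by (intro range_from_nat_into ne) auto
  obtain P where P: "\<And>n. unit_kernel (P n)"
    "\<And>n v. v \<in> space M \<Longrightarrow> integral {0..1} (\<lambda>s. P n s v) \<le> 1 - q v"
    "\<And>n x. x \<in> {0..1} \<Longrightarrow> integral {x..1} a \<le> integral {x..1} (\<lambda>s. \<integral>v. P n s v \<partial>M)"
    "\<And>n x. x \<in> {0..1} \<Longrightarrow> integral {x..1} (\<lambda>s. \<integral>v. P (Suc n) s v \<partial>M) \<le>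
       min (integral {x..1} (\<lambda>s. \<integral>v. P n s v \<partial>M)) (integral {r n..1} a - a (r n) * (x - r n))"
    "\<And>n v x. v \<in> space M \<Longrightarrow> x \<in> {0..1} \<Longrightarrow> integral {x..1} (\<lambda>s. P (Suc n) s v) \<le> integral {x..1} (\<lambda>s. P n s v)"
    using exists_unit_kernel_sequence[where r = r, OF q a border r01] by blast
  note sec = unit_kernel_section[OF P(1)]
  have tails: "(\<lambda>n. integral {x..1} (\<lambda>s. \<integral>v. P n s v \<partial>M)) \<longlonglongrightarrow> integral {x..1} a" if x: "x \<in> {0..1}" for x
  proof (rule order_tendstoI)
    fix y assume "y < integral {x..1} a"
    then show "eventually (\<lambda>n. y < integral {x..1} (\<lambda>s. \<integral>v. P n s v \<partial>M)) sequentially"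
      using P(3)[OF x] by (intro always_eventually) (auto intro: less_le_trans)
  next
    fix y assume "integral {x..1} a < y"
    then obtain \<rho> where "\<rho> \<in> \<rat> \<inter> {0..1}" "integral {\<rho>..1} a - a \<rho> * (x - \<rho>) < y"
      using tangent_approximation[OF a x, of "y - integral {x..1} a"] by auto
    then obtain k where k: "integral {r k..1} a - a (r k) * (x - r k) < y"
      unfolding r_range[symmetric] by blast
    have dec: "decseq (\<lambda>n. integral {x..1} (\<lambda>s. \<integral>v. P n s v \<partial>M))"
      using P(4)[OF x] by (intro decseq_SucI) simp
    have "integral {x..1} (\<lambda>s. \<integral>v. P n s v \<partial>M) < y" if "Suc k \<le> n" for n
      using decseqD[OF dec that] P(4)[OF x, of k] k by simp
    then show "eventually (\<lambda>n. integral {x..1} (\<lambda>s. \<integral>v. P n s v \<partial>M) < y) sequentially"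
      unfolding eventually_sequentially by blast
  qed
  have rows: "AE s in unit_lborel. (\<lambda>n. \<integral>v. P n s v \<partial>M) \<longlonglongrightarrow> a s"
  proof (rule AE_unit_lborel_open, rule mono_limit_AE[where L = "\<lambda>x. integral {x..1} a"])
    show "mono_on {0..1} (\<lambda>s. \<integral>v. P n s v \<partial>M)" for n
      using unit_kernel_row_mono[OF P(1)] by (simp add: unit_mono_def)
    show "mono_on {0<..<1} a" using a by (auto simp: unit_mono_def mono_on_def)
    show "(t - s) * a s \<le> integral {s..1} a - integral {t..1} a \<and>
        integral {s..1} a - integral {t..1} a \<le> (t - s) * a t" if "0 < s" "s < t" "t < 1" for s t
      using mono_tail_bounds[of a s t] a that by (auto simp: unit_mono_def)
  qed (use tails in auto)
  have cols: "AE s in unit_lborel. convergent (\<lambda>n. P n s v)" if v: "v \<in> space M" for v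
  proof -
    have "convergent (\<lambda>n. integral {x..1} (\<lambda>s. P n s v))" if x: "x \<in> {0..1}" for x
    proof -
      have "decseq (\<lambda>n. integral {x..1} (\<lambda>s. P n s v))"
        using P(5)[OF v x] by (intro decseq_SucI) simp
      moreover have "0 \<le> integral {x..1} (\<lambda>s. P n s v)" for n
        using unit_kernel_range[OF P(1) v] x unit_mono_integrable[OF sec[OF v], of x 1 n]
        by (intro integral_nonneg) auto
      ultimately show ?thesis
        using decseq_convergent by (metis convergentI)
    qed
    then have "(\<lambda>n. integral {x..1} (\<lambda>s. P n s v)) \<longlonglongrightarrow> lim (\<lambda>n. integral {x..1} (\<lambda>s. P n s v))"
      if "x \<in> {0..1}" for x
      using that by (simp add: convergent_LIMSEQ_iff)
    then show ?thesis
      using sec[OF v]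
      by (intro AE_unit_lborel_open mono_integrals_convergent_AE) (auto simp: unit_mono_def)
  qed
  have Pm[measurable]: "(\<lambda>(s, v). P n s v) \<in> borel_measurable (unit_lborel \<Otimes>\<^sub>M M)" for n
    using P(1)[of n] by (simp add: unit_kernel_def)
  \<comment> \<open>\<open>lim\<close> is unspecified where the sequence diverges; clamping keeps
    the kernel in \<open>{0..1}\<close> everywhere.\<close>
  define Q where "Q s v = max 0 (min 1 (lim (\<lambda>n. P n s v)))" for s v
  have Qm[measurable]: "(\<lambda>(s, v). Q s v) \<in> borel_measurable (unit_lborel \<Otimes>\<^sub>M M)"
    unfolding Q_def split_beta' using Pm[unfolded split_beta']
    by (intro borel_measurable_max borel_measurable_min borel_measurable_lim_metric) auto
  have Q01: "Q s v \<in> {0..1}" for s v by (simp add: Q_def)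
  have to_Q: "(\<lambda>n. P n s v) \<longlonglongrightarrow> Q s v"
    if "convergent (\<lambda>n. P n s v)" "v \<in> space M" "s \<in> {0..1}" for s v
  proof -
    have l: "(\<lambda>n. P n s v) \<longlonglongrightarrow> lim (\<lambda>n. P n s v)" using that(1) by (simp add: convergent_LIMSEQ_iff)
    have "0 \<le> lim (\<lambda>n. P n s v)" "lim (\<lambda>n. P n s v) \<le> 1"
      using LIMSEQ_le_const[OF l] LIMSEQ_le_const2[OF l] unit_kernel_range[OF P(1) that(2,3)] by blast+
    then show ?thesis using l by (simp add: Q_def)
  qed
  \<comment> \<open>The exceptional quantiles depend on \<open>v\<close>. Exchanging the quantifiers
    needs a measurable set, which the Cauchy property supplies.\<close>
  have "AE v in M. AE s in unit_lborel. Cauchy (\<lambda>n. P n s v)"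
    using cols by (auto simp: Cauchy_convergent_iff)
  moreover have "{x \<in> space (unit_lborel \<Otimes>\<^sub>M M). Cauchy (\<lambda>n. P n (fst x) (snd x))} \<in> sets (unit_lborel \<Otimes>\<^sub>M M)"
    using Pm[unfolded split_beta'] by (intro sets_Collect_Cauchy) auto
  ultimately have "AE s in unit_lborel. AE v in M. Cauchy (\<lambda>n. P n s v)"
    by (subst PP.AE_commute) (auto simp: split_beta')
  then have "AE s in unit_lborel. (\<integral>v. Q s v \<partial>M) = a s"
    using rows AE_space
  proof eventually_elim
    case (elim s)
    then have s: "s \<in> {0..1}" by simp
    have [measurable]: "Q s \<in> borel_measurable M" "P n s \<in> borel_measurable M" for n
      using measurable_Pair2[OF Qm, of s] unit_kernel_measurable_row[OF P(1) s] s by auto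
    have "(\<lambda>n. \<integral>v. P n s v \<partial>M) \<longlonglongrightarrow> (\<integral>v. Q s v \<partial>M)"
    proof (rule integral_dominated_convergence[where w = "\<lambda>_. 1"])
      show "AE v in M. (\<lambda>n. P n s v) \<longlonglongrightarrow> Q s v"
        using elim(1) AE_space by eventually_elim (auto intro: to_Q s simp: Cauchy_convergent_iff)
      show "AE v in M. norm (P n s v) \<le> 1" for n
        using unit_kernel_range[OF P(1) _ s] by (intro AE_I2) auto
    qed auto
    then show ?case using elim(2) LIMSEQ_unique by blast
  qed
  moreover have "(\<integral>s. Q s v \<partial>unit_lborel) \<le> 1 - q v" if v: "v \<in> space M" for v
  proof -
    have [measurable]: "(\<lambda>s. Q s v) \<in> borel_measurable unit_lborel" "(\<lambda>s. P n s v) \<in> borel_measurable unit_lborel" for n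
      using measurable_Pair1[OF Qm v] measurable_Pair1[OF Pm v] by auto
    have "(\<lambda>n. \<integral>s. P n s v \<partial>unit_lborel) \<longlonglongrightarrow> (\<integral>s. Q s v \<partial>unit_lborel)"
    proof (rule integral_dominated_convergence[where w = "\<lambda>_. 1"])
      show "AE s in unit_lborel. (\<lambda>n. P n s v) \<longlonglongrightarrow> Q s v"
        using cols[OF v] AE_space by eventually_elim (auto intro: to_Q v)
      show "AE s in unit_lborel. norm (P n s v) \<le> 1" for n
        using unit_kernel_range[OF P(1) v] by (intro AE_I2) auto
    qed auto
    moreover have "(\<integral>s. P n s v \<partial>unit_lborel) \<le> 1 - q v" for n
    proof -
      have "(\<integral>s. P n s v \<partial>unit_lborel) = (\<integral>s. indicator {0..1} s * P n s v \<partial>unit_lborel)"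
        by (intro Bochner_integral_cong) auto
      also have "\<dots> = integral {0..1} (\<lambda>s. P n s v)"
        using unit_kernel_range[OF P(1) v] by (intro integral_unit_lborel'[where C = 1]) auto
      finally show ?thesis using P(2)[OF v] by simp
    qed
    ultimately show ?thesis by (intro LIMSEQ_le_const2) auto
  qed
  ultimately show ?thesis using Qm Q01 by (intro exI[of _ Q]) auto
qed

end

section \<open>From the quantile square back to value profiles\<close>

text \<open>The conditional expectation of \<open>f\<close> given \<open>T\<close>, as a function of the value of \<open>T\<close>.\<close>

lemma exists_factored_expectation:
  fixes f :: "'a \<Rightarrow> real" and N :: "'b measure"
  assumes M: "prob_space M" and T[measurable]: "T \<in> M \<rightarrow>\<^sub>M N" and TN: "distr M N T = N"
    and f[measurable]: "f \<in> borel_measurable M" and f01: "\<And>z. z \<in> space M \<Longrightarrow> f z \<in> {0..1}"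
  shows "\<exists>p\<in>borel_measurable N. (\<forall>w. p w \<in> {0..1}) \<and>
    (\<forall>E\<in>sets N. (\<integral>w. indicator E w * p w \<partial>N) = (\<integral>z. indicator E (T z) * f z \<partial>M))"
proof -
  interpret M: prob_space M by (rule M)
  interpret N: prob_space N using M.prob_space_distr[OF T] by (simp add: TN)
  \<comment> \<open>The image under \<open>T\<close> of the measure with density \<open>f\<close>;
    its density with respect to \<open>N\<close> is the function sought.\<close>
  define \<nu> where "\<nu> = distr (density M (\<lambda>z. ennreal (f z))) N T"
  have \<nu>: "emeasure \<nu> E = (\<integral>\<^sup>+z. ennreal (indicator E (T z) * f z) \<partial>M)" if E: "E \<in> sets N" for E
  proof -
    have "emeasure \<nu> E = (\<integral>\<^sup>+z. ennreal (f z) * indicator (T -` E \<inter> space M) z \<partial>M)"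
      unfolding \<nu>_def using E by (simp add: emeasure_distr emeasure_density)
    also have "\<dots> = (\<integral>\<^sup>+z. ennreal (indicator E (T z) * f z) \<partial>M)"
      by (intro nn_integral_cong) (auto simp: indicator_def)
    finally show ?thesis .
  qed
  have le: "emeasure \<nu> E \<le> emeasure N E" if E: "E \<in> sets N" for E
  proof -
    have "emeasure \<nu> E \<le> (\<integral>\<^sup>+z. indicator (T -` E \<inter> space M) z \<partial>M)"
      unfolding \<nu>[OF E] using f01 by (intro nn_integral_mono) (auto simp: indicator_def)
    also have "\<dots> = emeasure (distr M N T) E"
      using E by (simp add: emeasure_distr)
    finally show ?thesis by (simp add: TN)
  qed
  have "absolutely_continuous N \<nu>"
    unfolding absolutely_continuous_def null_sets_def
    using le by (auto simp: \<nu>_def) (metis le_zero_eq \<nu>_def)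
  from N.Radon_Nikodym[OF this] obtain h where h[measurable]: "h \<in> borel_measurable N"
    and dh: "density N h = \<nu>" by (auto simp: \<nu>_def)
  have "emeasure \<nu> (space N) \<noteq> \<infinity>" using le[of "space N"] by (auto simp: N.emeasure_space_1 top_unique)
  moreover have "emeasure \<nu> (space N) = (\<integral>\<^sup>+w. h w \<partial>N)"
    unfolding dh[symmetric] by (subst emeasure_density) (auto intro!: nn_integral_cong)
  ultimately have fin: "AE w in N. h w \<noteq> \<infinity>" by (intro nn_integral_PInf_AE) auto
  define p where "p w = enn2real (h w)" for w
  have p[measurable]: "p \<in> borel_measurable N" unfolding p_def by measurable
  have pn: "0 \<le> p w" for w by (simp add: p_def)
  have nnp: "(\<integral>\<^sup>+w. ennreal (indicator E w * p w) \<partial>N) = emeasure \<nu> E" if E: "E \<in> sets N" for E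
  proof -
    have "(\<integral>\<^sup>+w. ennreal (indicator E w * p w) \<partial>N) = (\<integral>\<^sup>+w. h w * indicator E w \<partial>N)"
      using fin by (intro nn_integral_cong_AE) (auto simp: p_def indicator_def ennreal_enn2real_if)
    then show ?thesis using E by (simp add: dh[symmetric] emeasure_density)
  qed
  have eq: "(\<integral>w. indicator E w * p w \<partial>N) = (\<integral>z. indicator E (T z) * f z \<partial>M)" if E: "E \<in> sets N" for E
  proof -
    have "(\<integral>w. indicator E w * p w \<partial>N) = enn2real (emeasure \<nu> E)"
      using E pn by (subst integral_eq_nn_integral) (auto simp: nnp)
    also have "\<dots> = (\<integral>z. indicator E (T z) * f z \<partial>M)"
      unfolding \<nu>[OF E] using E f01 by (subst integral_eq_nn_integral) auto
    finally show ?thesis .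
  qed
  \<comment> \<open>Where \<open>p\<close> exceeds 1 its integral is at most the measure of that
    set, so the set is null.\<close>
  have "AE w in N. p w \<le> 1"
  proof -
    define E where "E = {w \<in> space N. 1 < p w}"
    have E[measurable]: "E \<in> sets N" unfolding E_def by measurable
    have "(\<integral>\<^sup>+w. ennreal (p w) \<partial>N) = emeasure \<nu> (space N)"
      using nnp[of "space N"] by (simp add: nn_integral_cong[of N "\<lambda>w. ennreal (indicator (space N) w * p w)"])
    then have ip: "integrable N p"
      using \<open>emeasure \<nu> (space N) \<noteq> \<infinity>\<close> pn by (intro integrableI_nonneg) (auto simp: top.not_eq_extremum)
    then have ig: "integrable N (\<lambda>w. indicator E w * p w)"
      using integrable_mult_indicator[OF E ip] by simp
    have ii: "integrable N (indicator E :: 'b \<Rightarrow> real)"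
      by (intro N.integrable_const_bound[of _ 1]) auto
    have "(\<integral>w. indicator E w * p w \<partial>N) = (\<integral>z. indicator E (T z) * f z \<partial>M)" by (rule eq[OF E])
    also have "\<dots> \<le> (\<integral>z. indicator E (T z) \<partial>M)"
      using f01 by (intro integral_mono M.integrable_const_bound[of _ 1]) (auto simp: indicator_def)
    also have "\<dots> = (\<integral>w. indicator E w \<partial>distr M N T)"
      by (subst integral_distr) auto
    finally have "(\<integral>w. indicator E w * p w \<partial>N) \<le> (\<integral>w. indicator E w \<partial>N)" by (simp add: TN)
    then have "(\<integral>w. indicator E w * p w - indicator E w \<partial>N) \<le> 0"
      using ig ii by (subst Bochner_Integration.integral_diff) auto
    moreover have nn: "0 \<le> indicator E w * p w - indicator E w" for w
      by (auto simp: E_def indicator_def)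
    then have "0 \<le> (\<integral>w. indicator E w * p w - indicator E w \<partial>N)"
      by (intro integral_nonneg_AE) auto
    ultimately have "(\<integral>w. indicator E w * p w - indicator E w \<partial>N) = 0"
      by linarith
    then have "AE w in N. indicator E w * p w - indicator E w = 0"
      using Bochner_Integration.integrable_diff[OF ig ii] nn
      by (subst (asm) integral_nonneg_eq_0_iff_AE) auto
    then show ?thesis using AE_space
      by eventually_elim (auto simp: E_def indicator_def split: if_splits)
  qed
  \<comment> \<open>Truncation at 1 turns the almost everywhere bound into one at every point
    without changing the integrals.\<close>
  then have le1: "AE w in N. indicator E w * min 1 (p w) = indicator E w * p w" for E
    by eventually_elim (simp add: min_def)
  have "(\<integral>w. indicator E w * min 1 (p w) \<partial>N) = (\<integral>z. indicator E (T z) * f z \<partial>M)"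
    if E[measurable]: "E \<in> sets N" for E
  proof -
    have "(\<integral>w. indicator E w * min 1 (p w) \<partial>N) = (\<integral>w. indicator E w * p w \<partial>N)"
      by (intro integral_cong_AE le1) measurable
    then show ?thesis using eq[OF E] by simp
  qed
  note int = this
  show ?thesis
  proof (intro bexI[of _ "\<lambda>w. min 1 (p w)"] conjI allI ballI)
    show "min 1 (p w) \<in> {0..1}" for w using pn[of w] by simp
    show "(\<lambda>w. min 1 (p w)) \<in> borel_measurable N" by measurable
  qed (rule int)
qed

section \<open>Transfers from the envelope formula\<close>

context value_interval
begin

text \<open>The payment that leaves a bidder of value \<open>v\<close> the interim utility
  \<open>integral {lo..v} q\<close>, hence nothing at the lowest value.\<close>

definition envelope_transfer :: "(real \<Rightarrow> real) \<Rightarrow> real \<Rightarrow> real" where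
  "envelope_transfer q v = v * q v - integral {lo..v} q"

text \<open>The loss from reporting \<open>r\<close> at value \<open>v\<close> is the integral of
  \<open>q - q r\<close> from \<open>r\<close> to \<open>v\<close>, nonnegative in either direction
  by monotonicity.\<close>

lemma envelope_transfer_incentive:
  assumes q: "mono_on {lo..hi} q" and v: "v \<in> {lo..hi}" and r: "r \<in> {lo..hi}"
  shows "v * q r - envelope_transfer q r \<le> v * q v - envelope_transfer q v"
proof -
  have m: "mono_on {a..b} q" if "lo \<le> a" "b \<le> hi" for a b
    using q that by (auto simp: mono_on_def)
  show ?thesis
  proof (cases "r \<le> v")
    case True
    have "integral {lo..r} q + integral {r..v} q = integral {lo..v} q"
      using True v r by (intro interval_integral_combine integrable_on_mono_on m) auto
    moreover have "(v - r) * q r \<le> integral {r..v} q"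
      using True v r by (intro mono_on_integral_bounds m) auto
    ultimately show ?thesis by (simp add: envelope_transfer_def algebra_simps)
  next
    case False
    have "integral {lo..v} q + integral {v..r} q = integral {lo..r} q"
      using False v r by (intro interval_integral_combine integrable_on_mono_on m) auto
    moreover have "integral {v..r} q \<le> (r - v) * q r"
      using False v r by (intro mono_on_integral_bounds m) auto
    ultimately show ?thesis by (simp add: envelope_transfer_def algebra_simps)
  qed
qed

lemma envelope_transfer_rational:
  assumes "mono_on {lo..hi} q" "q \<in> {lo..hi} \<rightarrow> {0..1}" "v \<in> {lo..hi}"
  shows "0 \<le> v * q v - envelope_transfer q v"
proof -
  have "q integrable_on {lo..v}"
    using assms by (intro integrable_on_mono_on) (auto simp: mono_on_def)
  then show ?thesis
    using assms by (auto simp: envelope_transfer_def Pi_iff intro!: integral_nonneg)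
qed

lemma envelope_transfer_measurable:
  assumes q: "mono_on {lo..hi} q" "q \<in> {lo..hi} \<rightarrow> {0..1}"
  shows "envelope_transfer q \<in> borel_measurable G"
proof -
  have "mono_on {lo..hi} (\<lambda>v. integral {lo..v} q)"
  proof (rule mono_onI)
    fix r s assume rs: "r \<in> {lo..hi}" "s \<in> {lo..hi}" "r \<le> s"
    have "q integrable_on {lo..s}" "q integrable_on {lo..r}"
      using q(1) rs by (auto intro!: integrable_on_mono_on simp: mono_on_def)
    then show "integral {lo..r} q \<le> integral {lo..s} q"
      using rs q(2) by (intro integral_subset_le) (auto simp: Pi_iff)
  qed
  then have "(\<lambda>v. integral {lo..v} q) \<in> borel_measurable G" by (rule mono_on_measurable)
  moreover have "(\<lambda>v. v) \<in> borel_measurable G" by (rule mono_on_measurable) (simp add: mono_on_def)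
  moreover have "q \<in> borel_measurable G" by (rule mono_on_measurable[OF q(1)])
  ultimately show ?thesis unfolding envelope_transfer_def[abs_def] by measurable
qed

end

lemma envelope_mechanism_side:
  assumes H: "prob_space H" and G: "value_interval lo hi G"
    and q: "mono_on {lo..hi} q" "q \<in> {lo..hi} \<rightarrow> {0..1}"
    and p: "\<And>v. v \<in> space G \<Longrightarrow> integrable H (p v)" "\<And>v. v \<in> space G \<Longrightarrow> (\<integral>w. p v w \<partial>H) = q v"
  shows "bayes_incentive_compatible G H p (\<lambda>v _. value_interval.envelope_transfer lo q v)"
    and "bayes_individually_rational G H p (\<lambda>v _. value_interval.envelope_transfer lo q v)"
proof -
  interpret H: prob_space H by (rule H)
  interpret value_interval lo hi G by (rule G)
  have u: "interim_utility H p (\<lambda>v _. envelope_transfer q v) r v = v * q r - envelope_transfer q r"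
    if "r \<in> space G" for r v
    using p[OF that] by (simp add: interim_utility_def H.prob_space mult.commute)
  show "bayes_incentive_compatible G H p (\<lambda>v _. envelope_transfer q v)"
    using envelope_transfer_incentive[OF q(1)]
    by (auto simp: bayes_incentive_compatible_def u space_G[symmetric])
  show "bayes_individually_rational G H p (\<lambda>v _. envelope_transfer q v)"
    using envelope_transfer_rational[OF q]
    by (auto simp: bayes_individually_rational_def u space_G[symmetric])
qed

section \<open>Border's condition characterizes reduced forms\<close>

locale two_bidders = B1: value_interval lo1 hi1 G1 + B2: value_interval lo2 hi2 G2
  for lo1 hi1 G1 lo2 hi2 G2
begin

sublocale PP: pair_prob_space G1 G2 ..

text \<open>A kernel in the quantile of bidder 1 is not a function of his value, since an atom
  spreads over an interval of quantiles. The conditional expectation under \<open>T\<close> averages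
  over that interval, and testing on rectangles shows that both marginals survive.\<close>

lemma exists_interim_allocation:
  assumes q1: "mono_on {lo1..hi1} q1" "q1 \<in> {lo1..hi1} \<rightarrow> {0..1}"
    and q2: "mono_on {lo2..hi2} q2" "q2 \<in> {lo2..hi2} \<rightarrow> {0..1}"
    and border: "border_pair (quantile_allocation G1 q1) (quantile_allocation G2 q2)"
  shows "\<exists>p. case_prod p \<in> borel_measurable (G1 \<Otimes>\<^sub>M G2) \<and> (\<forall>v w. p v w \<in> {0..1}) \<and>
    (AE v in G1. (\<integral>w. p v w \<partial>G2) = q1 v) \<and> (AE w in G2. (\<integral>v. p v w \<partial>G1) \<le> 1 - q2 w)"
proof -
  let ?a = "quantile_allocation G1 q1" and ?b = "quantile_allocation G2 q2"
  interpret bp: border_pair ?a ?b by (rule border)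
  interpret U: prob_space unit_lborel by (rule prob_space_unit_lborel)
  interpret UP: pair_prob_space unit_lborel G2 ..
  note [measurable] = B1.mono_on_measurable[OF q1(1)] B2.mono_on_measurable[OF q2(1)]
    B1.quantile_measurable
  have q1r: "q1 v \<in> {0..1}" if "v \<in> space G1" for v using q1(2) that B1.space_G by auto
  have q2r: "q2 w \<in> {0..1}" if "w \<in> space G2" for w using q2(2) that B2.space_G by auto
  have a: "unit_mono ?a" using bp.mono_f bp.range_f by (simp add: unit_mono_def)
  \<comment> \<open>Border's condition at its worst \<open>y\<close>, rewritten as an expectation
    over the values of the opponent.\<close>
  have le: "integral {x..1} ?a \<le> 1 - (\<integral>w. max x (q2 w) \<partial>G2)" if x: "x \<in> {0..1}" for x
  proof -
    have "0 \<le> border_slack ?a ?b x (mono_inverse ?b x)"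
      using x mono_inverse_range[OF bp.mono_g] by (rule bp.slack_nonneg)
    then have "integral {x..1} ?a \<le> integral {x..1} (mono_inverse ?b)"
      using majorization_gap_eq_slack[OF bp.mono_g bp.range_g x, of ?a] by simp
    also have "\<dots> = 1 - integral {0..1} (\<lambda>t. max x (?b t))"
      by (rule integral_mono_inverse[OF bp.mono_g bp.range_g x])
    also have "integral {0..1} (\<lambda>t. max x (?b t)) = (\<integral>t. indicator {0..1} t * max x (?b t) \<partial>unit_lborel)"
      using mono_on_measurable_unit[OF bp.mono_g] bp.range_g x
      by (intro integral_unit_lborel'[symmetric, where C = 1]) (auto simp: Pi_iff abs_le_iff)
    also have "\<dots> = (\<integral>t. max x (q2 (quantile G2 t)) \<partial>unit_lborel)"
      by (intro Bochner_integral_cong) (auto simp: quantile_allocation_def)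
    also have "\<dots> = (\<integral>w. max x (q2 w) \<partial>G2)"
      by (rule B2.integral_quantile) measurable
    finally show ?thesis .
  qed
  obtain Q where Q: "case_prod Q \<in> borel_measurable (unit_lborel \<Otimes>\<^sub>M G2)" "\<And>s w. Q s w \<in> {0..1}"
    "\<And>w. w \<in> space G2 \<Longrightarrow> (\<integral>s. Q s w \<partial>unit_lborel) \<le> 1 - q2 w"
    "AE s in unit_lborel. (\<integral>w. Q s w \<partial>G2) = ?a s"
    using B2.exists_interim_kernel[OF _ q2r a le] by (auto intro: B2.mono_on_measurable[OF q2(1)])
  note [measurable] = Q(1)
  define T where "T = (\<lambda>(s, w). (quantile G1 s, w :: real))"
  have T[measurable]: "T \<in> unit_lborel \<Otimes>\<^sub>M G2 \<rightarrow>\<^sub>M G1 \<Otimes>\<^sub>M G2"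
    unfolding T_def by measurable
  have TN: "distr (unit_lborel \<Otimes>\<^sub>M G2) (G1 \<Otimes>\<^sub>M G2) T = G1 \<Otimes>\<^sub>M G2"
  proof -
    have "distr unit_lborel G1 (quantile G1) \<Otimes>\<^sub>M distr G2 G2 (\<lambda>w. w) =
        distr (unit_lborel \<Otimes>\<^sub>M G2) (G1 \<Otimes>\<^sub>M G2) (\<lambda>(s, w). (quantile G1 s, w))"
      by (rule pair_measure_distr) (auto simp: B2.sigma_finite_measure_axioms)
    then show ?thesis by (simp add: B1.distr_quantile T_def)
  qed
  obtain p where p[measurable]: "p \<in> borel_measurable (G1 \<Otimes>\<^sub>M G2)" and p01: "\<And>z. p z \<in> {0..1}"
    and pE: "\<And>E. E \<in> sets (G1 \<Otimes>\<^sub>M G2) \<Longrightarrow> (\<integral>z. indicator E z * p z \<partial>(G1 \<Otimes>\<^sub>M G2)) =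
      (\<integral>z. indicator E (T z) * case_prod Q z \<partial>(unit_lborel \<Otimes>\<^sub>M G2))"
    using exists_factored_expectation[OF UP.prob_space_axioms T TN Q(1)] Q(2) by (auto simp: split_beta')
  have ip: "integrable (G1 \<Otimes>\<^sub>M G2) (\<lambda>z. indicator E z * p z)" if "E \<in> sets (G1 \<Otimes>\<^sub>M G2)" for E
    using that p01 by (intro PP.integrable_const_bound[of _ 1]) (auto simp: indicator_def)
  have iQ: "integrable (unit_lborel \<Otimes>\<^sub>M G2) (\<lambda>z. indicator E (T z) * case_prod Q z)"
    if "E \<in> sets (G1 \<Otimes>\<^sub>M G2)" for E
    using that Q(2) by (intro UP.integrable_const_bound[of _ 1]) (auto simp: indicator_def split_beta')
  have rows: "AE v in G1. (\<integral>w. p (v, w) \<partial>G2) = q1 v"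
  proof (rule density_unique_real)
    show "integrable G1 (\<lambda>v. \<integral>w. p (v, w) \<partial>G2)"
      using PP.integrable_fst'[of p] ip[of "space (G1 \<Otimes>\<^sub>M G2)"]
      by (intro PP.integrable_fst') (simp add: PP.integrable_const_bound[of p 1] p01[simplified])
    show "integrable G1 q1"
      using q1r by (intro B1.integrable_const_bound[of _ 1]) auto
    fix A assume A[measurable]: "A \<in> sets G1"
    let ?E = "A \<times> space G2"
    have E: "?E \<in> sets (G1 \<Otimes>\<^sub>M G2)" by simp
    have "(\<integral>v\<in>A. (\<integral>w. p (v, w) \<partial>G2) \<partial>G1) = (\<integral>v. (\<integral>w. indicator ?E (v, w) * p (v, w) \<partial>G2) \<partial>G1)"
      unfolding set_lebesgue_integral_def
      by (intro Bochner_integral_cong) (auto simp: indicator_def intro!: Bochner_integral_cong)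
    also have "\<dots> = (\<integral>z. indicator ?E z * p z \<partial>(G1 \<Otimes>\<^sub>M G2))"
      by (rule PP.integral_fst'[OF ip[OF E]])
    also have "\<dots> = (\<integral>z. indicator ?E (T z) * case_prod Q z \<partial>(unit_lborel \<Otimes>\<^sub>M G2))"
      by (rule pE[OF E])
    also have "\<dots> = (\<integral>s. (\<integral>w. indicator ?E (T (s, w)) * Q s w \<partial>G2) \<partial>unit_lborel)"
      using UP.integral_fst'[OF iQ[OF E]] by simp
    also have "\<dots> = (\<integral>s. indicator A (quantile G1 s) * (\<integral>w. Q s w \<partial>G2) \<partial>unit_lborel)"
      by (intro Bochner_integral_cong)
        (auto simp: T_def indicator_def intro!: Bochner_integral_cong)
    also have "\<dots> = (\<integral>s. indicator A (quantile G1 s) * q1 (quantile G1 s) \<partial>unit_lborel)"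
    proof (rule integral_cong_AE)
      show "AE s in unit_lborel. indicator A (quantile G1 s) * (\<integral>w. Q s w \<partial>G2) =
          indicator A (quantile G1 s) * q1 (quantile G1 s)"
        using Q(4) by eventually_elim (simp add: quantile_allocation_def)
    qed measurable
    also have "\<dots> = (\<integral>v. indicator A v * q1 v \<partial>G1)"
      by (rule B1.integral_quantile) measurable
    finally show "(\<integral>v\<in>A. (\<integral>w. p (v, w) \<partial>G2) \<partial>G1) = (\<integral>v\<in>A. q1 v \<partial>G1)"
      by (simp add: set_lebesgue_integral_def)
  qed
  have cols: "AE w in G2. (\<integral>v. p (v, w) \<partial>G1) = (\<integral>s. Q s w \<partial>unit_lborel)"
  proof (rule density_unique_real)
    show "integrable G2 (\<lambda>w. \<integral>v. p (v, w) \<partial>G1)"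
      using p01 by (intro B2.integrable_const_bound[of _ 1] AE_I2)
        (auto intro!: abs_leI B1.integral_le_const B1.integrable_const_bound[of _ 1]
          order_trans[OF _ integral_nonneg_AE])
    show "integrable G2 (\<lambda>w. \<integral>s. Q s w \<partial>unit_lborel)"
      using Q(2) by (intro B2.integrable_const_bound[of _ 1] AE_I2)
        (auto intro!: abs_leI U.integral_le_const U.integrable_const_bound[of _ 1]
          order_trans[OF _ integral_nonneg_AE])
    fix B assume B[measurable]: "B \<in> sets G2"
    let ?E = "space G1 \<times> B"
    have E: "?E \<in> sets (G1 \<Otimes>\<^sub>M G2)" by simp
    have "(\<integral>w\<in>B. (\<integral>v. p (v, w) \<partial>G1) \<partial>G2) = (\<integral>w. (\<integral>v. indicator ?E (v, w) * p (v, w) \<partial>G1) \<partial>G2)"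
      unfolding set_lebesgue_integral_def
      by (intro Bochner_integral_cong) (auto simp: indicator_def intro!: Bochner_integral_cong)
    also have "\<dots> = (\<integral>z. indicator ?E z * p z \<partial>(G1 \<Otimes>\<^sub>M G2))"
      using PP.integral_snd[of "\<lambda>v w. indicator ?E (v, w) * p (v, w)"] ip[OF E] by (simp add: split_beta')
    also have "\<dots> = (\<integral>z. indicator ?E (T z) * case_prod Q z \<partial>(unit_lborel \<Otimes>\<^sub>M G2))"
      by (rule pE[OF E])
    also have "\<dots> = (\<integral>w. (\<integral>s. indicator ?E (T (s, w)) * Q s w \<partial>unit_lborel) \<partial>G2)"
      using UP.integral_snd[of "\<lambda>s w. indicator ?E (T (s, w)) * Q s w"] iQ[OF E] by (simp add: split_beta')
    also have "\<dots> = (\<integral>w. indicator B w * (\<integral>s. Q s w \<partial>unit_lborel) \<partial>G2)"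
      using measurable_space[OF B1.quantile_measurable]
      by (intro Bochner_integral_cong)
        (auto simp: T_def indicator_def intro!: Bochner_integral_cong)
    finally show "(\<integral>w\<in>B. (\<integral>v. p (v, w) \<partial>G1) \<partial>G2) = (\<integral>w\<in>B. (\<integral>s. Q s w \<partial>unit_lborel) \<partial>G2)"
      by (simp add: set_lebesgue_integral_def)
  qed
  have "AE w in G2. (\<integral>v. p (v, w) \<partial>G1) \<le> 1 - q2 w"
    using cols AE_space by eventually_elim (use Q(3) in auto)
  then show ?thesis
    using rows p p01 by (intro exI[of _ "\<lambda>v w. p (v, w)"]) auto
qed

text \<open>The allocation \<open>p\<close> meets the interim probabilities only almost everywhere,
  while they are prescribed at every value. It is changed on exceptional rows and columns, each of
  which the other bidder's expectation ignores.\<close>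

lemma border_imp_reduced_form:
  assumes q1: "mono_on {lo1..hi1} q1" "q1 \<in> {lo1..hi1} \<rightarrow> {0..1}"
    and q2: "mono_on {lo2..hi2} q2" "q2 \<in> {lo2..hi2} \<rightarrow> {0..1}"
    and border: "border_pair (quantile_allocation G1 q1) (quantile_allocation G2 q2)"
  shows "reduced_form_auction G1 G2 q1 q2"
proof -
  obtain p where pm[measurable]: "case_prod p \<in> borel_measurable (G1 \<Otimes>\<^sub>M G2)"
    and p01: "\<And>v w. p v w \<in> {0..1}"
    and rows: "AE v in G1. (\<integral>w. p v w \<partial>G2) = q1 v"
    and cols: "AE w in G2. (\<integral>v. p v w \<partial>G1) \<le> 1 - q2 w"
    using exists_interim_allocation[OF assms] by blast
  note [measurable] = B1.mono_on_measurable[OF q1(1)] B2.mono_on_measurable[OF q2(1)]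
    B1.envelope_transfer_measurable[OF q1] B2.envelope_transfer_measurable[OF q2]
  have q1r: "q1 v \<in> {0..1}" if "v \<in> space G1" for v using q1(2) that B1.space_G by auto
  have q2r: "q2 w \<in> {0..1}" if "w \<in> space G2" for w using q2(2) that B2.space_G by auto
  define c where "c w = (\<integral>v. p v w \<partial>G1)" for w
  have [measurable]: "c \<in> borel_measurable G2" unfolding c_def by measurable
  define N1 where "N1 = {v \<in> space G1. (\<integral>w. p v w \<partial>G2) \<noteq> q1 v}"
  define N2 where "N2 = {w \<in> space G2. \<not> c w \<le> 1 - q2 w}"
  have [measurable]: "N1 \<in> sets G1" "N2 \<in> sets G2" unfolding N1_def N2_def by measurable
  have N1: "AE v in G1. v \<notin> N1" using rows by eventually_elim (simp add: N1_def)
  have N2: "AE w in G2. w \<notin> N2" using cols by eventually_elim (simp add: N2_def c_def)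
  \<comment> \<open>The fraction of the rest given to bidder 2. If \<open>c w = 1\<close> with
    \<open>w\<close> outside \<open>N2\<close>, then \<open>q2 w = 0\<close>, and division by zero
    returns the right value 0.\<close>
  define k where "k w = q2 w / (1 - c w)" for w
  have [measurable]: "k \<in> borel_measurable G2" unfolding k_def by measurable
  \<comment> \<open>On an exceptional row bidder 1 alone is served, with his prescribed probability;
    on an exceptional column bidder 2 alone; where they cross, nobody. Feasibility thus survives the
    change.\<close>
  define p1 where "p1 v w = (if w \<in> N2 then 0 else if v \<in> N1 then q1 v else p v w)" for v w
  define p2 where "p2 v w = (if v \<in> N1 then 0 else if w \<in> N2 then q2 w else (1 - p v w) * k w)" for v w
  have p1m[measurable]: "case_prod p1 \<in> borel_measurable (G1 \<Otimes>\<^sub>M G2)" unfolding p1_def by measurable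
  have p2m[measurable]: "case_prod p2 \<in> borel_measurable (G1 \<Otimes>\<^sub>M G2)" unfolding p2_def by measurable
  have k01: "0 \<le> k w \<and> k w \<le> 1" if "w \<in> space G2" "w \<notin> N2" for w
    using q2r[OF that(1)] that by (auto simp: k_def N2_def divide_le_eq_1)
  have p1r: "p1 v w \<in> {0..1}" if "v \<in> space G1" "w \<in> space G2" for v w
    using p01[of v w] q1r that by (auto simp: p1_def)
  have p2r: "p2 v w \<in> {0..1}" and sum1: "p1 v w + p2 v w \<le> 1" if "v \<in> space G1" "w \<in> space G2" for v w
  proof -
    have "0 \<le> (1 - p v w) * k w \<and> (1 - p v w) * k w \<le> 1 - p v w" if "w \<notin> N2"
      using p01[of v w] k01[OF \<open>w \<in> space G2\<close> that] by (auto intro: mult_left_le)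
    then show "p2 v w \<in> {0..1}" "p1 v w + p2 v w \<le> 1"
      using p01[of v w] q1r[OF that(1)] q2r[OF that(2)] by (auto simp: p1_def p2_def)
  qed
  have p1row[measurable]: "p1 v \<in> borel_measurable G2" if "v \<in> space G1" for v
    using measurable_Pair2[OF p1m that] by simp
  have p2col[measurable]: "(\<lambda>v. p2 v w) \<in> borel_measurable G1" if "w \<in> space G2" for w
    using measurable_Pair1[OF p2m that] by simp
  have ip1: "integrable G2 (p1 v)" if "v \<in> space G1" for v
    using p1r[OF that] p1row[OF that] by (intro B2.integrable_const_bound[of _ 1]) auto
  have ip2: "integrable G1 (\<lambda>v. p2 v w)" if "w \<in> space G2" for w
    using p2r[OF _ that] p2col[OF that] by (intro B1.integrable_const_bound[of _ 1]) auto
  have row: "(\<integral>w. p1 v w \<partial>G2) = q1 v" if v: "v \<in> space G1" for v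
  proof -
    have [measurable]: "p v \<in> borel_measurable G2" using measurable_Pair2[OF pm v] by simp
    have "(\<integral>w. p1 v w \<partial>G2) = (\<integral>w. (if v \<in> N1 then q1 v else p v w) \<partial>G2)"
    proof (rule integral_cong_AE)
      show "AE w in G2. p1 v w = (if v \<in> N1 then q1 v else p v w)"
        using N2 by eventually_elim (simp add: p1_def)
    qed (use p1row[OF v] in measurable)
    also have "\<dots> = q1 v"
    proof (cases "v \<in> N1")
      case True
      then show ?thesis by (simp add: B2.prob_space)
    next
      case False
      then have "(\<integral>w. p v w \<partial>G2) = q1 v" using v by (simp add: N1_def)
      then show ?thesis using False by simp
    qed
    finally show ?thesis .
  qed
  have col: "(\<integral>v. p2 v w \<partial>G1) = q2 w" if w: "w \<in> space G2" for w
  proof -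
    have pw[measurable]: "(\<lambda>v. p v w) \<in> borel_measurable G1" using measurable_Pair1[OF pm w] by simp
    have ipw: "integrable G1 (\<lambda>v. p v w)"
      using p01 by (intro B1.integrable_const_bound[of _ 1]) auto
    have "(\<integral>v. p2 v w \<partial>G1) = (\<integral>v. (if w \<in> N2 then q2 w else (1 - p v w) * k w) \<partial>G1)"
    proof (rule integral_cong_AE)
      show "AE v in G1. p2 v w = (if w \<in> N2 then q2 w else (1 - p v w) * k w)"
        using N1 by eventually_elim (simp add: p2_def)
    qed (use p2col[OF w] in measurable)
    also have "\<dots> = q2 w"
    proof (cases "w \<in> N2")
      case True
      then show ?thesis by (simp add: B1.prob_space)
    next
      case False
      then have "(\<integral>v. (if w \<in> N2 then q2 w else (1 - p v w) * k w) \<partial>G1) = (1 - c w) * k w"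
        using ipw by (simp add: c_def B1.prob_space)
      also have "\<dots> = q2 w"
        using False w q2r[OF w] by (auto simp: k_def N2_def)
      finally show ?thesis .
    qed
    finally show ?thesis .
  qed
  let ?t1 = "\<lambda>v (w :: real). B1.envelope_transfer q1 v" and ?t2 = "\<lambda>(v :: real) w. B2.envelope_transfer q2 w"
  have "mechanism G1 G2 p1 p2 ?t1 ?t2"
    unfolding mechanism_def
    using p1m p2m p1r p2r sum1
      envelope_mechanism_side[OF B2.prob B1.value_interval_axioms q1 ip1 row]
      envelope_mechanism_side[OF B1.prob B2.value_interval_axioms q2 ip2 col]
    by (intro conjI ballI) (auto simp: split_beta')
  then have "\<exists>p1 p2 t1 t2. mechanism G1 G2 p1 p2 t1 t2 \<and>
      (\<forall>v1\<in>space G1. q1 v1 = (\<integral>v2. p1 v1 v2 \<partial>G2)) \<and>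
      (\<forall>v2\<in>space G2. q2 v2 = (\<integral>v1. p2 v1 v2 \<partial>G1))"
    using row col by (intro exI conjI) auto
  then show ?thesis
    unfolding reduced_form_auction_def using q1(1) q2(1) by (simp add: B1.space_G B2.space_G)
qed

lemma reduced_form_range:
  assumes "reduced_form_auction G1 G2 q1 q2"
  shows "mono_on {lo1..hi1} q1" "q1 \<in> {lo1..hi1} \<rightarrow> {0..1}"
    "mono_on {lo2..hi2} q2" "q2 \<in> {lo2..hi2} \<rightarrow> {0..1}"
proof -
  obtain p1 p2 t1 t2 where m: "mechanism G1 G2 p1 p2 t1 t2"
    and q: "\<And>v. v \<in> space G1 \<Longrightarrow> q1 v = (\<integral>w. p1 v w \<partial>G2)" "\<And>w. w \<in> space G2 \<Longrightarrow> q2 w = (\<integral>v. p2 v w \<partial>G1)"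
    using assms by (auto simp: reduced_form_auction_def)
  have pm: "case_prod p1 \<in> borel_measurable (G1 \<Otimes>\<^sub>M G2)" "case_prod p2 \<in> borel_measurable (G1 \<Otimes>\<^sub>M G2)"
    and r: "\<And>v w. v \<in> space G1 \<Longrightarrow> w \<in> space G2 \<Longrightarrow> p1 v w \<in> {0..1} \<and> p2 v w \<in> {0..1}"
    using m by (auto simp: mechanism_def)
  have "(\<integral>w. p1 v w \<partial>G2) \<in> {0..1}" if v: "v \<in> space G1" for v
  proof -
    have "integrable G2 (p1 v)"
      using r[OF v] measurable_Pair2[OF pm(1) v] by (intro B2.integrable_const_bound[of _ 1]) auto
    then show ?thesis using r[OF v] by (auto intro!: integral_nonneg_AE B2.integral_le_const)
  qed
  moreover have "(\<integral>v. p2 v w \<partial>G1) \<in> {0..1}" if w: "w \<in> space G2" for w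
  proof -
    have "integrable G1 (\<lambda>v. p2 v w)"
      using r[OF _ w] measurable_Pair1[OF pm(2) w] by (intro B1.integrable_const_bound[of _ 1]) auto
    then show ?thesis using r[OF _ w] by (auto intro!: integral_nonneg_AE B1.integral_le_const)
  qed
  ultimately show "q1 \<in> {lo1..hi1} \<rightarrow> {0..1}" "q2 \<in> {lo2..hi2} \<rightarrow> {0..1}"
    using q B1.space_G B2.space_G by auto
  show "mono_on {lo1..hi1} q1" "mono_on {lo2..hi2} q2"
    using assms B1.space_G B2.space_G by (auto simp: reduced_form_auction_def)
qed

text \<open>For a fixed opponent value \<open>w\<close>, bidder 1 wins from quantiles above
  \<open>x\<close> with probability at most \<open>1 - x\<close> and, by feasibility, at most
  \<open>1 - q2 w\<close>, hence at most \<open>1 - max x (q2 w)\<close>. The expectation over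
  \<open>w\<close> is the majorization bound at \<open>x\<close>.\<close>

lemma reduced_form_imp_border:
  assumes rf: "reduced_form_auction G1 G2 q1 q2"
  shows "border_pair (quantile_allocation G1 q1) (quantile_allocation G2 q2)"
proof -
  let ?a = "quantile_allocation G1 q1" and ?b = "quantile_allocation G2 q2"
  interpret U: prob_space unit_lborel by (rule prob_space_unit_lborel)
  interpret UP: pair_prob_space unit_lborel G2 ..
  note qr = reduced_form_range[OF rf]
  note [measurable] = B1.mono_on_measurable[OF qr(1)] B2.mono_on_measurable[OF qr(3)]
    B1.quantile_measurable
  have a: "mono_on {0..1} ?a" "?a \<in> {0..1} \<rightarrow> {0..1}"
    using qr B1.quantile_allocation_mono B1.quantile_allocation_range by auto
  have b: "mono_on {0..1} ?b" "?b \<in> {0..1} \<rightarrow> {0..1}"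
    using qr B2.quantile_allocation_mono B2.quantile_allocation_range by auto
  have q2r: "q2 w \<in> {0..1}" if "w \<in> space G2" for w using qr(4) that B2.space_G by auto
  obtain p1 p2 t1 t2 where m: "mechanism G1 G2 p1 p2 t1 t2"
    and q: "\<And>v. v \<in> space G1 \<Longrightarrow> q1 v = (\<integral>w. p1 v w \<partial>G2)" "\<And>w. w \<in> space G2 \<Longrightarrow> q2 w = (\<integral>v. p2 v w \<partial>G1)"
    using rf by (auto simp: reduced_form_auction_def)
  have pm[measurable]: "case_prod p1 \<in> borel_measurable (G1 \<Otimes>\<^sub>M G2)" "case_prod p2 \<in> borel_measurable (G1 \<Otimes>\<^sub>M G2)"
    and r: "\<And>v w. v \<in> space G1 \<Longrightarrow> w \<in> space G2 \<Longrightarrow>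
      0 \<le> p1 v w \<and> p1 v w \<le> 1 \<and> 0 \<le> p2 v w \<and> p2 v w \<le> 1 \<and> p1 v w + p2 v w \<le> 1"
    using m by (auto simp: mechanism_def)
  have Q1: "quantile G1 s \<in> space G1" if "s \<in> {0..1}" for s
    using measurable_space[OF B1.quantile_measurable, of s] that by simp
  have "integral {x..1} ?a + (\<integral>w. max x (q2 w) \<partial>G2) \<le> 1" if x: "x \<in> {0..1}" for x
  proof -
    let ?F = "\<lambda>s w. indicator {x..1} s * p1 (quantile G1 s) w"
    have Fm[measurable]: "(\<lambda>(s, w). ?F s w) \<in> borel_measurable (unit_lborel \<Otimes>\<^sub>M G2)" by measurable
    have iF: "integrable (unit_lborel \<Otimes>\<^sub>M G2) (\<lambda>(s, w). ?F s w)"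
      using r Q1 by (intro UP.integrable_const_bound[of _ 1] AE_I2 Fm)
        (auto simp: space_pair_measure indicator_def)
    have "integral {x..1} ?a = (\<integral>s. indicator {x..1} s * ?a s \<partial>unit_lborel)"
      using a x mono_on_measurable_unit[OF a(1)]
      by (intro integral_unit_lborel'[symmetric, where C = 1]) (auto simp: Pi_iff)
    also have "\<dots> = (\<integral>s. (\<integral>w. ?F s w \<partial>G2) \<partial>unit_lborel)"
      using q(1) Q1 by (intro Bochner_integral_cong) (auto simp: quantile_allocation_def)
    also have "\<dots> = (\<integral>w. (\<integral>s. ?F s w \<partial>unit_lborel) \<partial>G2)"
      by (rule UP.Fubini_integral[OF iF, symmetric])
    finally have a_eq: "integral {x..1} ?a = (\<integral>w. (\<integral>s. ?F s w \<partial>unit_lborel) \<partial>G2)" .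
    have pw: "(\<integral>s. ?F s w \<partial>unit_lborel) + max x (q2 w) \<le> 1" if w: "w \<in> space G2" for w
    proof -
      have iFw: "integrable unit_lborel (\<lambda>s. ?F s w)"
        using r Q1 w measurable_Pair1[OF Fm w]
        by (intro U.integrable_const_bound[of _ 1] AE_I2) (auto simp: indicator_def)
      have p2w[measurable]: "(\<lambda>v. p2 v w) \<in> borel_measurable G1" using measurable_Pair1[OF pm(2) w] by simp
      have ip2: "integrable unit_lborel (\<lambda>s. p2 (quantile G1 s) w)"
        using r Q1 w by (intro U.integrable_const_bound[of _ 1] AE_I2) auto
      have ii: "integrable unit_lborel (\<lambda>s. indicator {x..1} s :: real)"
        by (intro U.integrable_const_bound[of _ 1] AE_I2) auto
      have "(\<integral>s. ?F s w \<partial>unit_lborel) \<le> (\<integral>s. indicator {x..1} s \<partial>unit_lborel)"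
        using r Q1 w by (intro integral_mono iFw ii) (auto simp: indicator_def)
      also have "\<dots> = 1 - x"
        using x integral_unit_lborel'[of "\<lambda>_. 1" 1 x 1] by simp
      finally have 1: "(\<integral>s. ?F s w \<partial>unit_lborel) + x \<le> 1" by simp
      have "q2 w = (\<integral>s. p2 (quantile G1 s) w \<partial>unit_lborel)"
        using q(2)[OF w] B1.integral_quantile[OF p2w] by simp
      then have "(\<integral>s. ?F s w \<partial>unit_lborel) + q2 w = (\<integral>s. ?F s w + p2 (quantile G1 s) w \<partial>unit_lborel)"
        using iFw ip2 by simp
      also have "\<dots> \<le> (\<integral>s. 1 \<partial>unit_lborel)"
        using iFw ip2 r Q1 w
        by (intro integral_mono Bochner_Integration.integrable_add) (auto simp: indicator_def)
      finally have 2: "(\<integral>s. ?F s w \<partial>unit_lborel) + q2 w \<le> 1" by (simp add: U.prob_space[simplified])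
      show ?thesis using 1 2 by simp
    qed
    have "integral {x..1} ?a + (\<integral>w. max x (q2 w) \<partial>G2) =
        (\<integral>w. (\<integral>s. ?F s w \<partial>unit_lborel) + max x (q2 w) \<partial>G2)"
      unfolding a_eq using UP.integrable_snd[OF iF] x q2r
      by (subst Bochner_Integration.integral_add)
        (auto intro!: B2.integrable_const_bound[of _ 1] AE_I2 simp: abs_le_iff)
    also have "\<dots> \<le> (\<integral>w. 1 \<partial>G2)"
      using UP.integrable_snd[OF iF] x q2r pw
      by (intro integral_mono Bochner_Integration.integrable_add)
        (auto intro!: B2.integrable_const_bound[of _ 1] AE_I2 simp: abs_le_iff)
    finally show ?thesis by (simp add: B2.prob_space)
  qed
  note main = this
  show ?thesis
  proof
    fix x y :: real assume x: "x \<in> {0..1}" and y: "y \<in> {0..1}"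
    have "integral {0..1} (\<lambda>t. max x (?b t)) = (\<integral>t. indicator {0..1} t * max x (?b t) \<partial>unit_lborel)"
      using mono_on_measurable_unit[OF b(1)] b(2) x
      by (intro integral_unit_lborel'[symmetric, where C = 1]) (auto simp: Pi_iff abs_le_iff)
    also have "\<dots> = (\<integral>t. max x (q2 (quantile G2 t)) \<partial>unit_lborel)"
      by (intro Bochner_integral_cong) (auto simp: quantile_allocation_def)
    also have "\<dots> = (\<integral>w. max x (q2 w) \<partial>G2)"
      by (rule B2.integral_quantile) measurable
    finally show "0 \<le> border_slack ?a ?b x y"
      using main[OF x] integral_mono_inverse[OF b x] majorization_gap_le_slack[OF b x y, of ?a] by linarith
  qed (use a b in auto)
qed

lemma reduced_form_iff_border:
  assumes "mono_on {lo1..hi1} q1" "q1 \<in> {lo1..hi1} \<rightarrow> {0..1}"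
    "mono_on {lo2..hi2} q2" "q2 \<in> {lo2..hi2} \<rightarrow> {0..1}"
  shows "reduced_form_auction G1 G2 q1 q2 \<longleftrightarrow>
    border_pair (quantile_allocation G1 q1) (quantile_allocation G2 q2)"
  using border_imp_reduced_form[OF assms] reduced_form_imp_border by blast

end

section \<open>Extreme points\<close>

lemma admissible_shift:
  fixes q :: "real \<Rightarrow> real"
  assumes \<psi>: "admissible \<psi>" and q: "mono_on A q" "q \<in> A \<rightarrow> {0..1}"
  shows "mono_on A (\<lambda>v. q v + \<psi> (q v))" "(\<lambda>v. q v + \<psi> (q v)) \<in> A \<rightarrow> {0..1}"
proof -
  have lip: "\<bar>\<psi> y - \<psi> x\<bar> \<le> y - x" if "x \<le> y" for x y using \<psi> that by (simp add: admissible_def)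
  have ends: "\<psi> 0 = 0" "\<psi> 1 = 0" using \<psi> by (simp_all add: admissible_def)
  show "mono_on A (\<lambda>v. q v + \<psi> (q v))"
  proof (rule mono_onI)
    fix r s assume "r \<in> A" "s \<in> A" "r \<le> s"
    with q(1) have "q r \<le> q s" by (simp add: mono_on_def)
    from lip[OF this] show "q r + \<psi> (q r) \<le> q s + \<psi> (q s)" by linarith
  qed
  show "(\<lambda>v. q v + \<psi> (q v)) \<in> A \<rightarrow> {0..1}"
  proof
    fix v assume "v \<in> A"
    with q(2) have "0 \<le> q v" "q v \<le> 1" by auto
    with lip[of 0 "q v"] lip[of "q v" 1] ends show "q v + \<psi> (q v) \<in> {0..1}"
      by (auto simp: abs_le_iff)
  qed
qed

lemma admissible_uminus: "admissible \<psi> \<Longrightarrow> admissible (\<lambda>z. - \<psi> z)"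
  using admissible_scale[of \<psi> "- 1"] by simp

lemma (in border_pair) border_pair_shift:
  assumes "admissible \<psi>" "admissible \<phi>"
    and "\<And>x y. x \<in> {0..1} \<Longrightarrow> y \<in> {0..1} \<Longrightarrow>
      integral {x..1} (\<lambda>s. \<psi> (f s)) + integral {y..1} (\<lambda>s. \<phi> (g s)) \<le> border_slack f g x y"
  shows "border_pair (\<lambda>s. f s + \<psi> (f s)) (\<lambda>s. g s + \<phi> (g s))"
proof -
  interpret s: border_pair g f by (rule swap)
  show ?thesis
  proof
    fix x y :: real assume x: "x \<in> {0..1}" and y: "y \<in> {0..1}"
    have "integral {x..1} (\<lambda>s. f s + \<psi> (f s)) = integral {x..1} f + integral {x..1} (\<lambda>s. \<psi> (f s))"
      using x f_int adm_int[OF assms(1)] by (intro Henstock_Kurzweil_Integration.integral_add) auto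
    moreover have "integral {y..1} (\<lambda>s. g s + \<phi> (g s)) = integral {y..1} g + integral {y..1} (\<lambda>s. \<phi> (g s))"
      using y s.f_int s.adm_int[OF assms(2)] by (intro Henstock_Kurzweil_Integration.integral_add) auto
    ultimately show "0 \<le> border_slack (\<lambda>s. f s + \<psi> (f s)) (\<lambda>s. g s + \<phi> (g s)) x y"
      using assms(3)[OF x y] by (simp add: border_slack_def)
  qed (use admissible_shift[OF assms(1) mono_f range_f] admissible_shift[OF assms(2) mono_g range_g] in auto)
qed

text \<open>Equality of the two ends of the segment means \<open>\<psi> (f s) = 0\<close> almost
  everywhere. Measurability comes from the difference of two monotone functions, as for
  integrability.\<close>

lemma ae_equal_shift_imp_integral_zero:
  assumes f: "mono_on {0..1} f" "f \<in> {0..1} \<rightarrow> {0..1}" and \<psi>: "admissible \<psi>"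
    and eq: "(\<lambda>s. f s + \<psi> (f s)) \<equiv>\<^sub>a\<^sub>e (\<lambda>s. f s - \<psi> (f s))"
  shows "integral {0..1} (\<lambda>s. \<bar>\<psi> (f s)\<bar>) = 0"
proof -
  note sh = admissible_shift[OF \<psi> f]
  have [measurable]: "f \<in> borel_measurable unit_lborel" "(\<lambda>s. f s + \<psi> (f s)) \<in> borel_measurable unit_lborel"
    using mono_on_measurable_unit f(1) sh(1) by auto
  have "(\<lambda>s. \<bar>(f s + \<psi> (f s)) - f s\<bar>) \<in> borel_measurable unit_lborel" by measurable
  then have m: "(\<lambda>s. \<bar>\<psi> (f s)\<bar>) \<in> borel_measurable unit_lborel" by simp
  have "\<bar>\<bar>\<psi> (f s)\<bar>\<bar> \<le> 1" if "s \<in> {0..1}" for s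
    using f(2) sh(2) that by (force simp: Pi_iff abs_le_iff)
  then have "integral {0..1} (\<lambda>s. \<bar>\<psi> (f s)\<bar>) = (\<integral>s. indicator {0..1} s * \<bar>\<psi> (f s)\<bar> \<partial>unit_lborel)"
    by (intro integral_unit_lborel'[symmetric, OF m]) auto
  moreover have "AE s in unit_lborel. indicator {0..1} s * \<bar>\<psi> (f s)\<bar> = 0"
    using eq unfolding ae_equal_def by (subst AE_restrict_space_iff) auto
  then have "(\<integral>s. indicator {0..1} s * \<bar>\<psi> (f s)\<bar> \<partial>unit_lborel) = 0"
    by (rule integral_eq_zero_AE)
  ultimately show ?thesis by simp
qed

context two_bidders
begin

text \<open>The perturbation is applied to \<open>q1\<close> and \<open>q2\<close>; composition with
  the quantile functions turns it into the same perturbation of \<open>r1\<close> and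
  \<open>r2\<close>. The ends of the segment are thus quantile allocations of genuine reduced forms,
  atoms or not.\<close>

lemma extreme_point_rigid:
  assumes ext: "ae_extreme_point (r1, r2) (reduced_form_quantile_pairs G1 G2)"
  shows "rigid_pair r1 r2"
proof -
  obtain q1 q2 where r: "r1 = quantile_allocation G1 q1" "r2 = quantile_allocation G2 q2"
    and rf: "reduced_form_auction G1 G2 q1 q2"
    using ext by (auto simp: ae_extreme_point_def reduced_form_quantile_pairs_def)
  note q = reduced_form_range[OF rf]
  interpret border_pair r1 r2
    unfolding r by (rule reduced_form_imp_border[OF rf])
  interpret s: border_pair r2 r1 by (rule swap)
  have member: "((\<lambda>s. r1 s + \<psi> (r1 s)), (\<lambda>s. r2 s + \<phi> (r2 s))) \<in> reduced_form_quantile_pairs G1 G2"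
    if "admissible \<psi>" "admissible \<phi>"
      "\<And>x y. x \<in> {0..1} \<Longrightarrow> y \<in> {0..1} \<Longrightarrow>
        integral {x..1} (\<lambda>s. \<psi> (r1 s)) + integral {y..1} (\<lambda>s. \<phi> (r2 s)) \<le> border_slack r1 r2 x y" for \<psi> \<phi>
  proof -
    let ?q1 = "\<lambda>v. q1 v + \<psi> (q1 v)" and ?q2 = "\<lambda>v. q2 v + \<phi> (q2 v)"
    have eq: "quantile_allocation G1 ?q1 = (\<lambda>s. r1 s + \<psi> (r1 s))"
      "quantile_allocation G2 ?q2 = (\<lambda>s. r2 s + \<phi> (r2 s))"
      by (auto simp: r quantile_allocation_def)
    have "reduced_form_auction G1 G2 ?q1 ?q2"
      using border_pair_shift[OF that] admissible_shift[OF that(1) q(1,2)] admissible_shift[OF that(2) q(3,4)]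
      by (intro border_imp_reduced_form) (auto simp: eq)
    then show ?thesis
      unfolding reduced_form_quantile_pairs_def eq[symmetric] by blast
  qed
  show ?thesis
  proof
    fix \<psi> \<phi> :: "real \<Rightarrow> real"
    assume adm: "admissible \<psi>" "admissible \<phi>"
      and le: "\<And>x y. x \<in> {0..1} \<Longrightarrow> y \<in> {0..1} \<Longrightarrow>
        \<bar>integral {x..1} (\<lambda>s. \<psi> (r1 s)) + integral {y..1} (\<lambda>s. \<phi> (r2 s))\<bar> \<le> border_slack r1 r2 x y"
    let ?a = "((\<lambda>s. r1 s + \<psi> (r1 s)), (\<lambda>s. r2 s + \<phi> (r2 s)))"
    let ?b = "((\<lambda>s. r1 s + - \<psi> (r1 s)), (\<lambda>s. r2 s + - \<phi> (r2 s)))"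
    have segment: "fst a \<equiv>\<^sub>a\<^sub>e fst b \<and> snd a \<equiv>\<^sub>a\<^sub>e snd b"
      if "a \<in> reduced_form_quantile_pairs G1 G2" "b \<in> reduced_form_quantile_pairs G1 G2" "0 < u" "u < 1"
        "fst (r1, r2) \<equiv>\<^sub>a\<^sub>e (\<lambda>s. (1 - u) * fst a s + u * fst b s)"
        "snd (r1, r2) \<equiv>\<^sub>a\<^sub>e (\<lambda>s. (1 - u) * snd a s + u * snd b s)" for a b u
      using ext that unfolding ae_extreme_point_def by blast
    have a: "?a \<in> reduced_form_quantile_pairs G1 G2"
      using le by (intro member adm) (auto simp: abs_le_iff)
    have b: "?b \<in> reduced_form_quantile_pairs G1 G2"
    proof (intro member admissible_uminus adm)
      fix x y :: real assume "x \<in> {0..1}" "y \<in> {0..1}"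
      then show "integral {x..1} (\<lambda>s. - \<psi> (r1 s)) + integral {y..1} (\<lambda>s. - \<phi> (r2 s)) \<le> border_slack r1 r2 x y"
        using le[of x y] by simp
    qed
    have mid: "fst (r1, r2) \<equiv>\<^sub>a\<^sub>e (\<lambda>s. (1 - 1 / 2) * fst ?a s + 1 / 2 * fst ?b s)"
      "snd (r1, r2) \<equiv>\<^sub>a\<^sub>e (\<lambda>s. (1 - 1 / 2) * snd ?a s + 1 / 2 * snd ?b s)"
      by (simp_all add: ae_equal_def field_simps)
    have "fst ?a \<equiv>\<^sub>a\<^sub>e fst ?b \<and> snd ?a \<equiv>\<^sub>a\<^sub>e snd ?b"
      by (rule segment[OF a b _ _ mid]) simp_all
    then show "integral {0..1} (\<lambda>s. \<bar>\<psi> (r1 s)\<bar>) = 0 \<and> integral {0..1} (\<lambda>s. \<bar>\<phi> (r2 s)\<bar>) = 0"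
      using ae_equal_shift_imp_integral_zero[OF mono_f range_f adm(1)]
        ae_equal_shift_imp_integral_zero[OF mono_g range_g adm(2)] by simp
  qed
qed

end

theorem proposition14:
  fixes lo1 hi1 lo2 hi2 :: real and G1 G2 :: "real measure"
  assumes "value_distribution lo1 hi1 G1"
    and "value_distribution lo2 hi2 G2"
  shows "(\<forall>q1 q2 :: real \<Rightarrow> real.
            mono_on {lo1..hi1} q1 \<and> q1 \<in> {lo1..hi1} \<rightarrow> {0..1} \<and>
            mono_on {lo2..hi2} q2 \<and> q2 \<in> {lo2..hi2} \<rightarrow> {0..1} \<longrightarrow>
            (reduced_form_auction G1 G2 q1 q2 \<longleftrightarrow>
             quantile_allocation G1 q1 \<preceq>\<^sub>w mono_inverse (quantile_allocation G2 q2)))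
       \<and> (\<forall>r1 r2 :: real \<Rightarrow> real.
            ae_extreme_point (r1, r2) (reduced_form_quantile_pairs G1 G2) \<longrightarrow>
            (\<exists>k1\<in>{0..1}. \<exists>k2\<in>{0..1}.
               r1 \<equiv>\<^sub>a\<^sub>e (\<lambda>s. mono_inverse r2 s * indicator {k1..1} s) \<and>
               r2 \<equiv>\<^sub>a\<^sub>e (\<lambda>s. mono_inverse r1 s * indicator {k2..1} s)))"
proof -
  interpret two_bidders lo1 hi1 G1 lo2 hi2 G2
    using assms by (simp add: two_bidders_def value_interval_def)
  show ?thesis
  proof (intro conjI allI impI)
    fix q1 q2 :: "real \<Rightarrow> real"
    assume q: "mono_on {lo1..hi1} q1 \<and> q1 \<in> {lo1..hi1} \<rightarrow> {0..1} \<and>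
      mono_on {lo2..hi2} q2 \<and> q2 \<in> {lo2..hi2} \<rightarrow> {0..1}"
    then show "reduced_form_auction G1 G2 q1 q2 \<longleftrightarrow>
        quantile_allocation G1 q1 \<preceq>\<^sub>w mono_inverse (quantile_allocation G2 q2)"
      by (simp add: reduced_form_iff_border weakly_majorized_iff_border
          B1.quantile_allocation_mono B1.quantile_allocation_range
          B2.quantile_allocation_mono B2.quantile_allocation_range)
  next
    fix r1 r2 :: "real \<Rightarrow> real"
    assume "ae_extreme_point (r1, r2) (reduced_form_quantile_pairs G1 G2)"
    then show "\<exists>k1\<in>{0..1}. \<exists>k2\<in>{0..1}.
        r1 \<equiv>\<^sub>a\<^sub>e (\<lambda>s. mono_inverse r2 s * indicator {k1..1} s) \<and>
        r2 \<equiv>\<^sub>a\<^sub>e (\<lambda>s. mono_inverse r1 s * indicator {k2..1} s)"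
      by (intro rigid_pair.rigid_inverse extreme_point_rigid)
  qed
qed

end
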